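(* Let $q=2$. Let $A=\begin{pmatrix}a_{11} & a_{12} \\ a_{21} & 0\end{pmatrix}$ with entries in $\mathbb{C}_\infty$, $\operatorname{ord}a_{11}=-1$, $a_{12}\neq0$, $a_{21}\neq0$, and put $u=\operatorname{ord}a_{12}$, $v=\operatorname{ord}a_{21}$. If $v\le-\frac43$ and $-2u-4\le v\le-2u-3$, then $h^1(M(A))=4$.
   Context: Let $q=2$ and $\theta$ a variable. $\mathbb{C}_\infty$ is the completion of an algebraic closure of the completion of $\mathbb{F}_q(\theta)$ at the valuation at infinity $\operatorname{ord}$, normalized by $\operatorname{ord}\theta=-1$ (and $\operatorname{ord}0=+\infty$). $\mathbb{C}_\infty[T,\tau]$ is the ring of non-commutative polynomials with relations $Ta=aT$, $T\tau=\tau T$, $\tau a=a^q\tau$ for $a\in\mathbb{C}_\infty$; $\mathbb{C}_\infty\{\tau\}$ is the subring generated over $\mathbb{C}_\infty$ by $\tau$. For a $2\times2$ matrix $A$ over $\mathbb{C}_\infty$, $M(A)$ is the left $\mathbb{C}_\infty[T,\tau]$-module (Anderson t-motive of dimension 2 and rank 4) which is free over $\mathbb{C}_\infty\{\tau\}$ with basis $e_1,e_2$, where multiplication by $T$ is given, for the column $e_*=(e_1,e_2)^t$, by $Te_*=\theta e_*+A\tau e_*+\tau^2e_*$. It is free of rank 4 over $\mathbb{C}_\infty[T]$. $\mathbb{C}_\infty\{T\}$ is the ring of power series $\sum_{i\ge0}a_iT^i$ with $a_i\in\mathbb{C}_\infty$, $a_i\to0$, on which $\tau$ acts by $\tau(\sum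 a_iT^i)=\sum a_i^qT^i$. On $M\otimes_{\mathbb{C}_\infty[T]}\mathbb{C}_\infty\{T\}$, $\tau$ acts by $\tau(m\otimes f)=\tau(m)\otimes\tau(f)$. $H^1(M)$ is the $\mathbb{F}_q[T]$-module of $\tau$-invariant elements of $M\otimes_{\mathbb{C}_\infty[T]}\mathbb{C}_\infty\{T\}$; it is free, and $h^1(M)$ is its rank over $\mathbb{F}_q[T]$. *)

theory Defs
  imports
    "HOL-Analysis.Analysis"
    "HOL-Computational_Algebra.Polynomial_FPS"
    "HOL-Algebra.Free_Abelian_Groups"
    "HOL-Algebra.Module"
begin

text \<open>Throughout \<open>q = 2\<close>, so that \<open>F_q = {0, 1}\<close> inside any field of characteristic 2.\<close>

section \<open>The field \<open>C_\<infinity>\<close>\<close>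

definition ord_closure :: "('a::field \<Rightarrow> ereal) \<Rightarrow> 'a set \<Rightarrow> 'a set" where
  "ord_closure ord S = {x. \<forall>K::real. \<exists>s\<in>S. ord (x - s) > ereal K}"

definition ord_Cauchy :: "('a::field \<Rightarrow> ereal) \<Rightarrow> (nat \<Rightarrow> 'a) \<Rightarrow> bool" where
  "ord_Cauchy ord X \<longleftrightarrow> (\<forall>K::real. \<exists>N. \<forall>m\<ge>N. \<forall>n\<ge>N. ord (X m - X n) > ereal K)"

definition F2_poly :: "'a::field poly set" where
  "F2_poly = {p. \<forall>i. Polynomial.coeff p i \<in> {0, 1}}"

definition F2_rat :: "'a::field \<Rightarrow> 'a set" where
  "F2_rat \<theta> = {poly p \<theta> / poly r \<theta> | p r. p \<in> F2_poly \<and> r \<in> F2_poly \<and> poly r \<theta> \<noteq> 0}"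

definition K_inf :: "('a::field \<Rightarrow> ereal) \<Rightarrow> 'a \<Rightarrow> 'a set" where
  "K_inf ord \<theta> = ord_closure ord (F2_rat \<theta>)"

definition K_inf_alg :: "('a::field \<Rightarrow> ereal) \<Rightarrow> 'a \<Rightarrow> 'a set" where
  "K_inf_alg ord \<theta> =
     {x. \<exists>p. p \<noteq> 0 \<and> (\<forall>i. Polynomial.coeff p i \<in> K_inf ord \<theta>) \<and> poly p x = 0}"

text \<open>
  The type \<open>'a\<close> with the valuation \<open>ord\<close> and the element \<open>\<theta>\<close> is a completion of an algebraic
  closure of the completion of \<open>F_2(\<theta>)\<close> at infinity. The tower
  \<open>F_2(\<theta>) \<subseteq> K_\<infinity> \<subseteq> L \<subseteq> C_\<infinity>\<close> is realised by subsets of \<open>'a\<close>: as \<open>'a\<close> is complete, the closure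
  \<open>K_inf\<close> of \<open>F_2(\<theta>)\<close> is its completion; \<open>L = K_inf_alg\<close>, the set of elements algebraic over it, is
  required to be algebraically closed; and \<open>L\<close> is dense in the complete field \<open>'a\<close>.
  The valuation laws and \<open>ord \<theta> = -1\<close> force \<open>\<theta>\<close> to be transcendental over \<open>F_2\<close> and \<open>ord\<close> to restrict
  to minus the degree on \<open>F_2(\<theta>)\<close>, and they determine \<open>ord\<close> everywhere.
\<close>

locale C_infinity =
  fixes ord :: "'a::field \<Rightarrow> ereal" and \<theta> :: 'a
  assumes char_2: "CHAR('a) = 2"
    and ord_eq_infinity_iff: "ord x = \<infinity> \<longleftrightarrow> x = 0"
    and ord_neq_minus_infinity: "ord x \<noteq> -\<infinity>"
    and ord_mult: "ord (x * y) = ord x + ord y"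
    and ord_add: "ord (x + y) \<ge> min (ord x) (ord y)"
    and ord_theta: "ord \<theta> = -1"
    and complete: "ord_Cauchy ord X \<Longrightarrow> \<exists>l. (\<lambda>n. ord (X n - l)) \<longlonglongrightarrow> \<infinity>"
    and K_inf_alg_closed:
      "Polynomial.degree p > 0 \<Longrightarrow> (\<And>i. Polynomial.coeff p i \<in> K_inf_alg ord \<theta>) \<Longrightarrow>
         \<exists>x\<in>K_inf_alg ord \<theta>. poly p x = 0"
    and K_inf_alg_dense: "ord_closure ord (K_inf_alg ord \<theta>) = UNIV"


section \<open>The Anderson t-motive \<open>M(A)\<close>\<close>

text \<open>
  An element \<open>\<Sum>i. c_i \<tau>^i\<close> of \<open>C_\<infinity>{\<tau>}\<close> is stored as the polynomial with coefficients \<open>c_i\<close>;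
  the product is the twisted one, \<open>(a \<tau>^i) (b \<tau>^j) = a b^(2^i) \<tau>^(i+j)\<close>, not that of \<open>'a poly\<close>.
\<close>

definition skew_mult :: "'a::field poly \<Rightarrow> 'a poly \<Rightarrow> 'a poly" where
  "skew_mult p r =
     (\<Sum>i\<le>Polynomial.degree p. \<Sum>j\<le>Polynomial.degree r.
        Polynomial.monom (Polynomial.coeff p i * Polynomial.coeff r j ^ (2 ^ i)) (i + j))"

text \<open>
  \<open>M(A)\<close> is the type \<open>'a poly ^ 2\<close> of coordinates over \<open>C_\<infinity>{\<tau>}\<close> with respect to \<open>e_1, e_2\<close>.
  The action of \<open>T\<close> is the \<open>C_\<infinity>{\<tau>}\<close>-linear map with \<open>T e_* = \<theta> e_* + A \<tau> e_* + \<tau>\<^sup>2 e_*\<close>.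
\<close>

definition skew_act :: "'a::field poly \<Rightarrow> 'a poly ^ 2 \<Rightarrow> 'a poly ^ 2" where
  "skew_act p m = (\<chi> k. skew_mult p (m $ k))"

definition motive_e :: "2 \<Rightarrow> 'a::field poly ^ 2" where
  "motive_e j = axis j 1"

definition motive_Te :: "'a::field \<Rightarrow> 'a ^ 2 ^ 2 \<Rightarrow> 2 \<Rightarrow> 'a poly ^ 2" where
  "motive_Te \<theta> A j =
     skew_act [:\<theta>:] (motive_e j) + (\<Sum>k\<in>UNIV. skew_act [:0, A $ j $ k:] (motive_e k))
       + skew_act [:0, 0, 1:] (motive_e j)"

definition motive_T :: "'a::field \<Rightarrow> 'a ^ 2 ^ 2 \<Rightarrow> 'a poly ^ 2 \<Rightarrow> 'a poly ^ 2" where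
  "motive_T \<theta> A m = (\<Sum>j\<in>UNIV. skew_act (m $ j) (motive_Te \<theta> A j))"

definition motive_tau :: "'a::field poly ^ 2 \<Rightarrow> 'a poly ^ 2" where
  "motive_tau = skew_act [:0, 1:]"

text \<open>Here \<open>p\<close> is an ordinary polynomial, an element of \<open>C_\<infinity>[T]\<close>.\<close>

definition motive_poly_act :: "'a::field \<Rightarrow> 'a ^ 2 ^ 2 \<Rightarrow> 'a poly \<Rightarrow> 'a poly ^ 2 \<Rightarrow> 'a poly ^ 2" where
  "motive_poly_act \<theta> A p m =
     (\<Sum>i\<le>Polynomial.degree p. skew_act [:Polynomial.coeff p i:] ((motive_T \<theta> A ^^ i) m))"


section \<open>The ring \<open>C_\<infinity>{T}\<close>\<close>

definition tate :: "('a::field \<Rightarrow> ereal) \<Rightarrow> 'a fps set" where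
  "tate ord = {f. (\<lambda>i. ord (fps_nth f i)) \<longlonglongrightarrow> \<infinity>}"

definition tate_tau :: "'a::field fps \<Rightarrow> 'a fps" where
  "tate_tau f = Abs_fps (\<lambda>i. fps_nth f i ^ 2)"

definition tate_poly_act :: "'a::field poly \<Rightarrow> 'a fps \<Rightarrow> 'a fps" where
  "tate_poly_act p f = fps_of_poly p * f"


section \<open>Tensor products\<close>

text \<open>
  The tensor product of a module with underlying type \<open>'m\<close> and a module with carrier \<open>N\<close> over the
  commutative ring \<open>'r\<close>, as the quotient of the free abelian group on \<open>UNIV \<times> N\<close> by the subgroup
  generated by the bilinearity relations; its elements are cosets.
\<close>

definition tensor_free :: "'n set \<Rightarrow> ('m \<times> 'n \<Rightarrow>\<^sub>0 int) monoid" where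
  "tensor_free N = free_Abelian_group (UNIV \<times> N)"

definition tensor_relations ::
  "('r \<Rightarrow> 'm \<Rightarrow> 'm) \<Rightarrow> ('r \<Rightarrow> 'n \<Rightarrow> 'n) \<Rightarrow> 'n set
     \<Rightarrow> ('m::ab_group_add \<times> 'n::ab_group_add \<Rightarrow>\<^sub>0 int) set" where
  "tensor_relations actM actN N = generate (tensor_free N)
     ({frag_of (m + m', f) - frag_of (m, f) - frag_of (m', f) | m m' f. f \<in> N} \<union>
      {frag_of (m, f + f') - frag_of (m, f) - frag_of (m, f') | m f f'. f \<in> N \<and> f' \<in> N} \<union>
      {frag_of (actM r m, f) - frag_of (m, actN r f) | r m f. f \<in> N})"

definition tensor_group ::
  "('r \<Rightarrow> 'm \<Rightarrow> 'm) \<Rightarrow> ('r \<Rightarrow> 'n \<Rightarrow> 'n) \<Rightarrow> 'n set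
     \<Rightarrow> ('m::ab_group_add \<times> 'n::ab_group_add \<Rightarrow>\<^sub>0 int) set monoid" where
  "tensor_group actM actN N = tensor_free N Mod tensor_relations actM actN N"

text \<open>
  The additive map \<open>m \<otimes> f \<mapsto> g m \<otimes> h f\<close>. The union is over all representatives of the coset \<open>X\<close>;
  whenever the map is well defined, all of them contribute the same coset.
\<close>

definition tensor_map ::
  "('r \<Rightarrow> 'm \<Rightarrow> 'm) \<Rightarrow> ('r \<Rightarrow> 'n \<Rightarrow> 'n) \<Rightarrow> 'n set \<Rightarrow> ('m \<Rightarrow> 'm) \<Rightarrow> ('n \<Rightarrow> 'n)
     \<Rightarrow> ('m::ab_group_add \<times> 'n::ab_group_add \<Rightarrow>\<^sub>0 int) set
     \<Rightarrow> ('m \<times> 'n \<Rightarrow>\<^sub>0 int) set" where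
  "tensor_map actM actN N g h X =
     (\<Union>x\<in>X. tensor_relations actM actN N
        #>\<^bsub>tensor_free N\<^esub> frag_extend (\<lambda>(m, f). frag_of (g m, h f)) x)"


section \<open>\<open>H\<^sup>1(M)\<close> and \<open>h\<^sup>1(M)\<close>\<close>

definition F2_poly_ring :: "'a::field poly ring" where
  "F2_poly_ring = \<lparr>carrier = F2_poly, monoid.mult = (*), one = 1, ring.zero = 0, add = (+)\<rparr>"

text \<open>The \<open>F_2[T]\<close>-module of \<open>\<tau>\<close>-invariants; module records also have multiplicative ring
  components, which play no role.\<close>

definition H1 ::
  "('a::field \<Rightarrow> ereal) \<Rightarrow> 'a \<Rightarrow> 'a ^ 2 ^ 2
     \<Rightarrow> ('a poly, (('a poly ^ 2) \<times> 'a fps \<Rightarrow>\<^sub>0 int) set) module" where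
  "H1 ord \<theta> A =
     (let actM = motive_poly_act \<theta> A; N = tate ord; G = tensor_group actM tate_poly_act N in
      \<lparr>carrier = {X \<in> carrier G. tensor_map actM tate_poly_act N motive_tau tate_tau X = X},
       monoid.mult = undefined, one = undefined,
       ring.zero = \<one>\<^bsub>G\<^esub>, add = (\<otimes>\<^bsub>G\<^esub>),
       smult = (\<lambda>p. tensor_map actM tate_poly_act N id (tate_poly_act p))\<rparr>)"

definition finite_module_basis ::
  "('r, 'k) ring_scheme \<Rightarrow> ('r, 'b, 'l) module_scheme \<Rightarrow> 'b set \<Rightarrow> bool" where
  "finite_module_basis R M B \<longleftrightarrow> finite B \<and> B \<subseteq> carrier M \<and>
     (\<forall>x\<in>carrier M. \<exists>!c. c \<in> B \<rightarrow>\<^sub>E carrier R \<and> x = (\<Oplus>\<^bsub>M\<^esub>b\<in>B. c b \<odot>\<^bsub>M\<^esub> b))"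

definition free_module_rank :: "('r, 'k) ring_scheme \<Rightarrow> ('r, 'b, 'l) module_scheme \<Rightarrow> nat" where
  "free_module_rank R M = (THE n. \<exists>B. finite_module_basis R M B \<and> card B = n)"

definition h1 :: "('a::field \<Rightarrow> ereal) \<Rightarrow> 'a \<Rightarrow> 'a ^ 2 ^ 2 \<Rightarrow> nat" where
  "h1 ord \<theta> A = free_module_rank F2_poly_ring (H1 ord \<theta> A)"

end

theory Submission
  imports Defs "HOL-Real_Asymp.Real_Asymp"
begin

text \<open>
  In the coordinates \<open>e\<^sub>j\<close>, \<open>\<tau> e\<^sub>j\<close> of \<open>M(A)\<close> over \<open>C_\<infinity>[T]\<close>, an invariant is determined by its
  \<open>\<tau> e\<^sub>j\<close>-coordinates \<open>Z = \<Sum>\<^sub>n (x\<^sub>n, y\<^sub>n) T\<^sup>n\<close>, which have to satisfy \<open>x\<^sub>n, y\<^sub>n \<rightarrow> 0\<close> and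
  \<open>\<theta>\<^sup>2 x\<^sub>n\<^sup>4 + a11 x\<^sub>n\<^sup>2 + a21 y\<^sub>n\<^sup>2 + x\<^sub>n = x\<^sub>n\<^sub>-\<^sub>1\<^sup>4\<close>,
  \<open>\<theta>\<^sup>2 y\<^sub>n\<^sup>4 + a12 x\<^sub>n\<^sup>2 + y\<^sub>n = y\<^sub>n\<^sub>-\<^sub>1\<^sup>4\<close>. Eliminating \<open>x\<^sub>n\<close> leaves a separable additive polynomial of
  degree 16 in \<open>y\<^sub>n\<close>, so there are 16 possible constant terms \<open>(x\<^sub>0, y\<^sub>0)\<close>. The hypotheses on \<open>u\<close> and
  \<open>v\<close> make the coefficient of \<open>y\<^sub>n\<^sup>4\<close> so large that it forces a root \<open>y\<^sub>n\<close> of large valuation: from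
  \<open>n = 1\<close> on, the lower bound gains \<open>7/8\<close> at every step. Hence every constant term extends to an
  invariant, and \<open>H\<^sup>1 / T H\<^sup>1\<close> has \<open>2\<^sup>4\<close> elements. Finally \<open>H\<^sup>1\<close> is free: lifts of a basis of
  \<open>H\<^sup>1 / T H\<^sup>1\<close> chosen successively of minimal degree, the degree of an invariant being measured by
  the last coefficient that is not small, form a basis.
\<close>

section \<open>Valuations and algebraic closedness\<close>

text \<open>Two obstacles precede the argument. \<open>C_infinity\<close> postulates algebraic
  closedness only for the dense subset \<open>K_inf_alg ord \<theta>\<close>; that of the whole
  field, on which all root counts depend, has to be derived from completeness. And the tensor
  product is a literal quotient of a free abelian group, so its elements must first be identified
  with vectors of power series.

  The forcing of a large root is a Newton polygon argument. The coefficient of y^4 has order 2v; if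
  the constant coefficient has order at least 2v + 4 \<mu>, there is a root of order at least \<mu>.
  What remains is to bound the constant coefficient, which depends on the preceding coefficients x,
  y of the invariant.

  Freeness rests on discreteness: only finitely many constant terms occur, so a threshold on the
  order separates the nonzero ones from 0, and an invariant whose coefficients all lie beyond it
  vanishes. Division by T lowers the degree defined by this threshold, so expansions in the chosen
  lifts terminate.\<close>

context C_infinity
begin

section \<open>Characteristic 2 and the laws of the valuation\<close>

lemma ord_0 [simp]: "ord 0 = \<infinity>"
  by (simp add: ord_eq_infinity_iff)

lemma two_eq_0: "(2::'a) = 0"
  using of_nat_CHAR[where 'a='a] char_2 by simp

lemma add_self [simp]: "x + x = (0::'a)"
  using two_eq_0 by (metis mult_2 mult_zero_left)

lemma uminus_eq: "- x = (x::'a)"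
  by (rule minus_unique) simp

lemma diff_eq_add: "x - y = x + (y::'a)"
  by (metis uminus_eq add_uminus_conv_diff)

lemma ord_diff: "ord (x - y) \<ge> min (ord x) (ord y)"
  using ord_add[of x y] by (simp add: diff_eq_add)

lemma ord_diff_commute: "ord (x - y) = ord (y - x)"
  by (simp add: diff_eq_add add.commute)

lemma ord_nonzero: assumes "x \<noteq> 0" obtains a where "ord x = ereal a"
  using assms ord_eq_infinity_iff[of x] ord_neq_minus_infinity[of x] by (cases "ord x") auto

lemma ord_1 [simp]: "ord 1 = 0"
proof -
  obtain a where a: "ord 1 = ereal a" using ord_nonzero[of 1] by auto
  have "ord (1*1) = ord 1 + ord 1" by (rule ord_mult)
  then show ?thesis using a by simp
qed

lemma ord_mult_ge: "ereal a \<le> ord x \<Longrightarrow> ereal b \<le> ord y \<Longrightarrow> ereal (a + b) \<le> ord (x * y)"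
  by (metis add_mono ord_mult plus_ereal.simps(1))

lemma ord_add_ge: "a \<le> ord x \<Longrightarrow> a \<le> ord y \<Longrightarrow> a \<le> ord (x + y)"
  using ord_add[of x y] by (metis min.bounded_iff order_trans)

lemma ord_diff_ge: "a \<le> ord x \<Longrightarrow> a \<le> ord y \<Longrightarrow> a \<le> ord (x - y)"
  by (simp add: diff_eq_add ord_add_ge)

lemma ord_add_gt: "a < ord x \<Longrightarrow> a < ord y \<Longrightarrow> a < ord (x + y)"
  using ord_add[of x y] by (metis min_less_iff_conj order_less_le_trans)

lemma ord_sum_ge: "(\<And>i. i \<in> I \<Longrightarrow> a \<le> ord (f i)) \<Longrightarrow> a \<le> ord (sum f I)"
  by (induction I rule: infinite_finite_induct) (auto intro: ord_add_ge)

lemma ord_power: "ord x = ereal a \<Longrightarrow> ord (x ^ n) = ereal (real n * a)"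
  by (induction n) (auto simp: ord_mult algebra_simps)

lemma ord_power_ge: "ereal a \<le> ord x \<Longrightarrow> ereal (real n * a) \<le> ord (x ^ n)"
proof (induction n)
  case (Suc n)
  then show ?case using ord_mult_ge[of a x "real n * a" "x^n"] by (simp add: algebra_simps)
qed auto

lemma ord_divide:
  assumes "ord y = ereal b" "ord x = ereal a"
  shows "ord (x / y) = ereal (a - b)"
proof -
  have "y \<noteq> 0" using assms by auto
  then have "ord x = ord (x / y) + ord y" by (metis ord_mult nonzero_divide_eq_eq)
  then show ?thesis using assms by (cases "ord (x / y)") auto
qed

lemma ord_divide_ge:
  assumes "ord y = ereal b" "ereal a \<le> ord x"
  shows "ereal (a - b) \<le> ord (x / y)"
proof (cases "x = 0")
  case False
  then obtain c where "ord x = ereal c" by (rule ord_nonzero)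
  then show ?thesis using assms by (simp add: ord_divide)
qed auto

lemma ord_sum_eq:
  assumes "ord x < ord y" shows "ord (x + y) = ord x"
proof -
  have "min (ord (x + y)) (ord y) \<le> ord x"
    using ord_diff[of "x + y" y] by (simp only: add_diff_cancel_right')
  then show ?thesis using ord_add[of x y] assms by (auto simp: min_def split: if_splits)
qed

lemma char2_power2: "(x + y) ^ 2 = x ^ 2 + (y::'a) ^ 2"
  using two_eq_0 by (simp add: power2_sum)

lemma char2_power4: "(x + y) ^ 4 = x ^ 4 + (y::'a) ^ 4"
proof -
  have "(x + y) ^ 4 = ((x + y) ^ 2) ^ 2" by (simp flip: power_mult)
  then show ?thesis by (simp add: char2_power2 flip: power_mult)
qed

lemma char2_power2_inj: "x ^ 2 = y ^ 2 \<Longrightarrow> x = (y::'a)"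
  by (metis power2_eq_iff uminus_eq)

section \<open>Algebraic closedness of the whole field\<close>

lemma zero_one_in_K_inf_alg: "c \<in> {0, 1} \<Longrightarrow> c \<in> K_inf_alg ord \<theta>"
proof -
  assume c: "c \<in> {0, 1}"
  have rat: "d \<in> F2_rat \<theta>" if "d \<in> {0, 1}" for d :: 'a
    unfolding F2_rat_def mem_Collect_eq
    by (rule exI[of _ "[:d:]"], rule exI[of _ 1])
       (use that in \<open>auto simp: F2_poly_def coeff_pCons split: nat.splits\<close>)
  have kinf: "d \<in> K_inf ord \<theta>" if "d \<in> {0, 1}" for d :: 'a
    using rat[OF that] unfolding K_inf_def ord_closure_def by (auto intro!: bexI[of _ d])
  \<comment> \<open>In characteristic 2 the polynomial X + c has the root c.\<close>
  have "poly [:c, 1:] c = 0" by simp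
  moreover have "Polynomial.coeff [:c, 1:] i \<in> K_inf ord \<theta>" for i
    by (rule kinf) (use c in \<open>auto simp: coeff_pCons split: nat.splits\<close>)
  ultimately show "c \<in> K_inf_alg ord \<theta>"
    unfolding K_inf_alg_def by (intro CollectI exI[of _ "[:c, 1:]"]) auto
qed

lemma K_inf_alg_approx: "\<exists>c\<in>K_inf_alg ord \<theta>. ereal K < ord (x - c)"
  using K_inf_alg_dense unfolding ord_closure_def by blast

text \<open>A root of an approximation with coefficients in \<open>K_inf_alg ord \<theta>\<close>
  splits off a linear factor, and the induction continues with the quotient. It runs over all monic
  polynomials of the field, so that nothing has to be known about the coefficients of the
  quotient.\<close>

lemma approx_split_poly:
  fixes p :: "'a poly"
  assumes "lead_coeff p = 1"
  shows "\<exists>rs. length rs = Polynomial.degree p \<and>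
    (\<forall>i. ereal K < ord (Polynomial.coeff (p - (\<Prod>r\<leftarrow>rs. [:- r, 1:])) i))"
  using assms
proof (induction "Polynomial.degree p" arbitrary: p K)
  case 0
  then obtain c where "p = [:c:]" by (metis degree_eq_zeroE)
  then have "p = 1" using 0 by (simp add: one_pCons)
  then show ?case by (intro exI[of _ "[]"]) simp
next
  case (Suc n p)
  have "\<exists>c. \<forall>i. c i \<in> K_inf_alg ord \<theta> \<and> ereal K < ord (Polynomial.coeff p i - c i)"
  proof (intro choice allI)
    show "\<exists>c. c \<in> K_inf_alg ord \<theta> \<and> ereal K < ord (Polynomial.coeff p i - c)" for i
      using K_inf_alg_approx[of K "Polynomial.coeff p i"] by blast
  qed
  then obtain c where c: "\<And>i. c i \<in> K_inf_alg ord \<theta>"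
    and cK: "\<And>i. ereal K < ord (Polynomial.coeff p i - c i)" by blast
  \<comment> \<open>Only the coefficients below the leading one are approximated; keeping the
    leading 1 and the zeros above it preserves monicity and degree.\<close>
  define d where "d = (\<lambda>i. if i \<le> n then c i else if i = Suc n then 1 else 0)"
  define pt where "pt = Abs_poly d"
  have coeff_pt: "Polynomial.coeff pt = d" unfolding pt_def
    by (rule coeff_Abs_poly[of "Suc n"]) (simp add: d_def)
  have deg_pt: "Polynomial.degree pt = Suc n"
    by (rule antisym) (auto intro!: degree_le le_degree simp: coeff_pt d_def)
  have "d i \<in> K_inf_alg ord \<theta>" for i
    using c zero_one_in_K_inf_alg[of 0] zero_one_in_K_inf_alg[of 1] by (simp add: d_def)
  then obtain s where s: "poly pt s = 0"
    using K_inf_alg_closed[of pt] by (auto simp: deg_pt coeff_pt)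
  then obtain q where q: "pt = [:- s, 1:] * q" using poly_eq_0_iff_dvd by blast
  have "q \<noteq> 0" using q deg_pt by auto
  then have dq: "n = Polynomial.degree q" using q deg_pt
    by (subst (asm) q, subst (asm) degree_mult_eq) auto
  have "lead_coeff pt = 1" unfolding deg_pt by (simp add: coeff_pt d_def)
  then have lq: "lead_coeff q = 1" unfolding q by (subst (asm) lead_coeff_mult) simp
  \<comment> \<open>Multiplication by s lowers the order of the error of the quotient by at most -b,
    so the quotient is approximated to precision K - b. The choice b \<le> 0 also covers the error
    that is multiplied by X instead of s.\<close>
  obtain b where b: "b \<le> 0" "ereal b \<le> ord s"
  proof (cases "s = 0")
    case False
    then obtain a where "ord s = ereal a" by (rule ord_nonzero)
    then show ?thesis using that[of "min a 0"] by simp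
  qed (use that[of 0] in auto)
  obtain rs where rs: "length rs = n"
    "\<And>i. ereal (K - b) < ord (Polynomial.coeff (q - (\<Prod>r\<leftarrow>rs. [:- r, 1:])) i)"
    using Suc.hyps(1)[OF dq lq, of "K - b"] dq by metis
  define e where "e = q - (\<Prod>r\<leftarrow>rs. [:- r, 1:])"
  have e: "ereal (K - b) < ord (Polynomial.coeff e i)" for i using rs(2) e_def by simp
  have eK: "ereal K < ord (Polynomial.coeff e i)" for i
  proof -
    have "ereal K \<le> ereal (K - b)" using b(1) by simp
    then show ?thesis using e[of i] by (rule order_le_less_trans)
  qed
  have esK: "ereal K < ord (s * Polynomial.coeff e i)" for i
  proof (cases "s * Polynomial.coeff e i = 0")
    case False
    then obtain a c where "ord s = ereal a" "ord (Polynomial.coeff e i) = ereal c"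
      by (metis mult_eq_0_iff ord_nonzero)
    then show ?thesis using e[of i] b by (simp add: ord_mult)
  next
    case True then show ?thesis by (simp only: ord_0 less_ereal.simps)
  qed
  have "ereal K < ord (Polynomial.coeff (p - (\<Prod>r\<leftarrow>s # rs. [:- r, 1:])) i)" for i
  proof -
    have "p - (\<Prod>r\<leftarrow>s # rs. [:- r, 1:]) = (p - pt) + [:- s, 1:] * e"
      by (simp add: q e_def algebra_simps)
    then have "Polynomial.coeff (p - (\<Prod>r\<leftarrow>s # rs. [:- r, 1:])) i =
      Polynomial.coeff ((p - pt) + [:- s, 1:] * e) i" by (simp only:)
    also have "\<dots> = (Polynomial.coeff p i - d i) + (- s * Polynomial.coeff e i + (case i of 0 \<Rightarrow> 0 | Suc j \<Rightarrow> Polynomial.coeff e j))"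
      by (simp add: coeff_pt coeff_pCons)
    finally have "Polynomial.coeff (p - (\<Prod>r\<leftarrow>s # rs. [:- r, 1:])) i =
      (Polynomial.coeff p i - d i) + (- s * Polynomial.coeff e i + (case i of 0 \<Rightarrow> 0 | Suc j \<Rightarrow> Polynomial.coeff e j))" .
    moreover have "ereal K < ord (Polynomial.coeff p i - d i)"
      using cK[of i] Suc.hyps(2) Suc.prems by (auto simp: d_def coeff_eq_0)
    moreover have "ereal K < ord (case i of 0 \<Rightarrow> 0 | Suc j \<Rightarrow> Polynomial.coeff e j)"
      using eK by (cases i) auto
    ultimately show ?thesis using esK[of i]
      by (simp only: mult_minus_left uminus_eq) (intro ord_add_gt)
  qed
  then show ?case using rs(1) Suc.hyps(2) by (intro exI[of _ "s # rs"]) auto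
qed

lemma ord_poly_ge:
  assumes "\<And>i. ereal c \<le> ord (Polynomial.coeff p i)" and "ereal m \<le> ord x" and "m \<le> 0"
    and "Polynomial.degree p \<le> n"
  shows "ereal (c + real n * m) \<le> ord (poly p x)"
proof -
  have "ereal (c + real n * m) \<le> ord (Polynomial.coeff p i * x ^ i)" if "i \<le> n" for i
  proof -
    have "real n * m \<le> real i * m" using that assms(3) by (simp add: mult_right_mono_neg)
    then have "ereal (c + real n * m) \<le> ereal (c + real i * m)" by simp
    also have "\<dots> \<le> ord (Polynomial.coeff p i * x ^ i)"
      by (intro ord_mult_ge ord_power_ge assms)
    finally show ?thesis .
  qed
  then show ?thesis using assms(4) unfolding poly_altdef by (intro ord_sum_ge) auto
qed

text \<open>If ord x = a < m \<le> 0, every lower term has order at least m + (n - 1) a > n a = ord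
  (x ^ n), so the lower terms cannot cancel x ^ n.\<close>

lemma ord_root_ge:
  assumes "lead_coeff p = 1" and m: "\<And>i. ereal m \<le> ord (Polynomial.coeff p i)" "m \<le> 0"
    and root: "poly p x = 0"
  shows "ereal m \<le> ord x"
proof (rule ccontr)
  assume *: "\<not> ereal m \<le> ord x"
  then have "x \<noteq> 0" by auto
  then obtain a where a: "ord x = ereal a" by (rule ord_nonzero)
  have am: "a < m" using * a by simp
  define n where "n = Polynomial.degree p"
  have "n \<noteq> 0"
  proof
    assume "n = 0"
    then obtain c where "p = [:c:]" unfolding n_def by (metis degree_eq_zeroE)
    then show False using root assms(1) by simp
  qed
  have "poly p x = (\<Sum>i<n. Polynomial.coeff p i * x ^ i) + x ^ n"
    using assms(1) by (simp add: poly_altdef n_def lessThan_Suc_atMost[symmetric])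
  then have eq: "x ^ n = (\<Sum>i<n. Polynomial.coeff p i * x ^ i)"
    using root by (metis add_eq_0_iff uminus_eq)
  have "ereal (m + real (n - 1) * a) \<le> ord (Polynomial.coeff p i * x ^ i)" if "i < n" for i
  proof -
    have "real (n - 1) * a \<le> real i * a" using that am m(2) by (intro mult_right_mono_neg) auto
    then have "ereal (m + real (n - 1) * a) \<le> ereal (m + real i * a)" by simp
    also have "\<dots> \<le> ord (Polynomial.coeff p i * x ^ i)"
      by (intro ord_mult_ge ord_power_ge m) (simp add: a)
    finally show ?thesis .
  qed
  then have "ereal (m + real (n - 1) * a) \<le> ord (x ^ n)" unfolding eq by (intro ord_sum_ge) auto
  then have "m + real (n - 1) * a \<le> real n * a" using a by (simp add: ord_power)
  then show False using am \<open>n \<noteq> 0\<close> by (cases n) (auto simp: algebra_simps)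
qed

lemma lead_coeff_prod_linear:
  "lead_coeff (\<Prod>r\<leftarrow>rs. [:- r, 1::'a:]) = 1 \<and> Polynomial.degree (\<Prod>r\<leftarrow>rs. [:- r, 1::'a:]) = length rs"
proof (induction rs)
  case (Cons r rs)
  let ?q = "\<Prod>r\<leftarrow>rs. [:- r, 1::'a:]"
  have "?q \<noteq> 0" using Cons by (metis lead_coeff_pCons(2) leading_coeff_0_iff zero_neq_one)
  then have "Polynomial.degree ([:- r, 1:] * ?q) = Suc (length rs)"
    using Cons by (subst degree_mult_eq) auto
  moreover have "lead_coeff ([:- r, 1:] * ?q) = 1"
    unfolding lead_coeff_mult Cons.IH[THEN conjunct1] by simp
  ultimately show ?case unfolding list.map prod_list.Cons list.size
    by (intro conjI) (simp_all only: add_Suc_right add_0_right)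
qed simp

lemma poly_prod_linear: "poly (\<Prod>r\<leftarrow>rs. [:- r, 1::'a:]) x = (\<Prod>r\<leftarrow>rs. x - r)"
proof (induction rs)
  case (Cons r rs)
  then show ?case by (simp only: list.map prod_list.Cons poly_mult) simp
qed simp

text \<open>Pigeonhole for orders: factors of order below t, n in number, have a product of order
  below n t.\<close>

lemma close_root:
  assumes "ereal (real (length rs) * t) \<le> ord (\<Prod>r\<leftarrow>rs. x - r)" "rs \<noteq> []"
  shows "\<exists>r\<in>set rs. ereal t \<le> ord (x - r)"
proof (rule ccontr)
  assume "\<not> ?thesis"
  then have *: "ord (x - r) < ereal t" if "r \<in> set rs" for r using that by force
  have "ord (\<Prod>r\<leftarrow>rs. x - r) < ereal (real (length rs) * t)"
    using assms(2) *
  proof (induction rs rule: list_nonempty_induct)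
    case (single r) then show ?case by simp
  next
    case (cons r rs)
    have "ord (x - r) < ereal t" "ord (\<Prod>r\<leftarrow>rs. x - r) < ereal (real (length rs) * t)"
      using cons by auto
    then have "ord (x - r) + ord (\<Prod>r\<leftarrow>rs. x - r) < ereal t + ereal (real (length rs) * t)"
      using ord_neq_minus_infinity
      by (intro ereal_add_strict_mono2) auto
    then show ?case by (simp add: ord_mult distrib_right)
  qed
  then show False using assms(1) by simp
qed

text \<open>Applied to the limit \<open>l\<close> in \<open>alg_closed\<close>: one factor is the
  small difference to the chosen root, the others are bounded only by m.\<close>

lemma ord_prod_ge:
  assumes "\<And>s. s \<in> set rs \<Longrightarrow> ereal m \<le> ord (x - s)" "r \<in> set rs" "ereal t \<le> ord (x - r)"
  shows "ereal (t + (real (length rs) - 1) * m) \<le> ord (\<Prod>s\<leftarrow>rs. x - s)"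
proof -
  have all: "ereal (real (length ys) * m) \<le> ord (\<Prod>s\<leftarrow>ys. x - s)"
    if "\<And>s. s \<in> set ys \<Longrightarrow> ereal m \<le> ord (x - s)" for ys
    using that
  proof (induction ys)
    case (Cons y ys)
    have "ereal (m + real (length ys) * m) \<le> ord ((x - y) * (\<Prod>s\<leftarrow>ys. x - s))"
      by (intro ord_mult_ge Cons.IH) (use Cons.prems in auto)
    then show ?case by (simp add: algebra_simps)
  qed auto
  obtain ys zs where rs: "rs = ys @ r # zs" using assms(2) by (meson split_list)
  have "ereal (real (length ys) * m + (t + real (length zs) * m)) \<le>
    ord ((\<Prod>s\<leftarrow>ys. x - s) * ((x - r) * (\<Prod>s\<leftarrow>zs. x - s)))"
    by (intro ord_mult_ge all assms) (auto simp: rs intro: assms)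
  then show ?thesis by (simp add: rs algebra_simps)
qed

lemma poly_coeffs_ord_bounded:
  obtains m where "m \<le> 0" "\<And>i. ereal m \<le> ord (Polynomial.coeff p i)"
proof -
  have "\<exists>m\<le>0. \<forall>i<n. ereal m \<le> ord (Polynomial.coeff p i)" for n
  proof (induction n)
    case (Suc n)
    then obtain m where m: "m \<le> 0" "\<And>i. i < n \<Longrightarrow> ereal m \<le> ord (Polynomial.coeff p i)" by blast
    obtain b where b: "ereal b \<le> ord (Polynomial.coeff p n)"
    proof (cases "Polynomial.coeff p n = 0")
      case False
      then obtain b where "ord (Polynomial.coeff p n) = ereal b" by (rule ord_nonzero)
      then show ?thesis by (intro that[of b]) simp
    qed (use that[of 0] in simp)
    have "ereal (min m b) \<le> ord (Polynomial.coeff p i)" if "i < Suc n" for i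
    proof (cases "i = n")
      case True
      have "ereal (min m b) \<le> ereal b" by simp
      then show ?thesis using b True by (metis order_trans)
    next
      case False
      have "ereal (min m b) \<le> ereal m" by simp
      then show ?thesis using m(2)[of i] False that by (metis order_trans less_SucE)
    qed
    then show ?case using m(1) by (intro exI[of _ "min m b"]) auto
  qed auto
  then obtain m where m: "m \<le> 0" "\<And>i. i < Suc (Polynomial.degree p) \<Longrightarrow> ereal m \<le> ord (Polynomial.coeff p i)"
    by blast
  then have "ereal m \<le> ord (Polynomial.coeff p i)" for i
    by (cases "i \<le> Polynomial.degree p") (auto simp: coeff_eq_0)
  then show ?thesis using that m(1) by blast
qed

text \<open>Roots of ever better split approximations of a polynomial are chosen close to one another;
  their limit is a root.\<close>

theorem alg_closed:
  fixes p :: "'a poly"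
  assumes "Polynomial.degree p > 0"
  shows "\<exists>x. poly p x = 0"
proof -
  define p' where "p' = Polynomial.smult (inverse (lead_coeff p)) p"
  define n where "n = Polynomial.degree p"
  have n: "n > 0" "Polynomial.degree p' = n" using assms by (auto simp: n_def p'_def)
  have lp: "lead_coeff p' = 1" using assms by (auto simp: p'_def)
  obtain m where m: "m \<le> 0" "\<And>i. ereal m \<le> ord (Polynomial.coeff p' i)"
    using poly_coeffs_ord_bounded[of p'] by blast
  obtain rs where len: "\<And>k. length (rs k) = n" and
    rs: "\<And>k i. ereal (real k) < ord (Polynomial.coeff (p' - (\<Prod>r\<leftarrow>rs k. [:- r, 1:])) i)"
  proof -
    have "\<forall>k. \<exists>rs. length rs = n \<and>
      (\<forall>i. ereal (real k) < ord (Polynomial.coeff (p' - (\<Prod>r\<leftarrow>rs. [:- r, 1:])) i))"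
      using approx_split_poly[OF lp] unfolding n by blast
    then show ?thesis using that by (auto dest!: choice)
  qed
  define q where "q = (\<lambda>k. \<Prod>r\<leftarrow>rs k. [:- r, 1:])"
  have q: "lead_coeff (q k) = 1" "Polynomial.degree (q k) = n" for k
    using lead_coeff_prod_linear[of "rs k"] len[of k] by (auto simp: q_def)
  have pq: "ereal (real k) \<le> ord (Polynomial.coeff (p' - q k) i)" for k i
    using rs[of k i] unfolding q_def by simp
  have qm: "ereal m \<le> ord (Polynomial.coeff (q k) i)" for k i
  proof -
    have "ereal m \<le> ord (Polynomial.coeff p' i - Polynomial.coeff (p' - q k) i)"
    proof (rule ord_diff_ge[OF m(2)])
      have "ereal m \<le> ereal (real k)" using m(1) by simp
      then show "ereal m \<le> ord (Polynomial.coeff (p' - q k) i)" using pq order_trans by blast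
    qed
    then show ?thesis by simp
  qed
  have roots_m: "ereal m \<le> ord r" if "r \<in> set (rs k)" for r k
  proof (rule ord_root_ge[OF q(1) qm m(1)])
    show "poly (q k) r = 0" using that by (auto simp: q_def poly_prod_linear prod_list_zero_iff)
  qed
  have near: "ereal (real k + real n * m) \<le> ord (poly (p' - q k) x)" if "ereal m \<le> ord x" for k x
    using that by (intro ord_poly_ge pq m(1)) (auto intro!: degree_diff_le simp: q n)
  \<comment> \<open>At a root of \<open>q k\<close> the value of \<open>q (Suc k)\<close> is a
    difference of two approximation errors, hence small. Sharing this smallness among n linear
    factors is the reason for the quotient by n.\<close>
  have step: "\<exists>r'\<in>set (rs (Suc k)). ereal (real k / real n + m) \<le> ord (r - r')"
    if r: "r \<in> set (rs k)" for k r
  proof (rule close_root)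
    have "poly (q k) r = 0" using r by (auto simp: q_def poly_prod_linear prod_list_zero_iff)
    then have "poly (q (Suc k)) r = poly (p' - q k) r - poly (p' - q (Suc k)) r" by simp
    moreover have "ereal (real k + real n * m) \<le> ord (poly (p' - q k) r - poly (p' - q (Suc k)) r)"
    proof (rule ord_diff_ge)
      show "ereal (real k + real n * m) \<le> ord (poly (p' - q k) r)"
        by (intro near roots_m[OF r])
      have "ereal (real k + real n * m) \<le> ereal (real (Suc k) + real n * m)" by simp
      also have "\<dots> \<le> ord (poly (p' - q (Suc k)) r)" by (intro near roots_m[OF r])
      finally show "ereal (real k + real n * m) \<le> ord (poly (p' - q (Suc k)) r)" .
    qed
    ultimately show "ereal (real (length (rs (Suc k))) * (real k / real n + m)) \<le>
      ord (\<Prod>r'\<leftarrow>rs (Suc k). r - r')"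
      using n(1) by (simp add: q_def poly_prod_linear len algebra_simps)
    show "rs (Suc k) \<noteq> []" using len[of "Suc k"] n(1) by auto
  qed
  have "\<exists>f. \<forall>k. f k \<in> set (rs k) \<and> ereal (real k / real n + m) \<le> ord (f k - f (Suc k))"
  proof (rule dependent_nat_choice)
    show "\<exists>x. x \<in> set (rs 0)" using len[of 0] n(1) by (cases "rs 0") auto
  qed (use step in blast)
  then obtain f where f: "\<And>k. f k \<in> set (rs k)"
    "\<And>k. ereal (real k / real n + m) \<le> ord (f k - f (Suc k))" by blast
  have cauchy: "ereal (real k / real n + m) \<le> ord (f k - f (k + j))" for k j
  proof (induction j)
    case (Suc j)
    have "ereal (real k / real n + m) \<le> ereal (real (k + j) / real n + m)"
      by (simp add: divide_right_mono)
    also have "\<dots> \<le> ord (f (k + j) - f (Suc (k + j)))" by (rule f)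
    finally have "ereal (real k / real n + m) \<le> ord ((f k - f (k + j)) + (f (k + j) - f (Suc (k + j))))"
      by (intro ord_add_ge Suc.IH)
    then show ?case by simp
  qed simp
  have Cau: "ord_Cauchy ord f"
    unfolding ord_Cauchy_def
  proof
    fix K :: real
    obtain N :: nat where N: "real N > (K - m) * real n" using reals_Archimedean2 by blast
    then have NK: "K < real N / real n + m" using n(1) by (simp add: field_simps)
    have "ord (f a - f b) > ereal K" if "a \<ge> N" "b \<ge> N" for a b
    proof -
      have "ereal (real N / real n + m) \<le> ord (f N - f a)" "ereal (real N / real n + m) \<le> ord (f N - f b)"
        using cauchy[of N "a - N"] cauchy[of N "b - N"] that by auto
      then have "ereal (real N / real n + m) \<le> ord ((f N - f b) - (f N - f a))" by (rule ord_diff_ge[rotated])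
      then have "ereal (real N / real n + m) \<le> ord (f a - f b)" by simp
      moreover have "ereal K < ereal (real N / real n + m)" using NK by simp
      ultimately show ?thesis by (rule order_less_le_trans[rotated])
    qed
    then show "\<exists>N. \<forall>a\<ge>N. \<forall>b\<ge>N. ord (f a - f b) > ereal K" by blast
  qed
  obtain l where l: "(\<lambda>k. ord (f k - l)) \<longlonglongrightarrow> \<infinity>" using complete[OF Cau] by blast
  have lk: "ereal (real k / real n + m) \<le> ord (l - f k)" for k
  proof -
    have "\<forall>\<^sub>F j in sequentially. ord (f j - l) > ereal (real k / real n + m)"
      using l by (simp add: tendsto_PInfty)
    then obtain N where N: "\<And>j. j \<ge> N \<Longrightarrow> ord (f j - l) > ereal (real k / real n + m)"
      unfolding eventually_sequentially by blast
    have "ereal (real k / real n + m) \<le> ord ((f k - f (k + N)) + (f (k + N) - l))"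
      using N[of "k + N"] by (intro ord_add_ge cauchy) auto
    then show ?thesis by (simp add: ord_diff_commute)
  qed
  have lm: "ereal m \<le> ord l"
  proof -
    have "ereal m \<le> ord ((l - f 0) + f 0)"
      using lk[of 0] by (intro ord_add_ge roots_m[OF f(1)]) simp
    then show ?thesis by simp
  qed
  have "ereal (real k / real n + real n * m) \<le> ord (poly p' l)" for k
  proof -
    have "ereal ((real k / real n + m) + (real (length (rs k)) - 1) * m) \<le> ord (\<Prod>s\<leftarrow>rs k. l - s)"
      using f(1) lk lm roots_m by (intro ord_prod_ge[of _ _ _ "f k"]) (auto intro: ord_diff_ge)
    then have 1: "ereal (real k / real n + real n * m) \<le> ord (poly (q k) l)"
      by (simp add: q_def poly_prod_linear len algebra_simps)
    have "real k * 1 \<le> real k * real n" using n(1) by (intro mult_left_mono) auto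
    then have "real k / real n \<le> real k" using n(1) by (simp add: field_simps)
    then have "ereal (real k / real n + real n * m) \<le> ereal (real k + real n * m)" by simp
    also have "\<dots> \<le> ord (poly (p' - q k) l)" by (rule near[OF lm])
    finally have "ereal (real k / real n + real n * m) \<le> ord (poly (p' - q k) l + poly (q k) l)"
      by (intro ord_add_ge 1)
    then show ?thesis by simp
  qed
  note big = this
  have "poly p' l = 0"
  proof (rule ccontr)
    assume "poly p' l \<noteq> 0"
    then obtain a where a: "ord (poly p' l) = ereal a" by (rule ord_nonzero)
    obtain k :: nat where "real k > (a - real n * m) * real n" using reals_Archimedean2 by blast
    then have "a < real k / real n + real n * m" using n(1) by (simp add: field_simps)
    then show False using big[of k] a by simp
  qed
  then have "poly p l = 0" using assms by (auto simp: p'_def)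
  then show ?thesis ..
qed

section \<open>Square roots, root counts and the Newton polygon\<close>

lemma exists_sqrt: "\<exists>x. x ^ 2 = (a::'a)"
proof -
  obtain x where "poly [:- a, 0, 1:] x = 0" using alg_closed[of "[:- a, 0, 1:]"] by auto
  then show ?thesis by (intro exI[of _ x]) (simp add: power2_eq_square algebra_simps)
qed

text \<open>For a root r and p = (X - r) q, separability makes q(r) = p'(r) nonzero, so r is not
  counted again among the roots of q.\<close>

lemma card_roots_separable:
  fixes p :: "'a poly"
  assumes "\<And>x. poly p x = 0 \<Longrightarrow> poly (pderiv p) x \<noteq> 0" "p \<noteq> 0"
  shows "card {x. poly p x = 0} = Polynomial.degree p"
  using assms
proof (induction "Polynomial.degree p" arbitrary: p)
  case 0
  then obtain c where "p = [:c:]" by (metis degree_eq_zeroE)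
  then show ?case using 0 by auto
next
  case (Suc n)
  obtain r where r: "poly p r = 0" using alg_closed[of p] Suc.hyps(2) by auto
  then obtain q where q: "p = [:- r, 1:] * q" using poly_eq_0_iff_dvd by blast
  have q0: "q \<noteq> 0" using q Suc.prems by auto
  have n: "n = Polynomial.degree q" using Suc.hyps(2) q0 unfolding q by (subst (asm) degree_mult_eq) auto
  have pd: "poly (pderiv p) x = poly q x + (x - r) * poly (pderiv q) x" for x
    unfolding q by (simp only: pderiv_mult) (simp add: pderiv_pCons algebra_simps)
  have rq: "poly q r \<noteq> 0" using Suc.prems(1)[OF r] pd[of r] by simp
  have "poly (pderiv q) x \<noteq> 0" if "poly q x = 0" for x
    using Suc.prems(1)[of x] pd[of x] that q by auto
  then have "card {x. poly q x = 0} = n" using Suc.hyps(1)[OF n _ q0] n by simp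
  moreover have "{x. poly p x = 0} = insert r {x. poly q x = 0}" by (auto simp: q)
  ultimately show ?case using rq Suc.hyps(2) poly_roots_finite[OF q0] by simp
qed

text \<open>Up to the factor \<open>poly p 0\<close>, p is the product of the 1 - x/r over its roots
  r, and each 1/r has order above -t. So the coefficient of x^k, relative to
  \<open>poly p 0\<close>, has order above -k t. The induction multiplies in one factor at a
  time.\<close>

lemma coeff_ord_gt_of_roots_ord_lt:
  fixes p :: "'a poly"
  assumes "\<And>x. poly p x = 0 \<Longrightarrow> ord x < ereal t" "p \<noteq> 0" "k > 0"
  shows "ord (Polynomial.coeff p k) + ereal (real k * t) > ord (poly p 0) \<and> poly p 0 \<noteq> 0"
  using assms
proof (induction "Polynomial.degree p" arbitrary: p k)
  case 0
  then obtain c where "p = [:c:]" by (metis degree_eq_zeroE)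
  then have c: "p = [:c:]" "c \<noteq> 0" "Polynomial.coeff p k = 0"
    using 0 by (auto simp: coeff_pCons split: nat.splits)
  from c(2) obtain a where "ord c = ereal a" by (rule ord_nonzero)
  then show ?case using c by simp
next
  case (Suc n)
  obtain r where r: "poly p r = 0" using alg_closed[of p] Suc.hyps(2) by auto
  then obtain q where q: "p = [:- r, 1:] * q" using poly_eq_0_iff_dvd by blast
  have q0: "q \<noteq> 0" using q Suc.prems by auto
  have n: "n = Polynomial.degree q" using Suc.hyps(2) q0 unfolding q by (subst (asm) degree_mult_eq) auto
  have roots: "ord x < ereal t" if "poly q x = 0" for x using that Suc.prems(1)[of x] q by simp
  note IH = Suc.hyps(1)[OF n roots q0]
  have "r \<noteq> 0" using Suc.prems(1)[OF r] by auto
  then obtain a where a: "ord r = ereal a" by (rule ord_nonzero)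
  have at: "a < t" using Suc.prems(1)[OF r] a by simp
  have "poly q 0 \<noteq> 0" using IH[of 1] by simp
  then obtain b where b: "ord (poly q 0) = ereal b" by (rule ord_nonzero)
  have p0: "ord (poly p 0) = ereal (a + b)" by (simp add: q ord_mult a b uminus_eq)
  obtain j where j: "k = Suc j" using Suc.prems(3) by (cases k) auto
  have "Polynomial.coeff p k = r * Polynomial.coeff q k + Polynomial.coeff q j"
    by (simp add: q j uminus_eq)
  moreover have "ereal (a + b - real k * t) < ord (r * Polynomial.coeff q k)"
    using IH[of k] Suc.prems(3) by (cases "ord (Polynomial.coeff q k)") (auto simp: ord_mult a b)
  moreover have "ereal (a + b - real k * t) < ord (Polynomial.coeff q j)"
  proof (cases "j = 0")
    case True
    then show ?thesis using at b by (simp add: j poly_0_coeff_0)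
  next
    case False
    then show ?thesis using IH[of j] at
      by (cases "ord (Polynomial.coeff q j)") (auto simp: b j algebra_simps)
  qed
  ultimately have *: "ereal (a + b - real k * t) < ord (Polynomial.coeff p k)"
    using ord_add_gt by metis
  then have "ord (poly p 0) < ord (Polynomial.coeff p k) + ereal (real k * t)"
    unfolding p0 by (cases "ord (Polynomial.coeff p k)") auto
  then show ?case using \<open>r \<noteq> 0\<close> \<open>poly q 0 \<noteq> 0\<close> by (simp add: q)
qed

text \<open>Contrapositive of the previous estimate; this is what produces the next coefficient of
  an invariant.\<close>

lemma root_with_ord_ge:
  fixes p :: "'a poly"
  assumes "ereal c \<le> ord (poly p 0)" "ord (Polynomial.coeff p k) = ereal d" "k > 0"
  shows "\<exists>x. poly p x = 0 \<and> ereal ((c - d) / real k) \<le> ord x"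
proof (rule ccontr)
  assume *: "\<not> ?thesis"
  have "p \<noteq> 0" using assms(2) by auto
  then have "ord (poly p 0) < ord (Polynomial.coeff p k) + ereal (real k * ((c - d) / real k))"
    using * assms(3) by (intro coeff_ord_gt_of_roots_ord_lt[THEN conjunct1]) force+
  then show False using assms by simp
qed

end

section \<open>The recurrence for the coefficients of an invariant\<close>

locale motive_7p5 = C_infinity ord \<theta> for ord :: "'a::field \<Rightarrow> ereal" and \<theta> +
  fixes a11 a12 a21 :: 'a and u v :: real
  assumes ord_a11: "ord a11 = -1" and ord_a12: "ord a12 = ereal u" and ord_a21: "ord a21 = ereal v"
    and v_le: "v \<le> -4/3" and v_ge: "-2*u - 4 \<le> v" and v_le_u: "v \<le> -2*u - 3"
begin

text \<open>(X, Y) stands for the coefficient of T^(n-1) and (x, y) for that of T^n; the constant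
  term is the case X = Y = 0.\<close>

definition recurrence :: "'a \<Rightarrow> 'a \<Rightarrow> 'a \<Rightarrow> 'a \<Rightarrow> bool" where
  "recurrence X Y x y \<longleftrightarrow>
     \<theta>^2 * x^4 + a11 * x^2 + a21 * y^2 + x = X^4 \<and> \<theta>^2 * y^4 + a12 * x^2 + y = Y^4"

text \<open>The result of inserting x^2 = (\<theta>^2 y^4 + y + Y^4) / a12 into the square of the
  first equation. The part free of y is collected in R, and \<open>elim_const X Y\<close> is its
  value.\<close>

definition elim_poly :: "'a \<Rightarrow> 'a poly" where
  "elim_poly R = Polynomial.monom (\<theta>^12 / a12^4) 16 + Polynomial.monom (a11^2 * \<theta>^4 / a12^2) 8
     + Polynomial.monom (\<theta>^4 / a12^4 + \<theta>^2 / a12 + a21^2) 4 + Polynomial.monom (a11^2 / a12^2) 2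
     + Polynomial.monom (1 / a12) 1 + Polynomial.monom R 0"

definition elim_const :: "'a \<Rightarrow> 'a \<Rightarrow> 'a" where
  "elim_const X Y = X^8 + \<theta>^4 * Y^16 / a12^4 + a11^2 * Y^8 / a12^2 + Y^4 / a12"

lemma a12_nonzero: "a12 \<noteq> 0" and theta_nonzero: "\<theta> \<noteq> 0"
  using ord_a12 ord_theta by (auto simp: one_ereal_def)

lemma ord_reals: "ord \<theta> = ereal (-1)" "ord a11 = ereal (-1)"
  using ord_theta ord_a11 by (simp_all add: one_ereal_def)

lemma even_numeral_eq_0: "numeral (Num.Bit0 n) = (0::'a)"
  by (simp only: numeral_Bit0 add_self)

lemma char2_solve: "a + b + c = d \<longleftrightarrow> b = a + c + (d::'a)"
proof -
  have eq: "a + b + c + (a + c) = b" for a b c :: 'a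
  proof -
    have "a + b + c + (a + c) = b + ((a + a) + (c + c))" by (simp only: ac_simps)
    then show ?thesis by simp
  qed
  show ?thesis
  proof
    assume "a + b + c = d"
    then show "b = a + c + d" using eq[of a b c] by (simp only: ac_simps)
  next
    assume "b = a + c + d"
    then show "a + b + c = d" using eq[of a d c] by (simp only: ac_simps)
  qed
qed

lemma poly_elim_poly:
  "poly (elim_poly R) y = \<theta>^12 / a12^4 * y^16 + a11^2 * \<theta>^4 / a12^2 * y^8
     + (\<theta>^4 / a12^4 + \<theta>^2 / a12 + a21^2) * y^4 + a11^2 / a12^2 * y^2 + 1 / a12 * y + R"
  by (simp add: elim_poly_def poly_monom)

lemma degree_elim_poly: "Polynomial.degree (elim_poly R) = 16"
proof (rule antisym)
  show "Polynomial.degree (elim_poly R) \<le> 16"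
    by (rule degree_le) (auto simp: elim_poly_def)
  show "16 \<le> Polynomial.degree (elim_poly R)"
    by (rule le_degree) (simp add: elim_poly_def theta_nonzero a12_nonzero)
qed

text \<open>All exponents except 1 are even, so only the linear term survives in characteristic 2.
  The derivative is a nonzero constant, hence every root is simple.\<close>

lemma pderiv_elim_poly: "pderiv (elim_poly R) = [:1 / a12:]"
  by (simp add: elim_poly_def pderiv_add pderiv_monom even_numeral_eq_0 monom_0)

text \<open>After squaring, the first equation involves x only through x^2, for which the second
  equation gives \<open>w\<close>. This is an equivalence because squaring is injective.\<close>

lemma recurrence_iff:
  "recurrence X Y x y \<longleftrightarrow>
     x^2 = (\<theta>^2 * y^4 + y + Y^4) / a12 \<and> poly (elim_poly (elim_const X Y)) y = 0"
proof -
  define w where "w = (\<theta>^2 * y^4 + y + Y^4) / a12"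
  have 2: "\<theta>^2 * y^4 + a12 * x^2 + y = Y^4 \<longleftrightarrow> x^2 = w"
  proof -
    have "\<theta>^2 * y^4 + a12 * x^2 + y = Y^4 \<longleftrightarrow> a12 * x^2 = \<theta>^2 * y^4 + y + Y^4"
      by (rule char2_solve)
    also have "\<dots> \<longleftrightarrow> x^2 = w" using a12_nonzero by (auto simp: w_def field_simps)
    finally show ?thesis .
  qed
  have sq: "(\<theta>^2 * x^4 + a11 * x^2 + a21 * y^2 + x)^2 =
      \<theta>^4 * (x^2)^4 + a11^2 * (x^2)^2 + a21^2 * y^4 + x^2"
    by (simp add: char2_power2 power_mult_distrib flip: power_mult)
  have w2: "w^2 = (\<theta>^4 * y^8 + y^2 + Y^8) / a12^2"
    by (simp add: w_def char2_power2 power_divide power_mult_distrib flip: power_mult)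
  have w4: "w^4 = (\<theta>^8 * y^16 + y^4 + Y^16) / a12^4"
    by (simp add: w_def char2_power4 power_divide power_mult_distrib flip: power_mult)
  have "\<theta>^2 * x^4 + a11 * x^2 + a21 * y^2 + x = X^4 \<longleftrightarrow>
      (\<theta>^2 * x^4 + a11 * x^2 + a21 * y^2 + x)^2 = (X^4)^2"
    using char2_power2_inj by auto
  also have "(X^4)^2 = X^8" by (simp flip: power_mult)
  finally have 1: "\<theta>^2 * x^4 + a11 * x^2 + a21 * y^2 + x = X^4 \<longleftrightarrow>
      \<theta>^4 * (x^2)^4 + a11^2 * (x^2)^2 + a21^2 * y^4 + x^2 = X^8" unfolding sq .
  have \<theta>12: "\<theta>^12 = \<theta>^4 * \<theta>^8" by (simp flip: power_add)
  have "\<theta>^4 * w^4 + a11^2 * w^2 + a21^2 * y^4 + w + X^8 = poly (elim_poly (elim_const X Y)) y"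
    unfolding w2 w4 poly_elim_poly elim_const_def unfolding w_def
    unfolding divide_inverse power_inverse[symmetric] \<theta>12 by (simp add: algebra_simps)
  then have "\<theta>^4 * w^4 + a11^2 * w^2 + a21^2 * y^4 + w = X^8 \<longleftrightarrow>
      poly (elim_poly (elim_const X Y)) y = 0"
    by (metis add_eq_0_iff uminus_eq)
  then show ?thesis unfolding recurrence_def 1 2 w_def[symmetric] by auto
qed

lemma elim_const_0: "elim_const 0 0 = 0"
  by (simp add: elim_const_def)

definition kernel :: "('a \<times> 'a) set" where
  "kernel = {(x, y). recurrence 0 0 x y}"

text \<open>Projection to y is a bijection onto the roots of \<open>elim_poly 0\<close>, since x is
  the unique square root of a value determined by y.\<close>

lemma card_kernel: "card kernel = 16"
proof -
  have "card {y. poly (elim_poly 0) y = 0} = 16"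
    using card_roots_separable[of "elim_poly 0"] degree_elim_poly[of 0] a12_nonzero
    by (fastforce simp: pderiv_elim_poly)
  moreover have "bij_betw snd kernel {y. poly (elim_poly 0) y = 0}"
  proof (rule bij_betwI')
    fix z z' assume "z \<in> kernel" "z' \<in> kernel"
    then show "snd z = snd z' \<longleftrightarrow> z = z'"
      by (auto simp: kernel_def recurrence_iff elim_const_0 prod_eq_iff intro: char2_power2_inj)
  next
    fix y assume y: "y \<in> {y. poly (elim_poly 0) y = 0}"
    obtain x where "x^2 = (\<theta>^2 * y^4 + y + 0^4) / a12" using exists_sqrt by blast
    then have "(x, y) \<in> kernel" using y by (simp add: kernel_def recurrence_iff elim_const_0)
    then show "\<exists>z\<in>kernel. y = snd z" by force
  qed (auto simp: kernel_def recurrence_iff elim_const_0)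
  ultimately show ?thesis by (simp add: bij_betw_same_card)
qed

section \<open>Order estimates and the lifting of constant terms\<close>

lemma ord_sqrt_ge:
  assumes "ereal r \<le> ord (x^2)" shows "ereal (r / 2) \<le> ord x"
proof (cases "x = 0")
  case False
  then obtain a where "ord x = ereal a" by (rule ord_nonzero)
  then show ?thesis using assms by (simp add: ord_power)
qed simp

text \<open>The slack in v \<le> -2u - 3. In terms of s the hypotheses read 0 \<le> s \<le> 1 and,
  from v \<le> -4/3, u \<ge> -5/6 - s/2.\<close>

definition s :: real where "s = -2*u - 3 - v"

lemma s_bounds: "0 \<le> s" "s \<le> 1" "-5/6 - s/2 \<le> u" "v = -2*u - 3 - s"
  using v_le v_ge v_le_u by (simp_all add: s_def field_simps)

text \<open>The summands have orders -4 - 4u, -2 - u and 2v; inserting v = -2u - 3 - s shows that 2v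
  is strictly the smallest.\<close>

lemma ord_coeff_4: "ord (\<theta>^4 / a12^4 + \<theta>^2 / a12 + a21^2) = ereal (2 * v)"
proof -
  have 1: "ord (a21^2) = ereal (2 * v)" using ord_power[OF ord_a21, of 2] by simp
  have 2: "ord (\<theta>^4 / a12^4) = ereal (-4 - 4 * u)"
    using ord_divide[OF ord_power[OF ord_a12, of 4] ord_power[OF ord_reals(1), of 4]] by simp
  have 3: "ord (\<theta>^2 / a12) = ereal (-2 - u)"
    using ord_divide[OF ord_a12 ord_power[OF ord_reals(1), of 2]] by simp
  have "ereal (2 * v) < ord (\<theta>^4 / a12^4 + \<theta>^2 / a12)"
    using s_bounds by (intro ord_add_gt) (simp_all add: 2 3)
  then show ?thesis
    using ord_sum_eq[of "a21^2" "\<theta>^4 / a12^4 + \<theta>^2 / a12"] 1 by (simp add: add.commute)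
qed

text \<open>a12 x^2 is a sum of \<theta>^2 y^4, y and Y^4, whose orders are at least 4 \<mu> - 2,
  \<mu> and 4 \<eta>.\<close>

lemma ord_x_ge:
  assumes rec: "recurrence X Y x y"
    and "ereal \<mu> \<le> ord y" "ereal \<eta> \<le> ord Y" and "\<nu> \<le> \<mu>" "\<nu> \<le> 4*\<mu> - 2" "\<nu> \<le> 4*\<eta>"
  shows "ereal ((\<nu> - u) / 2) \<le> ord x"
proof (rule ord_sqrt_ge)
  have 1: "ereal (real 2 * (-1) + real 4 * \<mu>) \<le> ord (\<theta>^2 * y^4)"
    using assms by (intro ord_mult_ge ord_power_ge) (simp_all add: ord_reals)
  have 2: "ereal (real 4 * \<eta>) \<le> ord (Y^4)" using assms by (intro ord_power_ge)
  have "ereal \<nu> \<le> ord (\<theta>^2 * y^4 + y + Y^4)"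
    by (intro ord_add_ge order_trans[OF _ 1] order_trans[OF _ 2] order_trans[OF _ assms(2)])
       (use assms in auto)
  then have "ereal (\<nu> - u) \<le> ord ((\<theta>^2 * y^4 + y + Y^4) / a12)"
    by (rule ord_divide_ge[OF ord_a12])
  then show "ereal (\<nu> - u) \<le> ord (x^2)" using rec by (simp add: recurrence_iff)
qed

text \<open>(3 - s)/6 is the t at which the terms of degree 16 and 4 balance: -12 - 4u + 16t = 2v +
  4t. For smaller t = ord y the term of degree 16 strictly dominates all others and y is no root.
  The bound on x is \<open>ord_x_ge\<close> with \<nu> = 4 \<mu> - 2 = -2s/3.\<close>

lemma ord_kernel:
  assumes "(x, y) \<in> kernel"
  shows "ereal ((3 - s) / 6) \<le> ord y" "ereal ((- 2 * s / 3 - u) / 2) \<le> ord x"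
proof -
  show y: "ereal ((3 - s) / 6) \<le> ord y"
  proof (rule ccontr)
    assume *: "\<not> ereal ((3 - s) / 6) \<le> ord y"
    then have "y \<noteq> 0" by auto
    then obtain t where t: "ord y = ereal t" by (rule ord_nonzero)
    have tlt: "t < (3 - s) / 6" using * t by simp
    have 16: "ord (\<theta>^12 / a12^4 * y^16) = ereal (-12 - 4*u + 16*t)"
      using ord_divide[OF ord_power[OF ord_a12, of 4] ord_power[OF ord_reals(1), of 12]]
      by (simp add: ord_mult ord_power[OF t] del: times_divide_eq_left times_divide_eq_right)
    have 8: "ord (a11^2 * \<theta>^4 / a12^2 * y^8) = ereal (-6 - 2*u + 8*t)"
      using ord_divide[OF ord_power[OF ord_a12, of 2], of "a11^2 * \<theta>^4" "-6"]
        ord_power[OF ord_reals(1), of 4] ord_power[OF ord_reals(2), of 2]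
      by (simp add: ord_mult ord_power[OF t] del: times_divide_eq_left times_divide_eq_right)
    have 4: "ord ((\<theta>^4 / a12^4 + \<theta>^2 / a12 + a21^2) * y^4) = ereal (2 * v + 4*t)"
      by (simp only: ord_mult ord_power[OF t] ord_coeff_4) simp
    have 2: "ord (a11^2 / a12^2 * y^2) = ereal (-2 - 2*u + 2*t)"
      using ord_divide[OF ord_power[OF ord_a12, of 2] ord_power[OF ord_reals(2), of 2]]
      by (simp add: ord_mult ord_power[OF t] del: times_divide_eq_left times_divide_eq_right)
    have 1: "ord (1 / a12 * y) = ereal (- u + t)"
      using ord_divide[OF ord_a12, of 1 0] by (simp add: ord_mult t del: times_divide_eq_left times_divide_eq_right)
    have "ereal (-12 - 4*u + 16*t) < ord (a11^2 * \<theta>^4 / a12^2 * y^8 +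
      ((\<theta>^4 / a12^4 + \<theta>^2 / a12 + a21^2) * y^4 + (a11^2 / a12^2 * y^2 + 1 / a12 * y)))"
      using tlt s_bounds by (intro ord_add_gt) (simp_all only: 8 4 2 1, auto)
    then have "ord (poly (elim_poly 0) y) = ereal (-12 - 4*u + 16*t)"
      unfolding poly_elim_poly using ord_sum_eq[of "\<theta>^12 / a12^4 * y^16"]
      by (simp only: 16 add.assoc add_0_right)
    then show False using assms by (simp add: kernel_def recurrence_iff elim_const_0)
  qed
  show "ereal ((- 2 * s / 3 - u) / 2) \<le> ord x"
    using assms s_bounds by (intro ord_x_ge[of 0 0 x y, OF _ y, of "(3 - s) / 6"])
      (auto simp: kernel_def field_simps)
qed

text \<open>The four conditions on \<mu> say that the four summands of \<open>elim_const X Y\<close>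
  have order at least 4 \<mu> + 2v, with v rewritten through s and u. The coefficient of y^4 then
  yields a root of order at least \<mu>. The conditions on \<nu> are those of
  \<open>ord_x_ge\<close>.\<close>

lemma recurrence_step:
  assumes Y: "ereal \<eta> \<le> ord Y" and X: "ereal ((\<zeta> - u) / 2) \<le> ord X"
    and \<mu>: "\<mu> \<le> \<zeta> + (3 + s) / 2" "\<mu> \<le> 4*\<eta> - 1 + (3 + s) / 2"
      "\<mu> \<le> 2*\<eta> - 1/2 + u/2 + (3 + s) / 2" "\<mu> \<le> \<eta> + 3*u/4 + (3 + s) / 2"
    and \<nu>: "\<nu> \<le> \<mu>" "\<nu> \<le> 4*\<mu> - 2" "\<nu> \<le> 4*\<eta>"
  shows "\<exists>x y. recurrence X Y x y \<and> ereal \<mu> \<le> ord y \<and> ereal ((\<nu> - u) / 2) \<le> ord x"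
proof -
  define \<rho> where "\<rho> = 4*\<mu> + 2 * v"
  have 1: "ereal (real 8 * ((\<zeta> - u) / 2)) \<le> ord (X^8)" by (rule ord_power_ge[OF X])
  have 2: "ereal (real 4 * (-1) + real 16 * \<eta> - real 4 * u) \<le> ord (\<theta>^4 * Y^16 / a12^4)"
    by (intro ord_divide_ge ord_mult_ge ord_power_ge Y ord_power ord_a12) (simp add: ord_reals)
  have 3: "ereal (real 2 * (-1) + real 8 * \<eta> - real 2 * u) \<le> ord (a11^2 * Y^8 / a12^2)"
    by (intro ord_divide_ge ord_mult_ge ord_power_ge Y ord_power ord_a12) (simp add: ord_reals)
  have 4: "ereal (real 4 * \<eta> - u) \<le> ord (Y^4 / a12)"
    by (intro ord_divide_ge ord_power_ge Y ord_a12)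
  have "ereal \<rho> \<le> ord (elim_const X Y)"
    unfolding elim_const_def
    by (intro ord_add_ge order_trans[OF _ 1] order_trans[OF _ 2] order_trans[OF _ 3] order_trans[OF _ 4])
       (use \<mu> s_bounds in \<open>auto simp: \<rho>_def field_simps\<close>)
  then have c: "ereal \<rho> \<le> ord (poly (elim_poly (elim_const X Y)) 0)"
    by (simp add: poly_elim_poly)
  have "Polynomial.coeff (elim_poly (elim_const X Y)) 4 = \<theta>^4 / a12^4 + \<theta>^2 / a12 + a21^2"
    by (simp add: elim_poly_def)
  then have "ord (Polynomial.coeff (elim_poly (elim_const X Y)) 4) = ereal (2 * v)"
    by (simp only: ord_coeff_4)
  from root_with_ord_ge[OF c this] obtain y where
    y: "poly (elim_poly (elim_const X Y)) y = 0" "ereal \<mu> \<le> ord y" by (auto simp: \<rho>_def)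
  obtain x where "x^2 = (\<theta>^2 * y^4 + y + Y^4) / a12" using exists_sqrt by blast
  then have rec: "recurrence X Y x y" using y by (simp add: recurrence_iff)
  then show ?thesis using ord_x_ge[OF rec y(2) Y \<nu>] y(2) by blast
qed

lemma kernel_lifts:
  assumes "z \<in> kernel"
  shows "\<exists>f. f 0 = z \<and> (\<forall>n. recurrence (fst (f n)) (snd (f n)) (fst (f (Suc n))) (snd (f (Suc n)))) \<and>
    (\<lambda>n. ord (fst (f n))) \<longlonglongrightarrow> \<infinity> \<and> (\<lambda>n. ord (snd (f n))) \<longlonglongrightarrow> \<infinity>"
proof -
  \<comment> \<open>The gain 7/8 is dictated by the summand Y^4 / a12: it allows \<mu> = \<eta> +
    3u/4 + (3 + s)/2, and u \<ge> -5/6 - s/2 makes this at least \<eta> + 7/8.\<close>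
  define m where "m = (\<lambda>n. 4/3 + real n * 7/8)"
  define P where "P = (\<lambda>n z. ereal (m n) \<le> ord (snd z) \<and> ereal ((m n - u) / 2) \<le> ord (fst z))"
  define R where "R = (\<lambda>z z'. recurrence (fst z) (snd z) (fst z') (snd z'))"
  \<comment> \<open>The first step is separate because x and y start from the different bounds of
    \<open>ord_kernel\<close>. With \<zeta> = -2s/3 the summand X^8 allows \<mu> = 3/2 - s/6, which
    for s = 1 is exactly 4/3.\<close>
  have "\<exists>x y. recurrence (fst z) (snd z) x y \<and> ereal (4/3) \<le> ord y \<and> ereal ((4/3 - u) / 2) \<le> ord x"
    using ord_kernel[of "fst z" "snd z"] assms s_bounds
    by (intro recurrence_step[of "(3 - s) / 6" _ "- 2 * s / 3"]) (auto simp: field_simps)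
  then obtain z1 where z1: "R z z1" "P 0 z1" by (auto simp: P_def R_def m_def)
  have "\<exists>z''. P (Suc n) z'' \<and> R z' z''" if "P n z'" for n z'
  proof -
    have "m n \<ge> 4/3" by (simp add: m_def)
    then have "\<exists>x y. recurrence (fst z') (snd z') x y \<and> ereal (m n + 7/8) \<le> ord y \<and>
        ereal ((m n + 7/8 - u) / 2) \<le> ord x"
      using that s_bounds unfolding P_def by (intro recurrence_step[of "m n" _ "m n"]) (auto simp: field_simps)
    moreover have "m n + 7/8 = m (Suc n)" by (simp add: m_def field_simps)
    ultimately show ?thesis by (simp add: P_def R_def) blast
  qed
  \<comment> \<open>The start \<open>z1\<close> of the dependent choice is prescribed by building it
    into the property at n = 0.\<close>
  then obtain g where g: "g 0 = z1" "\<And>n. P n (g n)" "\<And>n. R (g n) (g (Suc n))"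
    using dependent_nat_choice[of "\<lambda>n z. P n z \<and> (n = 0 \<longrightarrow> z = z1)" "\<lambda>_. R"] z1(2) by (metis nat.simps(3))
  define f where "f = case_nat z g"
  \<comment> \<open>m n / 2 - |u| is a common lower bound for m n, which bounds y, and (m n - u) /
    2, which bounds x.\<close>
  have lim: "(\<lambda>n. ord (h (f n))) \<longlonglongrightarrow> \<infinity>" if "\<And>n. ereal (m n / 2 - \<bar>u\<bar>) \<le> ord (h (g n))" for h
  proof -
    have "filterlim (\<lambda>n. m n / 2 - \<bar>u\<bar>) at_top sequentially" unfolding m_def by real_asymp
    then have "(\<lambda>n. ereal (m n / 2 - \<bar>u\<bar>)) \<longlonglongrightarrow> \<infinity>"
      by (simp add: tendsto_PInfty_eq_at_top)
    then have "(\<lambda>n. ord (h (g n))) \<longlonglongrightarrow> \<infinity>"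
      unfolding tendsto_PInfty by (meson eventually_mono less_le_trans that)
    then have "(\<lambda>n. ord (h (f (Suc n)))) \<longlonglongrightarrow> \<infinity>" by (simp add: f_def)
    then show ?thesis by (rule LIMSEQ_imp_Suc)
  qed
  have "ereal (m n / 2 - \<bar>u\<bar>) \<le> ord (snd (g n))" "ereal (m n / 2 - \<bar>u\<bar>) \<le> ord (fst (g n))" for n
  proof -
    have "m n \<ge> 0" by (simp add: m_def)
    then have "ereal (m n / 2 - \<bar>u\<bar>) \<le> ereal (m n)" "ereal (m n / 2 - \<bar>u\<bar>) \<le> ereal ((m n - u) / 2)"
      by (auto simp: field_simps)
    then show "ereal (m n / 2 - \<bar>u\<bar>) \<le> ord (snd (g n))" "ereal (m n / 2 - \<bar>u\<bar>) \<le> ord (fst (g n))"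
      using g(2)[of n] unfolding P_def by (meson order_trans)+
  qed
  moreover have "R (f n) (f (Suc n))" for n
    using g(1,3) z1(1) by (cases n) (auto simp: f_def)
  ultimately show ?thesis using lim
    by (intro exI[of _ f]) (auto simp: f_def R_def)
qed

end

section \<open>Bases of lattices of power series\<close>

context C_infinity
begin

lemma F2_poly_pCons_iff: "pCons c p \<in> F2_poly \<longleftrightarrow> c \<in> {0, 1} \<and> (p :: 'a poly) \<in> F2_poly"
  unfolding F2_poly_def by (auto simp: coeff_pCons split: nat.splits)

lemma F2_poly_0: "(0 :: 'a poly) \<in> F2_poly"
  by (simp add: F2_poly_def)

end

section \<open>Vectors of power series modulo T\<close>

definition fps_vec_const :: "'a::zero fps ^ 'k \<Rightarrow> 'a ^ 'k" where
  "fps_vec_const Z = (\<chi> k. fps_nth (Z $ k) 0)"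

lemma fps_vec_const_add: "fps_vec_const (Z + Z') = fps_vec_const Z + fps_vec_const (Z' :: 'a::comm_ring_1 fps ^ 'k)"
  by (simp add: fps_vec_const_def vec_eq_iff)

lemma fps_vec_const_sum: "fps_vec_const (\<Sum>b\<in>S. f b) = (\<Sum>b\<in>S. fps_vec_const (f b :: 'a::comm_ring_1 fps ^ 'k))"
proof -
  have "fps_vec_const (0 :: 'a fps ^ 'k) = 0" by (simp add: fps_vec_const_def vec_eq_iff)
  then show ?thesis by (induction S rule: infinite_finite_induct) (auto simp: fps_vec_const_add)
qed

lemma fps_vec_const_scale: "fps_vec_const (f *s Z) = fps_nth f 0 *s fps_vec_const (Z :: 'a::comm_ring_1 fps ^ 'k)"
  by (simp add: fps_vec_const_def vec_eq_iff)

lemma vec_sum_distrib_left: "f *s (\<Sum>b\<in>S. g b) = (\<Sum>b\<in>S. f *s (g b :: 'a::comm_ring_1 ^ 'k))"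
  by (simp add: vec_eq_iff sum_distrib_left)

lemma fps_vec_X_cancel: "fps_X *s Z = fps_X *s Z' \<Longrightarrow> Z = (Z' :: 'a::field fps ^ 'k)"
  by (simp add: vec_eq_iff)

lemma fps_vec_eq_X_mult:
  assumes "fps_vec_const (Z :: 'a::field fps ^ 'k) = 0"
  obtains Z' where "Z = fps_X *s Z'"
proof
  show "Z = fps_X *s (\<chi> k. fps_shift 1 (Z $ k))"
    using assms by (auto simp: vec_eq_iff fps_vec_const_def fps_eq_iff fps_X_mult_nth gr0_conv_Suc)
qed

text \<open>The properties of the invariants that yield freeness, with U a group of small elements.
  \<open>H_X_mult_iff\<close> identifies H / T H with the set of constant terms;
  \<open>discrete\<close> stops repeated division by T.\<close>

locale tau_lattice = C_infinity ord \<theta> for ord :: "'a::field \<Rightarrow> ereal" and \<theta> +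
  fixes H :: "('a fps ^ 'k::finite) set" and U :: "'a set"
  assumes H_0: "0 \<in> H" and H_add: "Z \<in> H \<Longrightarrow> Z' \<in> H \<Longrightarrow> Z + Z' \<in> H"
    and H_X_mult_iff: "fps_X *s Z \<in> H \<longleftrightarrow> Z \<in> H"
    and finite_const: "finite (fps_vec_const ` H)"
    and U_0: "0 \<in> U" and U_add: "x \<in> U \<Longrightarrow> y \<in> U \<Longrightarrow> x + y \<in> U"
    and eventually_in_U: "Z \<in> H \<Longrightarrow> \<exists>n. \<forall>j\<ge>n. \<forall>k. fps_nth (Z $ k) j \<in> U"
    and discrete: "Z \<in> H \<Longrightarrow> (\<And>j k. fps_nth (Z $ k) j \<in> U) \<Longrightarrow> Z = 0"
begin

definition deg_less :: "nat \<Rightarrow> 'a fps ^ 'k \<Rightarrow> bool" where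
  "deg_less n Z \<longleftrightarrow> (\<forall>j\<ge>n. \<forall>k. fps_nth (Z $ k) j \<in> U)"

definition comb :: "('a fps ^ 'k) set \<Rightarrow> ('a fps ^ 'k \<Rightarrow> 'a poly) \<Rightarrow> 'a fps ^ 'k" where
  "comb B c = (\<Sum>b\<in>B. fps_of_poly (c b) *s b)"

definition is_basis :: "('a fps ^ 'k) set \<Rightarrow> bool" where
  "is_basis B \<longleftrightarrow> finite B \<and> B \<subseteq> H \<and> (\<forall>Z\<in>H. \<exists>!c. c \<in> B \<rightarrow>\<^sub>E F2_poly \<and> Z = comb B c)"

text \<open>Over F_2 a linear combination is the choice of a subset, so combinations of the constant
  terms of B are indexed by \<open>Pow B\<close>.\<close>

definition const_sum :: "('a fps ^ 'k) set \<Rightarrow> 'a ^ 'k" where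
  "const_sum S = (\<Sum>b\<in>S. fps_vec_const b)"

lemma vec_add_self: "Z + Z = (0 :: 'a fps ^ 'k)"
  by (simp add: vec_eq_iff fps_eq_iff two_eq_0)

lemma vec_base_add_self: "x + x = (0 :: 'a ^ 'k)"
  by (simp add: vec_eq_iff two_eq_0)

lemma H_sum: "(\<And>b. b \<in> S \<Longrightarrow> f b \<in> H) \<Longrightarrow> sum f S \<in> H"
  by (induction S rule: infinite_finite_induct) (auto intro: H_0 H_add)

lemma H_poly_mult: "Z \<in> H \<Longrightarrow> p \<in> F2_poly \<Longrightarrow> fps_of_poly p *s Z \<in> H"
proof (induction p)
  case (pCons c p)
  then have "c \<in> {0, 1}" "fps_of_poly p *s Z \<in> H" by (auto simp: F2_poly_pCons_iff)
  moreover have "fps_of_poly (pCons c p) *s Z = fps_const c *s Z + fps_X *s (fps_of_poly p *s Z)"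
    by (simp add: fps_of_poly_pCons vec_eq_iff algebra_simps)
  ultimately show ?case using pCons.prems H_0
    by (auto intro!: H_add simp: H_X_mult_iff simp del: vector_smult_assoc)
qed (auto simp: H_0)

lemma deg_less_mono: "deg_less n Z \<Longrightarrow> n \<le> m \<Longrightarrow> deg_less m Z"
  by (auto simp: deg_less_def)

lemma deg_less_add: "deg_less n Z \<Longrightarrow> deg_less n Z' \<Longrightarrow> deg_less n (Z + Z')"
  by (auto simp: deg_less_def intro: U_add)

lemma deg_less_sum: "(\<And>b. b \<in> S \<Longrightarrow> deg_less n (f b)) \<Longrightarrow> deg_less n (sum f S)"
proof (induction S rule: infinite_finite_induct)
  case (insert x F)
  then show ?case by (simp add: deg_less_add)
qed (auto simp: deg_less_def U_0)

lemma deg_less_X_mult: "deg_less (Suc n) (fps_X *s Z) \<Longrightarrow> deg_less n Z"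
  unfolding deg_less_def by (metis Suc_le_mono fps_X_mult_nth diff_Suc_1 nat.simps(3) vector_smult_component)

text \<open>Separates the digits at T^0 of all coefficients from the rest; the inductions on T-adic
  digits proceed through this identity.\<close>

lemma comb_pCons:
  assumes "finite B" "\<And>b. b \<in> B \<Longrightarrow> e b \<in> {0, 1}"
  shows "comb B (\<lambda>b. pCons (e b) (c b)) = \<Sum>{b\<in>B. e b = 1} + fps_X *s comb B c"
proof -
  have "comb B (\<lambda>b. pCons (e b) (c b)) = (\<Sum>b\<in>B. fps_const (e b) *s b + fps_X *s (fps_of_poly (c b) *s b))"
    unfolding comb_def
    by (intro sum.cong refl) (simp add: fps_of_poly_pCons vec_eq_iff algebra_simps)
  also have "\<dots> = (\<Sum>b\<in>B. fps_const (e b) *s b) + fps_X *s comb B c"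
    by (simp add: comb_def vec_sum_distrib_left sum.distrib)
  also have "(\<Sum>b\<in>B. fps_const (e b) *s b) = (\<Sum>b\<in>B. if e b = 1 then b else 0)"
    by (intro sum.cong refl) (use assms(2) in force)
  also have "\<dots> = \<Sum>{b\<in>B. e b = 1}"
    using assms(1) by (simp add: sum.If_cases Int_def)
  finally show ?thesis .
qed

lemma comb_cong: "(\<And>b. b \<in> B \<Longrightarrow> c b = c' b) \<Longrightarrow> comb B c = comb B c'"
  unfolding comb_def by (intro sum.cong) auto

lemma comb_in_H: "B \<subseteq> H \<Longrightarrow> c \<in> B \<rightarrow> F2_poly \<Longrightarrow> comb B c \<in> H"
  unfolding comb_def by (intro H_sum H_poly_mult) auto

lemma F2_poly_cases:
  fixes c :: "'a fps ^ 'k \<Rightarrow> 'a poly"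
  assumes "c \<in> B \<rightarrow> F2_poly"
  obtains e d where "\<And>b. b \<in> B \<Longrightarrow> c b = pCons (e b) (d b)"
    "\<And>b. b \<in> B \<Longrightarrow> e b \<in> {0, 1}" "d \<in> B \<rightarrow> F2_poly"
proof -
  have "\<exists>e d. c b = pCons e d \<and> (b \<in> B \<longrightarrow> e \<in> {0, 1} \<and> d \<in> F2_poly)" for b
  proof -
    obtain e d where ed: "c b = pCons e d" by (rule pCons_cases)
    have "e \<in> {0, 1} \<and> d \<in> F2_poly" if "b \<in> B"
      using funcset_mem[OF assms that] unfolding ed F2_poly_pCons_iff .
    then show ?thesis using ed by blast
  qed
  then obtain e d where "\<And>b. c b = pCons (e b) (d b) \<and> (b \<in> B \<longrightarrow> e b \<in> {0, 1} \<and> d b \<in> F2_poly)"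
    by metis
  then show ?thesis using that[of e d] by blast
qed

lemma fps_vec_const_comb:
  assumes "finite B" "\<And>b. b \<in> B \<Longrightarrow> e b \<in> {0, 1}"
  shows "fps_vec_const (comb B (\<lambda>b. pCons (e b) (c b))) = const_sum {b\<in>B. e b = 1}"
  by (simp add: comb_pCons[OF assms] fps_vec_const_add fps_vec_const_sum fps_vec_const_scale const_sum_def)

lemma const_sum_in: "S \<subseteq> H \<Longrightarrow> const_sum S \<in> fps_vec_const ` H"
  unfolding const_sum_def fps_vec_const_sum[symmetric] by (intro imageI H_sum) auto

text \<open>A basis of H reduces to an F_2-basis of H / T H, whose elements are therefore indexed by
  the subsets of B. For injectivity, subsets with equal constant sums differ by T times an element
  of H; expanding that element in B and comparing digits at T^0 shows the subsets to be
  equal.\<close>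

lemma basis_card:
  assumes B: "is_basis B"
  shows "2 ^ card B = card (fps_vec_const ` H)"
proof -
  have fin: "finite B" and BH: "B \<subseteq> H" using B by (auto simp: is_basis_def)
  have unique: "c b = c' b" if "c \<in> B \<rightarrow> F2_poly" "c' \<in> B \<rightarrow> F2_poly" "comb B c = comb B c'" "b \<in> B" for c c' b
  proof -
    have "restrict c B \<in> B \<rightarrow>\<^sub>E F2_poly" "restrict c' B \<in> B \<rightarrow>\<^sub>E F2_poly" using that by auto
    moreover have "comb B (restrict c B) = comb B c" "comb B (restrict c' B) = comb B c'"
      by (auto intro: comb_cong)
    moreover have "comb B c \<in> H" using BH that(1) by (rule comb_in_H)
    ultimately have "restrict c B = restrict c' B" using B that(3) unfolding is_basis_def by metis
    then show ?thesis using that(4) by (metis restrict_apply')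
  qed
  have "bij_betw const_sum (Pow B) (fps_vec_const ` H)"
    unfolding bij_betw_def
  proof
    show "inj_on const_sum (Pow B)"
    proof (rule inj_onI)
      fix S S' assume S: "S \<in> Pow B" "S' \<in> Pow B" and eq: "const_sum S = const_sum S'"
      let ?Z = "\<Sum>S + \<Sum>S'"
      have sub: "\<Sum>S \<in> H" "\<Sum>S' \<in> H" using S BH by (auto intro!: H_sum)
      have "fps_vec_const ?Z = 0"
        using eq by (simp add: fps_vec_const_add fps_vec_const_sum vec_base_add_self flip: const_sum_def)
      then obtain Z' where Z': "?Z = fps_X *s Z'" by (rule fps_vec_eq_X_mult)
      have "Z' \<in> H" using H_add[OF sub] unfolding Z' by (simp add: H_X_mult_iff)
      then obtain c where c: "c \<in> B \<rightarrow>\<^sub>E F2_poly" "Z' = comb B c" using B unfolding is_basis_def by blast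
      define i where "i = (\<lambda>(S :: ('a fps ^ 'k) set) b. if b \<in> S then 1 else 0 :: 'a)"
      have iS: "{b \<in> B. i T b = 1} = T" if "T \<in> Pow B" for T using that by (auto simp: i_def)
      have "\<Sum>S = \<Sum>S' + (\<Sum>S + \<Sum>S')" using vec_add_self[of "\<Sum>S'"] by (simp only: ac_simps) simp
      then have "\<Sum>S = \<Sum>S' + fps_X *s comb B c" unfolding Z' c(2) .
      moreover have "comb B (\<lambda>b. pCons (i S b) 0) = \<Sum>S"
        by (subst comb_pCons[OF fin]) (simp_all add: iS[OF S(1)], auto simp: i_def comb_def)
      moreover have "comb B (\<lambda>b. pCons (i S' b) (c b)) = \<Sum>S' + fps_X *s comb B c"
        by (subst comb_pCons[OF fin]) (simp_all add: iS[OF S(2)], auto simp: i_def)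
      ultimately have "comb B (\<lambda>b. pCons (i S b) 0) = comb B (\<lambda>b. pCons (i S' b) (c b))" by simp
      then have eq: "pCons (i S b) 0 = pCons (i S' b) (c b)" if "b \<in> B" for b
        using c(1) that by (intro unique) (auto simp: F2_poly_pCons_iff F2_poly_0 i_def)
      have "b \<in> S \<longleftrightarrow> b \<in> S'" if "b \<in> B" for b
        using eq[OF that] by (auto simp: i_def split: if_splits)
      then show "S = S'" using S by blast
    qed
    show "const_sum ` Pow B = fps_vec_const ` H"
    proof (intro equalityI subsetI)
      fix v assume "v \<in> fps_vec_const ` H"
      then obtain Z where Z: "Z \<in> H" "v = fps_vec_const Z" by blast
      then obtain c where c: "c \<in> B \<rightarrow>\<^sub>E F2_poly" "Z = comb B c" using B unfolding is_basis_def by blast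
      then have "c \<in> B \<rightarrow> F2_poly" by auto
      from F2_poly_cases[OF this] obtain e d where ed: "\<And>b. b \<in> B \<Longrightarrow> c b = pCons (e b) (d b)"
        "\<And>b. b \<in> B \<Longrightarrow> e b \<in> {0, 1}" by metis
      then have "Z = comb B (\<lambda>b. pCons (e b) (d b))" using c(2) comb_cong[of B c] by simp
      then have "v = const_sum {b\<in>B. e b = 1}" using Z(2) fps_vec_const_comb[OF fin ed(2)] by simp
      then show "v \<in> const_sum ` Pow B" by blast
    qed (use BH in \<open>auto intro!: const_sum_in\<close>)
  qed
  then have "card (Pow B) = card (fps_vec_const ` H)" by (rule bij_betw_same_card)
  then show ?thesis using fin by (simp add: card_Pow)
qed

text \<open>A family adapted to the filtration by \<open>deg_less\<close>: reducing modulo \<open>T\<close> never raises the degree.\<close>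

definition adapted :: "('a fps ^ 'k) set \<Rightarrow> bool" where
  "adapted B \<longleftrightarrow> finite B \<and> B \<subseteq> H \<and> inj_on const_sum (Pow B) \<and>
     (\<forall>Z\<in>H. \<forall>S\<subseteq>B. \<forall>n. fps_vec_const Z = const_sum S \<longrightarrow> deg_less n Z \<longrightarrow> (\<forall>b\<in>S. deg_less n b)) \<and>
     (\<forall>Z\<in>H. \<forall>n. fps_vec_const Z \<notin> const_sum ` Pow B \<longrightarrow> deg_less n Z \<longrightarrow> (\<forall>b\<in>B. deg_less n b))"

text \<open>Existence: subtract the lifts that match the constant term, divide by T and recurse.
  Adaptedness keeps the degree bound during the subtraction, and the division lowers it by one.
  Uniqueness: injectivity of \<open>const_sum\<close> determines the digits at T^0, then T is
  cancelled.\<close>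

lemma adapted_spanning_imp_basis:
  assumes ad: "adapted B" and span: "fps_vec_const ` H \<subseteq> const_sum ` Pow B"
  shows "is_basis B"
proof -
  have fin: "finite B" and BH: "B \<subseteq> H" and inj: "inj_on const_sum (Pow B)"
    using ad by (auto simp: adapted_def)
  have ex: "\<exists>c \<in> B \<rightarrow> F2_poly. Z = comb B c" if "Z \<in> H" "deg_less n Z" for n Z
    using that
  proof (induction n arbitrary: Z)
    case 0
    \<comment> \<open>Discreteness ends the recursion: degree bound 0 means that all coefficients
      lie in U.\<close>
    then have "Z = 0" by (intro discrete) (auto simp: deg_less_def)
    then show ?case by (intro bexI[of _ "\<lambda>_. 0"]) (auto simp: comb_def F2_poly_0)
  next
    case (Suc n)
    obtain S where S: "S \<subseteq> B" "fps_vec_const Z = const_sum S" using span Suc.prems(1) by blast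
    then have dS: "\<forall>b\<in>S. deg_less (Suc n) b" using ad Suc.prems unfolding adapted_def by blast
    let ?W = "Z + \<Sum>S"
    have "fps_vec_const ?W = 0"
      by (simp add: fps_vec_const_add S(2) fps_vec_const_sum vec_base_add_self flip: const_sum_def)
    then obtain Z' where Z': "?W = fps_X *s Z'" by (rule fps_vec_eq_X_mult)
    have "?W \<in> H" using S BH by (intro H_add Suc.prems H_sum) auto
    then have Z'H: "Z' \<in> H" unfolding Z' by (simp add: H_X_mult_iff)
    have "deg_less (Suc n) ?W" using dS Suc.prems by (intro deg_less_add deg_less_sum) auto
    then have "deg_less n Z'" unfolding Z' by (rule deg_less_X_mult)
    then obtain c where c: "c \<in> B \<rightarrow> F2_poly" "Z' = comb B c" using Suc.IH Z'H by blast
    define e where "e = (\<lambda>b. if b \<in> S then 1 else 0 :: 'a)"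
    have "{b\<in>B. e b = 1} = S" using S(1) by (auto simp: e_def)
    then have "comb B (\<lambda>b. pCons (e b) (c b)) = \<Sum>S + ?W"
      using c(2) Z' by (subst comb_pCons[OF fin]) (auto simp: e_def)
    also have "\<dots> = Z" using vec_add_self[of "\<Sum>S"] by (simp add: add.left_commute)
    finally show ?case using c(1)
      by (intro bexI[of _ "\<lambda>b. pCons (e b) (c b)"]) (auto simp: F2_poly_pCons_iff e_def)
  qed
  have coeff_eq: "\<forall>b\<in>B. Polynomial.coeff (c b) n = Polynomial.coeff (c' b) n"
    if "c \<in> B \<rightarrow> F2_poly" "c' \<in> B \<rightarrow> F2_poly" "comb B c = comb B c'" for n c c'
    using that
  proof (induction n arbitrary: c c')
    case (0 c c')
    obtain e d where ed: "\<And>b. b \<in> B \<Longrightarrow> c b = pCons (e b) (d b)" "\<And>b. b \<in> B \<Longrightarrow> e b \<in> {0, 1}"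
      using F2_poly_cases[OF 0(1)] by metis
    obtain e' d' where ed': "\<And>b. b \<in> B \<Longrightarrow> c' b = pCons (e' b) (d' b)" "\<And>b. b \<in> B \<Longrightarrow> e' b \<in> {0, 1}"
      using F2_poly_cases[OF 0(2)] by metis
    have "comb B (\<lambda>b. pCons (e b) (d b)) = comb B (\<lambda>b. pCons (e' b) (d' b))"
      using 0(3) comb_cong[of B c, OF ed(1)] comb_cong[of B c', OF ed'(1)] by simp
    then have "const_sum {b\<in>B. e b = 1} = const_sum {b\<in>B. e' b = 1}"
      using fps_vec_const_comb[of B e d, OF fin ed(2)] fps_vec_const_comb[of B e' d', OF fin ed'(2)]
      by (simp only:)
    then have "{b\<in>B. e b = 1} = {b\<in>B. e' b = 1}" by (intro inj_onD[OF inj]) auto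
    then have iff: "e b = 1 \<longleftrightarrow> e' b = 1" if "b \<in> B" for b using that by blast
    have "e b = e' b" if "b \<in> B" for b using iff[OF that] ed(2)[OF that] ed'(2)[OF that] by auto
    then show ?case using ed(1) ed'(1) by simp
  next
    case (Suc n c c')
    obtain e d where ed: "\<And>b. b \<in> B \<Longrightarrow> c b = pCons (e b) (d b)" "\<And>b. b \<in> B \<Longrightarrow> e b \<in> {0, 1}"
      "d \<in> B \<rightarrow> F2_poly" using F2_poly_cases[OF Suc.prems(1)] by metis
    obtain e' d' where ed': "\<And>b. b \<in> B \<Longrightarrow> c' b = pCons (e' b) (d' b)" "\<And>b. b \<in> B \<Longrightarrow> e' b \<in> {0, 1}"
      "d' \<in> B \<rightarrow> F2_poly" using F2_poly_cases[OF Suc.prems(2)] by metis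
    have eq: "comb B (\<lambda>b. pCons (e b) (d b)) = comb B (\<lambda>b. pCons (e' b) (d' b))"
      using Suc.prems(3) comb_cong[of B c, OF ed(1)] comb_cong[of B c', OF ed'(1)] by simp
    then have "const_sum {b\<in>B. e b = 1} = const_sum {b\<in>B. e' b = 1}"
      using fps_vec_const_comb[of B e d, OF fin ed(2)] fps_vec_const_comb[of B e' d', OF fin ed'(2)]
      by (simp only:)
    then have "{b\<in>B. e b = 1} = {b\<in>B. e' b = 1}" by (intro inj_onD[OF inj]) auto
    then have "fps_X *s comb B d = fps_X *s comb B d'"
      using eq comb_pCons[OF fin ed(2)] comb_pCons[OF fin ed'(2)] by simp
    then have "comb B d = comb B d'" by (rule fps_vec_X_cancel)
    then show ?case using Suc.IH[OF ed(3) ed'(3)] ed(1) ed'(1) by simp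
  qed
  have "\<exists>!c. c \<in> B \<rightarrow>\<^sub>E F2_poly \<and> Z = comb B c" if ZH: "Z \<in> H" for Z
  proof -
    obtain n where "deg_less n Z" using eventually_in_U[OF ZH] by (auto simp: deg_less_def)
    then obtain c where c: "c \<in> B \<rightarrow> F2_poly" "Z = comb B c" using ex ZH by blast
    show ?thesis
    proof (rule ex1I[of _ "restrict c B"])
      show "restrict c B \<in> B \<rightarrow>\<^sub>E F2_poly \<and> Z = comb B (restrict c B)"
        using c comb_cong[of B "restrict c B" c] by auto
      fix c' assume c': "c' \<in> B \<rightarrow>\<^sub>E F2_poly \<and> Z = comb B c'"
      have "c' b = c b" if "b \<in> B" for b
        using coeff_eq[of c' c] c c' that by (intro poly_eqI) auto
      then show "c' = restrict c B" using c' by (auto simp: fun_eq_iff PiE_def extensional_def)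
    qed
  qed
  then show ?thesis using fin BH by (auto simp: is_basis_def)
qed

text \<open>Greedy choice: b has minimal degree among the elements whose constant term is not yet
  spanned. If Z has such a constant term, its degree is at least that of b by minimality, and at
  least that of each member of B by the last clause of \<open>adapted\<close>.\<close>

lemma adapted_extend:
  assumes ad: "adapted B" and not_span: "\<not> fps_vec_const ` H \<subseteq> const_sum ` Pow B"
  obtains b where "b \<notin> B" "adapted (insert b B)"
proof -
  have fin: "finite B" and BH: "B \<subseteq> H" and inj: "inj_on const_sum (Pow B)"
    using ad by (auto simp: adapted_def)
  define Q where "Q = (\<lambda>n b. b \<in> H \<and> fps_vec_const b \<notin> const_sum ` Pow B \<and> deg_less n b)"
  obtain b0 where b0: "b0 \<in> H" "fps_vec_const b0 \<notin> const_sum ` Pow B" using not_span by blast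
  then obtain n0 where "Q n0 b0" using eventually_in_U[of b0] by (auto simp: Q_def deg_less_def)
  then have ex: "\<exists>b. Q n0 b" by blast
  define n where "n = (LEAST n. \<exists>b. Q n b)"
  have "\<exists>b. Q n b" unfolding n_def by (rule LeastI[of "\<lambda>n. \<exists>b. Q n b", OF ex])
  then obtain b where b: "b \<in> H" "fps_vec_const b \<notin> const_sum ` Pow B" "deg_less n b" by (auto simp: Q_def)
  have min: "deg_less m b" if "Z \<in> H" "fps_vec_const Z \<notin> const_sum ` Pow B" "deg_less m Z" for m Z
  proof -
    have "Q m Z" using that by (simp add: Q_def)
    then have "n \<le> m" unfolding n_def by (blast intro: Least_le)
    then show ?thesis using b(3) deg_less_mono by blast
  qed
  have bB: "b \<notin> B"
  proof
    assume "b \<in> B"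
    then have "fps_vec_const b = const_sum {b}" "{b} \<in> Pow B" by (auto simp: const_sum_def)
    then show False using b(2) by blast
  qed
  have ins: "const_sum (insert b S) = fps_vec_const b + const_sum S" if "S \<subseteq> B" for S
    using that bB fin finite_subset[OF that] by (subst const_sum_def, subst sum.insert) (auto simp: const_sum_def)
  \<comment> \<open>The common part of two subsets cancels in characteristic 2, leaving their
    symmetric difference.\<close>
  have sym_diff: "const_sum S + const_sum S' \<in> const_sum ` Pow B" if "S \<subseteq> B" "S' \<subseteq> B" for S S'
  proof -
    have fS: "finite S" "finite S'" using that fin finite_subset by auto
    have "const_sum S = const_sum (S - S') + const_sum (S \<inter> S')"
      unfolding const_sum_def using fS by (subst sum.union_disjoint[symmetric]) (auto intro: sum.cong)
    moreover have "const_sum S' = const_sum (S' - S) + const_sum (S \<inter> S')"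
      unfolding const_sum_def using fS by (subst sum.union_disjoint[symmetric]) (auto intro: sum.cong)
    moreover have "const_sum ((S - S') \<union> (S' - S)) = const_sum (S - S') + const_sum (S' - S)"
      unfolding const_sum_def using fS by (intro sum.union_disjoint) auto
    moreover note vec_base_add_self
    ultimately have "const_sum S + const_sum S' = const_sum ((S - S') \<union> (S' - S))"
      by (metis (no_types, opaque_lifting) add.assoc add.commute add_0_right)
    then show ?thesis using that by auto
  qed
  have out: "const_sum (insert b S) \<notin> const_sum ` Pow B" if "S \<subseteq> B" for S
  proof
    assume "const_sum (insert b S) \<in> const_sum ` Pow B"
    then obtain S' where S': "S' \<subseteq> B" "fps_vec_const b + const_sum S = const_sum S'" using ins[OF \<open>S \<subseteq> B\<close>] by auto
    have "fps_vec_const b = const_sum S' + const_sum S"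
      using S'(2) vec_base_add_self[of "const_sum S"] by (metis add.assoc add_0_right)
    then show False using sym_diff[OF S'(1) that] b(2) by simp
  qed
  have pow: "(\<exists>S'\<subseteq>B. S = insert b S') \<or> S \<subseteq> B" if "S \<subseteq> insert b B" for S
    using that by (metis subset_insert_iff insert_Diff)
  have "inj_on const_sum (Pow (insert b B))"
  proof (rule inj_onI)
    fix S S' assume "S \<in> Pow (insert b B)" "S' \<in> Pow (insert b B)" and eq: "const_sum S = const_sum S'"
    then consider S1 S1' where "S1 \<subseteq> B" "S1' \<subseteq> B" "S = insert b S1" "S' = insert b S1'"
      | "S \<subseteq> B" "S' \<subseteq> B" | S1 where "S1 \<subseteq> B" "S = insert b S1" "S' \<subseteq> B"
      | S1 where "S1 \<subseteq> B" "S' = insert b S1" "S \<subseteq> B"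
      using pow by (metis PowD)
    then show "S = S'"
    proof cases
      case 1
      then have "const_sum S1 = const_sum S1'" using eq ins by simp
      then show ?thesis using 1 inj by (auto dest: inj_onD)
    next
      case 2
      then show ?thesis using eq inj by (auto dest: inj_onD)
    next
      case 3
      then show ?thesis using eq out by (metis PowI image_eqI)
    next
      case 4
      then show ?thesis using eq out by (metis PowI image_eqI)
    qed
  qed
  moreover have "deg_less m d" if Z: "Z \<in> H" and S: "S \<subseteq> insert b B" and eq: "fps_vec_const Z = const_sum S"
    and m: "deg_less m Z" and d: "d \<in> S" for Z S m d
  proof (cases "S \<subseteq> B")
    case True
    then show ?thesis using ad Z eq m d unfolding adapted_def by blast
  next
    case False
    then obtain S1 where S1: "S1 \<subseteq> B" "S = insert b S1" using pow[OF S] by blast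
    then have no: "fps_vec_const Z \<notin> const_sum ` Pow B" using out eq by simp
    show ?thesis
    proof (cases "d = b")
      case True
      then show ?thesis using min[OF Z no m] by simp
    next
      case False
      then have "d \<in> B" using S1 d by auto
      then show ?thesis using ad Z no m unfolding adapted_def by blast
    qed
  qed
  moreover have "deg_less m d" if Z: "Z \<in> H" and "fps_vec_const Z \<notin> const_sum ` Pow (insert b B)"
    and m: "deg_less m Z" and d: "d \<in> insert b B" for Z m d
  proof -
    have no: "fps_vec_const Z \<notin> const_sum ` Pow B" using that(2) by blast
    then show ?thesis using min[OF Z no m] d ad Z m unfolding adapted_def by blast
  qed
  ultimately have "adapted (insert b B)"
    unfolding adapted_def using fin BH b(1) by auto
  then show ?thesis using that bB by blast
qed

text \<open>The subsets of an adapted family have distinct constant sums within a finite set, so its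
  cardinality is bounded. A family of maximal cardinality admits no extension and hence
  spans.\<close>

lemma basis_exists: "\<exists>B. is_basis B"
proof -
  have "adapted {}" by (auto simp: adapted_def)
  moreover have "card B \<le> card (fps_vec_const ` H)" if "adapted B" for B
  proof -
    have "card B < 2 ^ card B" by (rule less_exp)
    also have "\<dots> = card (const_sum ` Pow B)"
      using that by (simp add: adapted_def card_image card_Pow)
    also have "\<dots> \<le> card (fps_vec_const ` H)"
      using that const_sum_in by (intro card_mono finite_const) (auto simp: adapted_def)
    finally show ?thesis by simp
  qed
  ultimately obtain B where B: "adapted B" "\<And>B'. adapted B' \<Longrightarrow> card B' \<le> card B"
    using ex_has_greatest_nat[of adapted "{}" card] by (metis le_imp_less_Suc)
  have "fps_vec_const ` H \<subseteq> const_sum ` Pow B"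
  proof (rule ccontr)
    assume "\<not> ?thesis"
    then obtain b where "b \<notin> B" "adapted (insert b B)" by (rule adapted_extend[OF B(1)])
    then show False using B(2)[of "insert b B"] B(1) by (simp add: adapted_def)
  qed
  then show ?thesis using adapted_spanning_imp_basis[OF B(1)] by blast
qed

end

section \<open>Coordinates on the motive\<close>

context C_infinity
begin

section \<open>The twisted product of polynomials in \<tau>\<close>

lemma char2_add_pow2: "(x + y) ^ (2 ^ n) = x ^ (2 ^ n) + (y::'a) ^ (2 ^ n)"
proof (induction n)
  case (Suc n)
  have "(x + y) ^ (2 ^ Suc n) = ((x + y) ^ (2 ^ n)) ^ 2" by (simp add: mult.commute flip: power_mult)
  then show ?case by (simp add: Suc char2_power2 mult.commute flip: power_mult)
qed simp

text \<open>With a range of summation independent of the degrees, the laws of the twisted product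
  can be checked coefficientwise.\<close>

lemma coeff_skew_mult:
  "Polynomial.coeff (skew_mult p (r :: 'a poly)) n =
     (\<Sum>i\<le>n. Polynomial.coeff p i * Polynomial.coeff r (n - i) ^ (2 ^ i))"
proof -
  let ?t = "\<lambda>i. Polynomial.coeff p i * Polynomial.coeff r (n - i) ^ (2 ^ i)"
  have inner: "(\<Sum>j\<le>Polynomial.degree r. Polynomial.coeff
      (Polynomial.monom (Polynomial.coeff p i * Polynomial.coeff r j ^ (2 ^ i)) (i + j)) n) =
      (if i \<le> n then ?t i else 0)" for i
  proof (cases "i \<le> n")
    case True
    have "(\<Sum>j\<le>Polynomial.degree r. Polynomial.coeff
      (Polynomial.monom (Polynomial.coeff p i * Polynomial.coeff r j ^ (2 ^ i)) (i + j)) n) =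
      (\<Sum>j\<le>Polynomial.degree r. if j = n - i then ?t i else 0)"
      by (intro sum.cong refl) (use True in auto)
    also have "\<dots> = ?t i" by (auto simp: coeff_eq_0)
    finally show ?thesis using True by simp
  qed (auto intro: sum.neutral)
  have "Polynomial.coeff (skew_mult p r) n = (\<Sum>i\<le>Polynomial.degree p. if i \<le> n then ?t i else 0)"
    unfolding skew_mult_def Polynomial.coeff_sum inner ..
  also have "\<dots> = sum ?t {i. i \<le> Polynomial.degree p \<and> i \<le> n}"
    by (simp add: sum.If_cases Int_def)
  also have "\<dots> = sum ?t {..n}"
    by (intro sum.mono_neutral_left) (auto intro: le_degree)
  finally show ?thesis .
qed

lemma skew_mult_add_left: "skew_mult (p + q) (r :: 'a poly) = skew_mult p r + skew_mult q r"
  by (intro poly_eqI) (simp add: coeff_skew_mult sum.distrib algebra_simps)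

lemma skew_mult_add_right: "skew_mult p (q + r :: 'a poly) = skew_mult p q + skew_mult p r"
  by (intro poly_eqI) (simp add: coeff_skew_mult sum.distrib algebra_simps char2_add_pow2)

lemma skew_mult_0_left: "skew_mult 0 (r :: 'a poly) = 0"
  and skew_mult_0_right: "skew_mult r (0 :: 'a poly) = 0"
  by (auto intro!: poly_eqI simp: coeff_skew_mult power_0_left)

lemma skew_mult_const: "skew_mult [:c:] (p :: 'a poly) = Polynomial.smult c p"
proof (intro poly_eqI)
  fix n
  have "(\<Sum>i\<le>n. Polynomial.coeff [:c:] i * Polynomial.coeff p (n - i) ^ (2 ^ i)) =
    (\<Sum>i\<le>n. if i = 0 then c * Polynomial.coeff p n else 0)"
    by (intro sum.cong refl) (auto simp: coeff_pCons split: nat.splits)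
  then show "Polynomial.coeff (skew_mult [:c:] p) n = Polynomial.coeff (Polynomial.smult c p) n"
    by (simp add: coeff_skew_mult)
qed

lemma coeff_tau_mult:
  "Polynomial.coeff (skew_mult [:0, 1:] (p :: 'a poly)) n =
     (case n of 0 \<Rightarrow> 0 | Suc k \<Rightarrow> Polynomial.coeff p k ^ 2)"
proof (cases n)
  case (Suc k)
  have "(\<Sum>i\<le>n. Polynomial.coeff [:0, 1:] i * Polynomial.coeff p (n - i) ^ (2 ^ i)) =
    (\<Sum>i\<le>n. if i = 1 then Polynomial.coeff p k ^ 2 else 0)"
    by (intro sum.cong refl) (auto simp: coeff_pCons Suc split: nat.splits)
  then show ?thesis by (simp add: coeff_skew_mult Suc)
qed (simp add: coeff_skew_mult)

text \<open>The case of associativity that makes \<tau> commute with T; it reduces to the additivity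
  of squaring.\<close>

lemma skew_mult_tau_assoc:
  "skew_mult (skew_mult [:0, 1:] p) r = skew_mult [:0, 1:] (skew_mult p (r :: 'a poly))"
proof (intro poly_eqI)
  fix n
  have sum2: "(\<Sum>i\<in>S. f i) ^ 2 = (\<Sum>i\<in>S. f i ^ 2)" for S and f :: "nat \<Rightarrow> 'a"
    by (induction S rule: infinite_finite_induct) (auto simp: char2_power2)
  show "Polynomial.coeff (skew_mult (skew_mult [:0, 1:] p) r) n =
    Polynomial.coeff (skew_mult [:0, 1:] (skew_mult p r)) n"
  proof (cases n)
    case (Suc k)
    have "Polynomial.coeff (skew_mult (skew_mult [:0, 1:] p) r) n =
      (\<Sum>i\<le>k. Polynomial.coeff p i ^ 2 * Polynomial.coeff r (k - i) ^ (2 ^ Suc i))"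
      unfolding coeff_skew_mult[of _ r] Suc
      by (subst sum.atMost_Suc_shift) (simp add: coeff_tau_mult)
    also have "\<dots> = (\<Sum>i\<le>k. (Polynomial.coeff p i * Polynomial.coeff r (k - i) ^ (2 ^ i)) ^ 2)"
      by (intro sum.cong refl) (simp add: power_mult_distrib mult.commute flip: power_mult)
    finally show ?thesis by (simp add: coeff_tau_mult Suc coeff_skew_mult[of p r] sum2)
  qed (simp add: coeff_tau_mult coeff_skew_mult[of _ r])
qed

lemma skew_mult_smult_left: "skew_mult (Polynomial.smult c p) r = Polynomial.smult c (skew_mult p (r :: 'a poly))"
  by (intro poly_eqI) (simp add: coeff_skew_mult sum_distrib_left mult.assoc)

section \<open>Scalars, \<tau> and T acting on the motive\<close>

definition scale :: "'a \<Rightarrow> 'a poly ^ 2 \<Rightarrow> 'a poly ^ 2" where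
  "scale c m = (\<chi> k. Polynomial.smult c (m $ k))"

lemma skew_act_const: "skew_act [:c:] m = scale c m"
  by (simp add: skew_act_def scale_def skew_mult_const)

lemma scale_add: "scale c (m + m') = scale c m + scale c m'"
  and scale_add_left: "scale (c + d) m = scale c m + scale d m"
  and scale_scale: "scale c (scale d m) = scale (c * d) m"
  and scale_0: "scale 0 m = 0" and scale_0_right: "scale c 0 = 0" and scale_1: "scale 1 m = m"
  by (simp_all add: scale_def vec_eq_iff smult_add_right smult_add_left)

lemma motive_tau_add: "motive_tau (m + m') = motive_tau m + motive_tau (m' :: 'a poly ^ 2)"
  by (simp add: motive_tau_def skew_act_def vec_eq_iff skew_mult_add_right)

lemma motive_tau_0: "motive_tau 0 = (0 :: 'a poly ^ 2)"
  by (simp add: motive_tau_def skew_act_def vec_eq_iff skew_mult_0_right)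

lemma motive_tau_scale: "motive_tau (scale c m) = scale (c^2) (motive_tau m)"
  unfolding motive_tau_def skew_act_def scale_def vec_eq_iff
  by (auto intro!: poly_eqI simp: coeff_tau_mult power_mult_distrib split: nat.splits)

lemma motive_tau_sum: "motive_tau (sum f S) = (\<Sum>i\<in>S. motive_tau (f i :: 'a poly ^ 2))"
  by (induction S rule: infinite_finite_induct) (auto simp: motive_tau_add motive_tau_0)

lemma motive_T_add: "motive_T \<theta> A (m + m') = motive_T \<theta> A m + motive_T \<theta> A m'"
  by (simp add: motive_T_def skew_act_def vec_eq_iff skew_mult_add_left sum.distrib)

lemma motive_T_0: "motive_T \<theta> A 0 = 0"
  by (simp add: motive_T_def skew_act_def vec_eq_iff skew_mult_0_left)

lemma smult_sum: "Polynomial.smult (c::'a) (sum f S) = (\<Sum>i\<in>S. Polynomial.smult c (f i))"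
  by (induction S rule: infinite_finite_induct) (auto simp: smult_add_right)

lemma motive_T_scale: "motive_T \<theta> A (scale c m) = scale c (motive_T \<theta> A m)"
  by (simp add: motive_T_def skew_act_def scale_def vec_eq_iff skew_mult_smult_left smult_sum)

lemma motive_T_tau: "motive_T \<theta> A (motive_tau m) = motive_tau (motive_T \<theta> A m)"
  unfolding motive_T_def motive_tau_sum
  by (intro sum.cong refl) (simp add: motive_tau_def skew_act_def vec_eq_iff skew_mult_tau_assoc)

lemma motive_T_e:
  "motive_T \<theta> A (motive_e j) =
     scale \<theta> (motive_e j) + (\<Sum>k\<in>UNIV. scale (A $ j $ k) (motive_tau (motive_e k)))
       + motive_tau (motive_tau (motive_e j))"
proof -
  have 1: "skew_act [:0, a:] (motive_e k) = scale a (motive_tau (motive_e k))" for a :: 'a and k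
    unfolding motive_tau_def skew_act_def scale_def motive_e_def vec_eq_iff
    by (auto intro!: poly_eqI simp: axis_def coeff_skew_mult coeff_pCons split: nat.splits intro!: sum.cong)
       (auto simp: sum_distrib_left intro!: sum.cong split: nat.splits)
  have 2: "skew_act [:0, 0, 1:] (motive_e k) = (motive_tau (motive_tau (motive_e k)) :: 'a poly ^ 2)" for k
  proof -
    have "skew_mult [:0, 0, 1:] p = skew_mult [:0, 1:] (skew_mult [:0, 1:] p)" for p :: "'a poly"
    proof -
      have "skew_mult [:0, 1:] [:0, 1:] = ([:0, 0, 1:] :: 'a poly)"
        by (rule poly_eqI) (auto simp: coeff_tau_mult coeff_pCons split: nat.splits)
      then show ?thesis using skew_mult_tau_assoc[of "[:0, 1:]" p] by simp
    qed
    then show ?thesis by (simp add: motive_tau_def skew_act_def vec_eq_iff)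
  qed
  have 3: "motive_T \<theta> A (motive_e j) = motive_Te \<theta> A j"
  proof -
    have "skew_act (motive_e j $ i) (motive_Te \<theta> A i) = (if i = j then motive_Te \<theta> A j else 0)" for i
      using skew_mult_const[of 1]
      by (simp add: motive_e_def axis_def skew_act_def vec_eq_iff skew_mult_0_left one_pCons)
    then show ?thesis by (simp add: motive_T_def)
  qed
  show ?thesis unfolding 3 motive_Te_def 1 2 skew_act_const ..
qed

lemma funpow_tau_e: "(motive_tau ^^ n) (motive_e j) = (axis j (Polynomial.monom 1 n) :: 'a poly ^ 2)"
proof (induction n)
  case 0
  then show ?case by (simp add: motive_e_def one_poly_eq_simps)
next
  case (Suc n)
  have "skew_mult [:0, 1:] (Polynomial.monom 1 n) = (Polynomial.monom 1 (Suc n) :: 'a poly)"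
    by (rule poly_eqI) (auto simp: coeff_tau_mult split: nat.splits)
  then have "motive_tau (axis j (Polynomial.monom 1 n)) = (axis j (Polynomial.monom 1 (Suc n)) :: 'a poly ^ 2)"
    by (simp add: motive_tau_def skew_act_def vec_eq_iff axis_def skew_mult_0_right)
  then show ?case by (simp add: Suc)
qed

lemma motive_expansion:
  assumes "\<And>j. Polynomial.degree (m $ j) < N"
  shows "m = (\<Sum>j\<in>UNIV. \<Sum>i<N. scale (Polynomial.coeff (m $ j) i) ((motive_tau ^^ i) (motive_e j)))"
proof -
  have "Polynomial.coeff (m $ k) n = (\<Sum>j\<in>UNIV. \<Sum>i<N. Polynomial.coeff (m $ j) i *
      Polynomial.coeff (axis j (Polynomial.monom 1 i) $ k) n)" for k n
  proof -
    have "(\<Sum>i<N. Polynomial.coeff (m $ j) i * Polynomial.coeff (axis j (Polynomial.monom 1 i) $ k) n)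
      = (if j = k then (\<Sum>i<N. if i = n then Polynomial.coeff (m $ k) n else 0) else 0)" for j
    proof (cases "j = k")
      case True
      have "(\<Sum>i<N. Polynomial.coeff (m $ j) i * Polynomial.coeff (axis j (Polynomial.monom 1 i) $ k) n)
        = (\<Sum>i<N. if i = n then Polynomial.coeff (m $ k) n else 0)"
        by (intro sum.cong refl) (simp add: axis_def True)
      then show ?thesis using True by simp
    qed (simp add: axis_def)
    moreover have "(\<Sum>i<N. if i = n then Polynomial.coeff (m $ k) n else 0) = Polynomial.coeff (m $ k) n"
      using assms[of k] by (auto simp: coeff_eq_0)
    ultimately show ?thesis by simp
  qed
  note coeff = this
  show ?thesis
    unfolding vec_eq_iff poly_eq_iff
  proof (intro allI)
    fix k n
    show "Polynomial.coeff (m $ k) n = Polynomial.coeff ((\<Sum>j\<in>UNIV. \<Sum>i<N.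
        scale (Polynomial.coeff (m $ j) i) ((motive_tau ^^ i) (motive_e j))) $ k) n"
      by (subst coeff) (simp add: scale_def funpow_tau_e Polynomial.coeff_sum)
  qed
qed

text \<open>The \<tau>^n e_j span the motive over the constants, so identities between additive maps
  compatible with scalars need checking only there.\<close>

lemma motive_induct:
  assumes add: "\<And>m m'. P m \<Longrightarrow> P m' \<Longrightarrow> P (m + m')" and scale: "\<And>c m. P m \<Longrightarrow> P (scale c m)"
    and base: "\<And>n j. P ((motive_tau ^^ n) (motive_e j))"
  shows "P (m :: 'a poly ^ 2)"
proof -
  have P0: "P 0" using scale[OF base, of 0] by (simp add: scale_0)
  have sum: "P (sum f S)" if "\<And>i. P (f i)" for f :: "2 \<Rightarrow> 'a poly ^ 2" and S
    by (induction S rule: infinite_finite_induct) (auto intro: P0 add that)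
  have sum': "P (sum f S)" if "\<And>i. P (f i)" for f :: "nat \<Rightarrow> 'a poly ^ 2" and S
    by (induction S rule: infinite_finite_induct) (auto intro: P0 add that)
  define N where "N = Suc (\<Sum>j\<in>UNIV. Polynomial.degree (m $ j))"
  have "Polynomial.degree (m $ j) < N" for j
    unfolding N_def less_Suc_eq_le by (rule member_le_sum) auto
  then show ?thesis by (subst motive_expansion[of m N]) (auto intro!: sum sum' scale base)
qed

lemma motive_poly_act_altdef:
  assumes "Polynomial.degree p < N"
  shows "motive_poly_act \<theta> A p m = (\<Sum>i<N. scale (Polynomial.coeff p i) ((motive_T \<theta> A ^^ i) m))"
  unfolding motive_poly_act_def skew_act_const
  using assms by (intro sum.mono_neutral_left) (auto simp: coeff_eq_0 scale_0)

lemma motive_T_sum: "motive_T \<theta> A (sum f S) = (\<Sum>i\<in>S. motive_T \<theta> A (f i))"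
  by (induction S rule: infinite_finite_induct) (auto simp: motive_T_add motive_T_0)

lemma motive_poly_act_pCons:
  "motive_poly_act \<theta> A (pCons c p) m = scale c m + motive_T \<theta> A (motive_poly_act \<theta> A p m)"
proof -
  define N where "N = Suc (Polynomial.degree p)"
  have 1: "Polynomial.degree (pCons c p) < Suc N" and 2: "Polynomial.degree p < N"
    using degree_pCons_le[of c p] by (auto simp: N_def)
  show ?thesis unfolding motive_poly_act_altdef[OF 1] motive_poly_act_altdef[OF 2]
    by (subst sum.lessThan_Suc_shift) (simp add: motive_T_sum motive_T_scale)
qed

lemma motive_poly_act_add:
  "motive_poly_act \<theta> A (p + q) m = motive_poly_act \<theta> A p m + motive_poly_act \<theta> A q m"
proof -
  define N where "N = Suc (max (Polynomial.degree p) (Polynomial.degree q))"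
  have 1: "Polynomial.degree p < N" and 2: "Polynomial.degree q < N" and 3: "Polynomial.degree (p + q) < N"
    using degree_add_le_max[of p q] by (auto simp: N_def)
  show ?thesis
    unfolding motive_poly_act_altdef[OF 1] motive_poly_act_altdef[OF 2] motive_poly_act_altdef[OF 3]
    by (simp add: scale_add_left sum.distrib)
qed

lemma motive_poly_act_0: "motive_poly_act \<theta> A 0 m = 0"
  using motive_poly_act_altdef[of 0 1] by (simp add: scale_0)

lemma scale_sum: "scale c (sum f S) = (\<Sum>i\<in>S. scale c (f i))"
  by (induction S rule: infinite_finite_induct) (auto simp: scale_add scale_0_right)

lemma motive_poly_act_smult:
  "motive_poly_act \<theta> A (Polynomial.smult c p) m = scale c (motive_poly_act \<theta> A p m)"
proof -
  define N where "N = Suc (Polynomial.degree p)"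
  have 1: "Polynomial.degree (Polynomial.smult c p) < N" and 2: "Polynomial.degree p < N"
    using degree_smult_le[of c p] by (auto simp: N_def)
  show ?thesis unfolding motive_poly_act_altdef[OF 1] motive_poly_act_altdef[OF 2]
    by (simp add: scale_sum scale_scale)
qed

section \<open>The basis e_j, \<tau> e_j over polynomials in T\<close>

definition motive_basis :: "2 + 2 \<Rightarrow> 'a poly ^ 2" where
  "motive_basis i = (case i of Inl j \<Rightarrow> motive_e j | Inr j \<Rightarrow> motive_tau (motive_e j))"

text \<open>The span is closed under T. Applying \<tau>^k to the equation for T e_j expresses
  \<tau>^(k+2) e_j through T \<tau>^k e_j, \<tau>^k e_j and the \<tau>^(k+1) e_i, so strong
  induction on the power of \<tau> applies.\<close>

lemma motive_basis_spans: "\<exists>p. m = (\<Sum>i\<in>UNIV. motive_poly_act \<theta> A (p i) (motive_basis i))"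
proof -
  define P where "P = (\<lambda>m. \<exists>p. m = (\<Sum>i\<in>UNIV. motive_poly_act \<theta> A (p i) (motive_basis i)))"
  have add: "P (m + m')" if Pm: "P m" "P m'" for m m'
  proof -
    obtain p q where "m = (\<Sum>i\<in>UNIV. motive_poly_act \<theta> A (p i) (motive_basis i))"
      "m' = (\<Sum>i\<in>UNIV. motive_poly_act \<theta> A (q i) (motive_basis i))" using Pm unfolding P_def by blast
    then show ?thesis unfolding P_def
      by (intro exI[of _ "\<lambda>i. p i + q i"]) (simp add: motive_poly_act_add sum.distrib)
  qed
  have sc: "P (scale c m)" if "P m" for c m
    using that unfolding P_def
    by (elim exE) (rule exI[of _ "\<lambda>i. Polynomial.smult c (p i)" for p], simp add: motive_poly_act_smult scale_sum)
  have T: "P (motive_T \<theta> A m)" if "P m" for m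
    using that unfolding P_def
    by (elim exE) (rule exI[of _ "\<lambda>i. pCons 0 (p i)" for p], simp add: motive_poly_act_pCons scale_0 motive_T_sum)
  have b: "P (motive_basis i)" for i
  proof -
    have "motive_poly_act \<theta> A (if j = i then 1 else 0) (motive_basis j) = (if j = i then motive_basis i else 0)" for j
    proof -
      have "motive_poly_act \<theta> A 1 m = m" for m
        unfolding one_pCons motive_poly_act_pCons by (simp add: motive_poly_act_0 scale_1 motive_T_0)
      then show ?thesis by (simp add: motive_poly_act_0)
    qed
    then show ?thesis unfolding P_def by (intro exI[of _ "\<lambda>j. if j = i then 1 else 0"]) simp
  qed
  have "P m"
  proof (rule motive_induct[of P, OF add sc])
    fix n
    show "P ((motive_tau ^^ n) (motive_e j))" for j
    proof (induction n arbitrary: j rule: less_induct)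
      case (less n)
      consider "n = 0" | "n = 1" | k where "n = Suc (Suc k)" by (metis One_nat_def not0_implies_Suc)
      then show ?case
      proof cases
        case 1 then show ?thesis using b[of "Inl j"] by (simp add: motive_basis_def)
      next
        case 2 then show ?thesis using b[of "Inr j"] by (simp add: motive_basis_def)
      next
        case 3
        define \<tau>k where "\<tau>k = (motive_tau ^^ k :: 'a poly ^ 2 \<Rightarrow> _)"
        have k_add: "\<tau>k (m + m') = \<tau>k m + \<tau>k m'" and k_scale: "\<tau>k (scale c m) = scale (c ^ (2^k)) (\<tau>k m)"
          and k_T: "\<tau>k (motive_T \<theta> A m) = motive_T \<theta> A (\<tau>k m)" for m m' c
          unfolding \<tau>k_def
          by (induction k) (simp_all add: motive_tau_add motive_tau_scale motive_T_tau mult.commute flip: power_mult)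
        have k_0: "\<tau>k 0 = 0" using k_scale[of 0 0] by (simp add: scale_0 power_0_left)
        have k_sum: "\<tau>k (sum f S) = (\<Sum>i\<in>S. \<tau>k (f i))" for f and S :: "2 set"
          by (induction S rule: infinite_finite_induct) (auto simp: k_add k_0)
        have self: "m + m = 0" for m :: "'a poly ^ 2"
          by (simp only: vec_eq_iff poly_eq_iff vector_add_component Polynomial.coeff_add add_self zero_index coeff_0) simp
        have "motive_tau (motive_tau (motive_e j)) = motive_T \<theta> A (motive_e j) +
          (scale \<theta> (motive_e j) + (\<Sum>k\<in>UNIV. scale (A $ j $ k) (motive_tau (motive_e k))))"
          unfolding motive_T_e using self[of "scale \<theta> (motive_e j) + (\<Sum>k\<in>UNIV. scale (A $ j $ k) (motive_tau (motive_e k)))"]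
          by (simp add: add.commute add.left_commute)
        then have "\<tau>k (motive_tau (motive_tau (motive_e j))) = motive_T \<theta> A (\<tau>k (motive_e j)) +
          (scale (\<theta> ^ (2^k)) (\<tau>k (motive_e j)) +
            (\<Sum>i\<in>UNIV. scale ((A $ j $ i) ^ (2^k)) (\<tau>k (motive_tau (motive_e i)))))"
          by (simp add: k_add k_scale k_T k_sum)
        moreover have "\<tau>k (motive_tau (motive_tau (motive_e j))) = (motive_tau ^^ n) (motive_e j)"
          by (simp add: \<tau>k_def 3 funpow_swap1)
        moreover have "P (\<tau>k (motive_e i))" "P (\<tau>k (motive_tau (motive_e i)))" for i
          using less(1)[of k i] less(1)[of "Suc k" i] by (simp_all add: \<tau>k_def 3 funpow_swap1)
        moreover have P_sum: "P (sum f S)" if "\<And>i. P (f i)" for f and S :: "2 set"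
        proof -
          have "P 0" using sc[OF b, of 0] by (simp add: scale_0)
          then show ?thesis by (induction S rule: infinite_finite_induct) (auto intro: add that)
        qed
        ultimately show ?thesis by (auto intro!: add sc T P_sum)
      qed
    qed
  qed
  then show ?thesis unfolding P_def .
qed

section \<open>Coordinates in this basis\<close>

lemma tate_tau_nth: "fps_nth (tate_tau f) n = fps_nth f n ^ 2"
  by (simp add: tate_tau_def)

lemma tate_tau_add: "tate_tau (f + g) = tate_tau f + tate_tau (g :: 'a fps)"
  by (simp add: fps_eq_iff tate_tau_nth char2_power2)

lemma tate_tau_0: "tate_tau 0 = (0 :: 'a fps)" and tate_tau_1: "tate_tau 1 = (1 :: 'a fps)"
  by (simp_all add: fps_eq_iff tate_tau_nth)

lemma tate_tau_mult: "tate_tau (f * g) = tate_tau f * tate_tau (g :: 'a fps)"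
proof -
  have "(\<Sum>i\<in>S. h i) ^ 2 = (\<Sum>i\<in>S. h i ^ 2)" for S and h :: "nat \<Rightarrow> 'a"
    by (induction S rule: infinite_finite_induct) (auto simp: char2_power2)
  then show ?thesis by (simp add: fps_eq_iff tate_tau_nth fps_mult_nth power_mult_distrib)
qed

lemma tate_tau_const: "tate_tau (fps_const c) = fps_const ((c::'a)^2)"
  and tate_tau_X: "tate_tau fps_X = (fps_X :: 'a fps)"
  by (simp_all add: fps_eq_iff tate_tau_nth fps_X_def)

lemma tate_tau_fps_of_poly: "p \<in> F2_poly \<Longrightarrow> tate_tau (fps_of_poly p) = fps_of_poly (p :: 'a poly)"
  by (simp add: fps_eq_iff tate_tau_nth F2_poly_def) (metis one_power2 zero_power2)

text \<open>The semilinear action of \<tau> in this basis: it sends e_j to \<tau> e_j, and \<tau>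
  e_j to \<tau>^2 e_j, which equals (T - \<theta>) e_j minus the sum of the A_jk \<tau> e_k.\<close>

definition coord_tau :: "'a ^ 2 ^ 2 \<Rightarrow> 'a fps ^ (2 + 2) \<Rightarrow> 'a fps ^ (2 + 2)" where
  "coord_tau A h = (\<chi> i. case i of
     Inl k \<Rightarrow> (fps_X - fps_const \<theta>) * tate_tau (h $ Inr k)
   | Inr k \<Rightarrow> tate_tau (h $ Inl k) - (\<Sum>j\<in>UNIV. tate_tau (h $ Inr j) * fps_const (A $ j $ k)))"

lemma coord_tau_add: "coord_tau A (h + h') = coord_tau A h + coord_tau A h'"
  by (auto simp: coord_tau_def vec_eq_iff tate_tau_add sum.distrib algebra_simps split: sum.splits)

lemma coord_tau_0: "coord_tau A 0 = 0"
  by (auto simp: coord_tau_def vec_eq_iff tate_tau_0 split: sum.splits)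

lemma coord_tau_scale: "coord_tau A (f *s h) = tate_tau f *s coord_tau A h"
  by (auto simp: coord_tau_def vec_eq_iff tate_tau_mult sum_distrib_left algebra_simps split: sum.splits)

lemma coord_tau_sum: "coord_tau A (sum f S) = (\<Sum>i\<in>S. coord_tau A (f i))"
  by (induction S rule: infinite_finite_induct) (auto simp: coord_tau_add coord_tau_0)

text \<open>The value on \<tau>^i e_j is obtained by iterating \<open>coord_tau\<close>. This avoids
  presupposing that the e_j and \<tau> e_j are independent over polynomials in T; independence then
  follows from \<open>coord_poly_act\<close> and \<open>coord_basis\<close>.\<close>

definition coord :: "'a ^ 2 ^ 2 \<Rightarrow> 'a poly ^ 2 \<Rightarrow> 'a fps ^ (2 + 2)" where
  "coord A m = (\<Sum>j\<in>UNIV. \<Sum>i\<le>Polynomial.degree (m $ j).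
     fps_const (Polynomial.coeff (m $ j) i) *s (coord_tau A ^^ i) (axis (Inl j) 1))"

lemma coord_altdef:
  assumes "\<And>j. Polynomial.degree (m $ j) < N"
  shows "coord A m = (\<Sum>j\<in>UNIV. \<Sum>i<N.
     fps_const (Polynomial.coeff (m $ j) i) *s (coord_tau A ^^ i) (axis (Inl j) 1))"
  unfolding coord_def
proof (rule sum.cong[OF refl])
  fix j
  show "(\<Sum>i\<le>Polynomial.degree (m $ j). fps_const (Polynomial.coeff (m $ j) i) *s (coord_tau A ^^ i) (axis (Inl j) 1))
    = (\<Sum>i<N. fps_const (Polynomial.coeff (m $ j) i) *s (coord_tau A ^^ i) (axis (Inl j) 1))"
    using assms[of j] by (intro sum.mono_neutral_left) (auto simp: coeff_eq_0)
qed

lemma motive_degree_bound: obtains N where "\<And>j. Polynomial.degree ((m :: 'a poly ^ 2) $ j) < N"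
proof
  show "Polynomial.degree (m $ j) < Suc (\<Sum>j\<in>UNIV. Polynomial.degree (m $ j))" for j
    unfolding less_Suc_eq_le by (rule member_le_sum) auto
qed

lemma coord_add: "coord A (m + m') = coord A m + coord A m'"
proof -
  obtain N N' where N: "\<And>j. Polynomial.degree (m $ j) < N" "\<And>j. Polynomial.degree (m' $ j) < N'"
    using motive_degree_bound by metis
  have 1: "\<And>j. Polynomial.degree (m $ j) < max N N'" "\<And>j. Polynomial.degree (m' $ j) < max N N'"
    using N by (auto simp: less_max_iff_disj)
  then have 2: "Polynomial.degree ((m + m') $ j) < max N N'" for j
    using degree_add_less[of "m $ j" "max N N'" "m' $ j"] by simp
  show ?thesis
    unfolding coord_altdef[OF 1(1)] coord_altdef[OF 1(2)] coord_altdef[OF 2]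
    by (simp add: sum.distrib fps_const_add[symmetric] del: fps_const_add)
qed

lemma coord_scale: "coord A (scale c m) = fps_const c *s coord A m"
proof -
  obtain N where N: "\<And>j. Polynomial.degree (m $ j) < N" by (rule motive_degree_bound[of m]) blast
  have 2: "Polynomial.degree (scale c m $ j) < N" for j
    using N[of j] degree_smult_le[of c "m $ j"] by (simp add: scale_def)
  show ?thesis
    unfolding coord_altdef[OF N] coord_altdef[OF 2]
    by (simp add: scale_def vec_sum_distrib_left)
qed

lemma coord_tau: "coord A (motive_tau m) = coord_tau A (coord A m)"
proof -
  obtain N where N: "\<And>j. Polynomial.degree (m $ j) < N" by (rule motive_degree_bound[of m]) blast
  have c: "Polynomial.coeff (motive_tau m $ j) n = (case n of 0 \<Rightarrow> 0 | Suc k \<Rightarrow> Polynomial.coeff (m $ j) k ^ 2)" for j n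
    by (simp add: motive_tau_def skew_act_def coeff_tau_mult)
  have 2: "Polynomial.degree (motive_tau m $ j) < Suc N" for j
    unfolding less_Suc_eq_le
    by (rule degree_le) (use N[of j] in \<open>auto simp: c coeff_eq_0 split: nat.splits\<close>)
  show ?thesis
    unfolding coord_altdef[OF N] coord_altdef[OF 2] sum.lessThan_Suc_shift
    by (simp add: c coord_tau_sum coord_tau_scale tate_tau_const)
qed

lemma coord_e: "coord A (motive_e j) = axis (Inl j) 1"
proof -
  have "(\<Sum>i\<le>Polynomial.degree (motive_e j $ k :: 'a poly).
      fps_const (Polynomial.coeff (motive_e j $ k) i) *s (coord_tau A ^^ i) (axis (Inl k) 1)) =
      (if k = j then axis (Inl j) 1 else 0)" for k
    by (simp add: motive_e_def axis_def)
  then show ?thesis by (simp add: coord_def)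
qed

lemma coord_tau_Inl: "coord_tau A (axis (Inl j) 1) = axis (Inr j) 1"
  by (auto simp: coord_tau_def vec_eq_iff axis_def tate_tau_0 tate_tau_1 split: sum.splits)

lemma coord_tau_Inr: "coord_tau A (axis (Inr j) 1) =
    (fps_X - fps_const \<theta>) *s axis (Inl j) 1 - (\<Sum>k\<in>UNIV. fps_const (A $ j $ k) *s axis (Inr k) 1)"
proof -
  have 1: "(\<Sum>i\<in>UNIV. tate_tau (axis (Inr j) 1 $ Inr i) * fps_const (A $ i $ k)) = fps_const (A $ j $ k)" for k
  proof -
    have eq: "tate_tau (axis (Inr j) 1 $ Inr i) * fps_const (A $ i $ k) = (if i = j then fps_const (A $ j $ k) else 0)" for i
      by (auto simp: axis_def tate_tau_0 tate_tau_1)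
    show ?thesis unfolding eq by simp
  qed
  have 2: "(\<Sum>i\<in>UNIV. fps_const (A $ j $ i) * axis (Inr i) 1 $ (Inr k)) = fps_const (A $ j $ k)" for k
  proof -
    have eq: "fps_const (A $ j $ i) * axis (Inr i) 1 $ (Inr k) = (if i = k then fps_const (A $ j $ k) else 0)" for i
      by (auto simp: axis_def)
    show ?thesis unfolding eq by simp
  qed
  show ?thesis
    unfolding vec_eq_iff
  proof
    fix i :: "2 + 2"
    show "coord_tau A (axis (Inr j) 1) $ i = ((fps_X - fps_const \<theta>) *s axis (Inl j) 1 -
      (\<Sum>k\<in>UNIV. fps_const (A $ j $ k) *s axis (Inr k) 1)) $ i"
    proof (cases i)
      case (Inl k)
      then show ?thesis by (simp add: coord_tau_def axis_def tate_tau_0 tate_tau_1)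
    next
      case (Inr k)
      have "coord_tau A (axis (Inr j) 1) $ i = tate_tau (axis (Inr j) 1 $ Inl k) - fps_const (A $ j $ k)"
        unfolding Inr coord_tau_def by (simp add: 1)
      moreover have "((fps_X - fps_const \<theta>) *s axis (Inl j) 1 -
          (\<Sum>k\<in>UNIV. fps_const (A $ j $ k) *s axis (Inr k) 1)) $ i =
          (fps_X - fps_const \<theta>) * axis (Inl j) 1 $ (Inr k) - fps_const (A $ j $ k)"
        unfolding Inr by (simp add: 2 algebra_simps)
      ultimately show ?thesis by (simp add: axis_def tate_tau_0)
    qed
  qed
qed

text \<open>Both sides are compatible with sums, scalars and \<tau>, which leaves m = e_j. There the
  \<theta> e_j and \<tau> e_k terms of T e_j cancel against those in the coordinates of \<tau>^2
  e_j.\<close>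

lemma coord_T: "coord A (motive_T \<theta> A m) = fps_X *s coord A m"
proof (rule motive_induct[of "\<lambda>m. coord A (motive_T \<theta> A m) = fps_X *s coord A m"])
  fix n j
  have coord_sum: "coord A (sum f S) = (\<Sum>i\<in>S. coord A (f i))" for f and S :: "2 set"
    using coord_scale[of A 0 0]
    by (induction S rule: infinite_finite_induct) (auto simp: coord_add scale_0)
  show "coord A (motive_T \<theta> A ((motive_tau ^^ n) (motive_e j))) = fps_X *s coord A ((motive_tau ^^ n) (motive_e j))"
  proof (induction n)
    case 0
    have "coord A (motive_T \<theta> A (motive_e j)) = fps_const \<theta> *s axis (Inl j) 1 +
        (\<Sum>k\<in>UNIV. fps_const (A $ j $ k) *s axis (Inr k) 1) + coord_tau A (axis (Inr j) 1)"
      by (simp add: motive_T_e coord_add coord_scale coord_sum coord_tau coord_e coord_tau_Inl)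
    also have "\<dots> = fps_X *s axis (Inl j) 1"
      unfolding coord_tau_Inr by (simp add: vec_eq_iff algebra_simps)
    finally show ?case by (simp add: coord_e)
  next
    case (Suc n)
    then show ?case by (simp add: motive_T_tau coord_tau coord_tau_scale tate_tau_X)
  qed
qed (auto simp: motive_T_add coord_add motive_T_scale coord_scale vector_add_ldistrib mult.commute)

lemma coord_poly_act: "coord A (motive_poly_act \<theta> A p m) = fps_of_poly p *s coord A m"
proof (induction p)
  case 0
  have "coord A 0 = 0" using coord_scale[of A 0 0] by (simp add: scale_0)
  then show ?case by (simp add: motive_poly_act_0)
next
  case (pCons c p)
  then show ?case
    by (simp add: motive_poly_act_pCons coord_add coord_scale coord_T fps_of_poly_pCons vec_eq_iff algebra_simps)
qed

lemma coord_basis: "coord A (motive_basis i) = axis i 1"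
  by (cases i) (auto simp: motive_basis_def coord_tau coord_e coord_tau_Inl)

end

section \<open>Tensor products with a free module\<close>

text \<open>\<open>M\<close> is free on the family \<open>b\<close>: its independence is witnessed by the map \<open>\<Phi>\<close>, which sends
  \<open>(m, f)\<close> to the coordinates of \<open>m \<otimes> f\<close>.\<close>

locale tensor_coords =
  fixes actM :: "'r \<Rightarrow> 'm \<Rightarrow> 'm :: ab_group_add" and actN :: "'r \<Rightarrow> 'n \<Rightarrow> 'n :: ab_group_add"
    and N :: "'n set" and b :: "'k :: finite \<Rightarrow> 'm" and \<Phi> :: "'m \<Rightarrow> 'n \<Rightarrow> 'n ^ 'k"
  assumes N_0: "0 \<in> N" and N_diff: "f \<in> N \<Longrightarrow> g \<in> N \<Longrightarrow> f - g \<in> N"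
    and \<Phi>_add_left: "f \<in> N \<Longrightarrow> \<Phi> (m + m') f = \<Phi> m f + \<Phi> m' f"
    and \<Phi>_add_right: "f \<in> N \<Longrightarrow> g \<in> N \<Longrightarrow> \<Phi> m (f + g) = \<Phi> m f + \<Phi> m g"
    and \<Phi>_balanced: "f \<in> N \<Longrightarrow> \<Phi> (actM r m) f = \<Phi> m (actN r f)"
    and \<Phi>_in_N: "f \<in> N \<Longrightarrow> \<Phi> m f $ i \<in> N"
    and actN_in_N: "f \<in> N \<Longrightarrow> actN r f \<in> N"
    and \<Phi>_b: "f \<in> N \<Longrightarrow> \<Phi> (b i) f = axis i f"
    and b_spans: "\<exists>r. m = (\<Sum>i\<in>UNIV. actM (r i) (b i)) \<and> (\<forall>f\<in>N. \<forall>i. \<Phi> m f $ i = actN (r i) f)"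
begin

abbreviation F :: "('m \<times> 'n \<Rightarrow>\<^sub>0 int) monoid" where "F \<equiv> tensor_free N"
abbreviation R :: "('m \<times> 'n \<Rightarrow>\<^sub>0 int) set" where "R \<equiv> tensor_relations actM actN N"

section \<open>The relation subgroup and its cosets\<close>

lemma N_add: "f \<in> N \<Longrightarrow> g \<in> N \<Longrightarrow> f + g \<in> N"
  using N_diff[of f "- g"] N_diff[OF N_0, of g] by simp

lemma comm_group_F: "comm_group F"
  by (simp add: tensor_free_def abelian_free_Abelian_group)

lemma group_F: "group F"
  using comm_group_F by (rule comm_group.axioms)

lemma carrier_F: "x \<in> carrier F \<longleftrightarrow> Poly_Mapping.keys x \<subseteq> UNIV \<times> N"
  by (simp add: tensor_free_def)

lemma mult_F: "x \<otimes>\<^bsub>F\<^esub> y = x + y" and one_F: "\<one>\<^bsub>F\<^esub> = 0"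
  by (simp_all add: tensor_free_def)

lemma inv_F: "x \<in> carrier F \<Longrightarrow> inv\<^bsub>F\<^esub> x = - x"
  by (simp add: tensor_free_def)

lemma frag_of_carrier: "f \<in> N \<Longrightarrow> frag_of (m, f) \<in> carrier F"
  by (simp add: carrier_F)

lemma F_closed: "x \<in> carrier F \<Longrightarrow> y \<in> carrier F \<Longrightarrow> x + y \<in> carrier F"
  "x \<in> carrier F \<Longrightarrow> y \<in> carrier F \<Longrightarrow> x - y \<in> carrier F" "0 \<in> carrier F"
  unfolding carrier_F using keys_add[of x y] keys_diff[of x y] by auto

abbreviation relation_gens :: "('m \<times> 'n \<Rightarrow>\<^sub>0 int) set" where
  "relation_gens \<equiv> {frag_of (m + m', f) - frag_of (m, f) - frag_of (m', f) | m m' f. f \<in> N} \<union>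
      {frag_of (m, f + f') - frag_of (m, f) - frag_of (m, f') | m f f'. f \<in> N \<and> f' \<in> N} \<union>
      {frag_of (actM r m, f) - frag_of (m, actN r f) | r m f. f \<in> N}"

lemma relation_gens_carrier: "relation_gens \<subseteq> carrier F"
  by (auto intro!: F_closed frag_of_carrier N_add actN_in_N)

lemma R_eq_generate: "R = generate F relation_gens"
  by (simp add: tensor_relations_def)

lemma subgroup_R: "subgroup R F"
  unfolding R_eq_generate by (rule group.generate_is_subgroup[OF group_F relation_gens_carrier])

lemma R_carrier: "x \<in> R \<Longrightarrow> x \<in> carrier F"
  using subgroup.subset[OF subgroup_R] by blast

lemma R_0: "0 \<in> R" and R_add: "x \<in> R \<Longrightarrow> y \<in> R \<Longrightarrow> x + y \<in> R"
  and R_uminus: "x \<in> R \<Longrightarrow> - x \<in> R"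
  using subgroup.one_closed[OF subgroup_R] subgroup.m_closed[OF subgroup_R, of x y]
    subgroup.m_inv_closed[OF subgroup_R, of x] R_carrier[of x]
  by (simp_all add: mult_F one_F inv_F)

lemma R_diff: "x \<in> R \<Longrightarrow> y \<in> R \<Longrightarrow> x - y \<in> R"
  using R_add[of x "- y"] R_uminus[of y] by simp

lemma R_sum: "(\<And>i. i \<in> S \<Longrightarrow> h i \<in> R) \<Longrightarrow> sum h S \<in> R"
  by (induction S rule: infinite_finite_induct) (auto intro: R_0 R_add)

lemma R_rel_add_left: "f \<in> N \<Longrightarrow> frag_of (m + m', f) - frag_of (m, f) - frag_of (m', f) \<in> R"
  and R_rel_add_right: "f \<in> N \<Longrightarrow> g \<in> N \<Longrightarrow> frag_of (m, f + g) - frag_of (m, f) - frag_of (m, g) \<in> R"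
  and R_rel_act: "f \<in> N \<Longrightarrow> frag_of (actM r m, f) - frag_of (m, actN r f) \<in> R"
  unfolding R_eq_generate by (rule generate.incl; blast)+

lemma coset_eq: "R #>\<^bsub>F\<^esub> x = {r + x | r. r \<in> R}"
  by (auto simp: r_coset_def mult_F)

lemma coset_eq_iff: "R #>\<^bsub>F\<^esub> x = R #>\<^bsub>F\<^esub> y \<longleftrightarrow> x - y \<in> R"
proof
  assume "R #>\<^bsub>F\<^esub> x = R #>\<^bsub>F\<^esub> y"
  then have "0 + x \<in> {r + y | r. r \<in> R}" using R_0 unfolding coset_eq by blast
  then show "x - y \<in> R" by auto
next
  assume xy: "x - y \<in> R"
  have "r + x = (r + (x - y)) + y" "r + y = (r - (x - y)) + x" for r by simp_all
  then show "R #>\<^bsub>F\<^esub> x = R #>\<^bsub>F\<^esub> y"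
    unfolding coset_eq using R_add[OF _ xy] R_diff[OF _ xy] by blast
qed

section \<open>The coordinate map and normal forms of tensors\<close>

lemma exists_coord_hom:
  "\<exists>h. (\<forall>x\<in>carrier F. \<forall>y\<in>carrier F. h (x + y) = h x + h y) \<and> (\<forall>m. \<forall>f\<in>N. h (frag_of (m, f)) = \<Phi> m f)"
proof -
  define G :: "('n ^ 'k) monoid" where "G = \<lparr>carrier = UNIV, monoid.mult = (+), one = 0\<rparr>"
  have "comm_group G"
  proof (rule comm_groupI)
    show "\<exists>y\<in>carrier G. y \<otimes>\<^bsub>G\<^esub> x = \<one>\<^bsub>G\<^esub>" for x
      by (intro bexI[of _ "- x"]) (auto simp: G_def)
  qed (auto simp: G_def algebra_simps)
  then interpret G: comm_group G .
  obtain h where h: "h \<in> hom (free_Abelian_group (UNIV \<times> N)) G"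
    "\<And>x. x \<in> UNIV \<times> N \<Longrightarrow> h (frag_of x) = (case x of (m, f) \<Rightarrow> \<Phi> m f)"
    by (rule G.free_Abelian_group_universal[of "\<lambda>(m, f). \<Phi> m f" "UNIV \<times> N"]) (auto simp: G_def)
  then show ?thesis
    by (intro exI[of _ h]) (auto simp: hom_def G_def tensor_free_def)
qed

definition \<Theta> :: "('m \<times> 'n \<Rightarrow>\<^sub>0 int) \<Rightarrow> 'n ^ 'k" where
  "\<Theta> = (SOME h. (\<forall>x\<in>carrier F. \<forall>y\<in>carrier F. h (x + y) = h x + h y) \<and> (\<forall>m. \<forall>f\<in>N. h (frag_of (m, f)) = \<Phi> m f))"

lemma \<Theta>_add: "x \<in> carrier F \<Longrightarrow> y \<in> carrier F \<Longrightarrow> \<Theta> (x + y) = \<Theta> x + \<Theta> y"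
  and \<Theta>_frag_of: "f \<in> N \<Longrightarrow> \<Theta> (frag_of (m, f)) = \<Phi> m f"
  using someI_ex[OF exists_coord_hom] unfolding \<Theta>_def[symmetric] by blast+

lemma \<Theta>_0: "\<Theta> 0 = 0"
  using \<Theta>_add[of 0 0] F_closed(3) by simp

lemma \<Theta>_diff: "x \<in> carrier F \<Longrightarrow> y \<in> carrier F \<Longrightarrow> \<Theta> (x - y) = \<Theta> x - \<Theta> y"
  using \<Theta>_add[of "x - y" y] F_closed(2)[of x y] by (simp add: algebra_simps)

lemma \<Theta>_uminus: "x \<in> carrier F \<Longrightarrow> \<Theta> (- x) = - \<Theta> x"
  using \<Theta>_diff[of 0 x] F_closed(3) by (simp add: \<Theta>_0)

lemma \<Theta>_relation_gens: "x \<in> relation_gens \<Longrightarrow> \<Theta> x = 0"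
  by (elim UnE CollectE exE conjE)
     (simp_all add: \<Theta>_diff \<Theta>_frag_of \<Phi>_add_left \<Phi>_add_right \<Phi>_balanced F_closed frag_of_carrier N_add actN_in_N)

lemma \<Theta>_R: "x \<in> R \<Longrightarrow> \<Theta> x = 0"
  unfolding R_eq_generate
proof (induction rule: generate.induct)
  case one
  then show ?case by (simp add: one_F \<Theta>_0)
next
  case (incl x)
  then show ?case by (rule \<Theta>_relation_gens)
next
  case (inv x)
  then have "x \<in> carrier F" using relation_gens_carrier by blast
  moreover have "\<Theta> x = 0" using inv by (rule \<Theta>_relation_gens)
  ultimately show ?case by (simp add: inv_F \<Theta>_uminus)
next
  case (eng x y)
  then have "x \<in> carrier F" "y \<in> carrier F"
    using group.generate_in_carrier[OF group_F relation_gens_carrier] by blast+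
  then show ?case using eng by (simp add: mult_F \<Theta>_add)
qed

definition vecs :: "('n ^ 'k) set" where "vecs = {h. \<forall>i. h $ i \<in> N}"

text \<open>A section of \<open>\<Theta>\<close>, representing the sum of the b_i \<otimes> h_i. It
  respects sums only modulo the relations.\<close>

definition \<Psi> :: "'n ^ 'k \<Rightarrow> ('m \<times> 'n \<Rightarrow>\<^sub>0 int)" where
  "\<Psi> h = (\<Sum>i\<in>UNIV. frag_of (b i, h $ i))"

lemma F_sum_closed: "(\<And>i. i \<in> S \<Longrightarrow> h i \<in> carrier F) \<Longrightarrow> sum h S \<in> carrier F"
  by (induction S rule: infinite_finite_induct) (auto intro: F_closed)

lemma \<Psi>_carrier: "h \<in> vecs \<Longrightarrow> \<Psi> h \<in> carrier F"
  unfolding \<Psi>_def by (intro F_sum_closed frag_of_carrier) (auto simp: vecs_def)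

lemma \<Theta>_sum: "(\<And>i. i \<in> S \<Longrightarrow> h i \<in> carrier F) \<Longrightarrow> \<Theta> (sum h S) = (\<Sum>i\<in>S. \<Theta> (h i))"
  by (induction S rule: infinite_finite_induct) (auto simp: \<Theta>_0 \<Theta>_add F_sum_closed)

lemma \<Theta>_\<Psi>: assumes "h \<in> vecs" shows "\<Theta> (\<Psi> h) = h"
proof -
  have "\<Theta> (\<Psi> h) = (\<Sum>i\<in>UNIV. axis i (h $ i))"
    unfolding \<Psi>_def using assms
    by (subst \<Theta>_sum) (auto simp: vecs_def frag_of_carrier \<Theta>_frag_of \<Phi>_b)
  also have "\<dots> = h"
  proof -
    have "(\<Sum>i\<in>UNIV. axis i (h $ i) $ j) = (\<Sum>i\<in>UNIV. if i = j then h $ j else 0)" for j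
      by (intro sum.cong refl) (auto simp: axis_def)
    then show ?thesis by (simp add: vec_eq_iff)
  qed
  finally show ?thesis .
qed

lemma vecs_diff: "h \<in> vecs \<Longrightarrow> h' \<in> vecs \<Longrightarrow> h - h' \<in> vecs"
  and vecs_0: "0 \<in> vecs"
  by (auto simp: vecs_def N_0 intro: N_diff)

lemma frag_of_sum_left:
  "f \<in> N \<Longrightarrow> frag_of (sum h S, f) - (\<Sum>i\<in>S. frag_of (h i, f)) \<in> R"
proof (induction S rule: infinite_finite_induct)
  case (insert i S)
  have "frag_of (h i + sum h S, f) - (frag_of (h i, f) + (\<Sum>i\<in>S. frag_of (h i, f))) =
    (frag_of (h i + sum h S, f) - frag_of (h i, f) - frag_of (sum h S, f)) +
    (frag_of (sum h S, f) - (\<Sum>i\<in>S. frag_of (h i, f)))" by simp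
  also have "\<dots> \<in> R" using insert by (intro R_add R_rel_add_left)
  finally show ?case using insert by simp
\<comment> \<open>For the empty sum, left additivity with m = m' = 0 reduces to the relation
  -\<open>frag_of (0, f)\<close>.\<close>
qed (use R_uminus[OF R_rel_add_left[of f 0 0]] in simp_all)

text \<open>Expand m in the basis by additivity on the left, then move each scalar across the tensor
  sign.\<close>

lemma frag_of_expand: assumes f: "f \<in> N" shows "frag_of (m, f) - \<Psi> (\<Phi> m f) \<in> R"
proof -
  obtain r where r: "m = (\<Sum>i\<in>UNIV. actM (r i) (b i))" "\<And>i. \<Phi> m f $ i = actN (r i) f"
    using b_spans f by metis
  have "frag_of (m, f) - \<Psi> (\<Phi> m f) =
    (frag_of (\<Sum>i\<in>UNIV. actM (r i) (b i), f) - (\<Sum>i\<in>UNIV. frag_of (actM (r i) (b i), f))) +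
    (\<Sum>i\<in>UNIV. frag_of (actM (r i) (b i), f) - frag_of (b i, actN (r i) f))"
    unfolding r(1)[symmetric] by (simp add: \<Psi>_def r(2) sum_subtractf)
  also have "\<dots> \<in> R" by (intro R_add frag_of_sum_left R_sum R_rel_act f)
  finally show ?thesis .
qed

lemma \<Psi>_diff: assumes "h \<in> vecs" "h' \<in> vecs" shows "\<Psi> h - \<Psi> h' - \<Psi> (h - h') \<in> R"
proof -
  have "\<Psi> h - \<Psi> h' - \<Psi> (h - h') =
    (\<Sum>i\<in>UNIV. frag_of (b i, (h - h') $ i + h' $ i) - frag_of (b i, (h - h') $ i) - frag_of (b i, h' $ i))"
    by (simp add: \<Psi>_def sum_subtractf)
  also have "\<dots> \<in> R"
    using assms vecs_diff[OF assms] by (intro R_sum R_rel_add_right) (auto simp: vecs_def)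
  finally show ?thesis .
qed

text \<open>Normal form of a tensor. With \<open>\<Theta>_R\<close> and
  \<open>\<Theta>_\<Psi>\<close> it identifies the cosets with the vectors over N.\<close>

lemma expand: assumes "x \<in> carrier F" shows "\<Theta> x \<in> vecs \<and> x - \<Psi> (\<Theta> x) \<in> R"
proof -
  have "Poly_Mapping.keys x \<subseteq> UNIV \<times> N" using assms by (simp add: carrier_F)
  then have "x \<in> carrier F \<and> \<Theta> x \<in> vecs \<and> x - \<Psi> (\<Theta> x) \<in> R"
  proof (induction x rule: frag_induction)
    case zero
    have "\<Psi> 0 \<in> R" using R_uminus[OF \<Psi>_diff[OF vecs_0 vecs_0]] by simp
    then show ?case using R_uminus by (auto simp: F_closed \<Theta>_0 vecs_0)
  next
    case (one x)
    then show ?case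
      by (cases x) (auto simp: frag_of_carrier \<Theta>_frag_of frag_of_expand vecs_def \<Phi>_in_N)
  next
    case (diff x y)
    have "x - y - \<Psi> (\<Theta> x - \<Theta> y) =
      (x - \<Psi> (\<Theta> x)) - (y - \<Psi> (\<Theta> y)) + (\<Psi> (\<Theta> x) - \<Psi> (\<Theta> y) - \<Psi> (\<Theta> x - \<Theta> y))" by simp
    also have "\<dots> \<in> R" using diff by (intro R_add[OF R_diff \<Psi>_diff]) auto
    finally show ?case using diff by (auto simp: F_closed \<Theta>_diff vecs_diff)
  qed
  then show ?thesis by blast
qed

definition \<Omega> :: "'n ^ 'k \<Rightarrow> ('m \<times> 'n \<Rightarrow>\<^sub>0 int) set" where
  "\<Omega> h = R #>\<^bsub>F\<^esub> \<Psi> h"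

lemma coset_eq_\<Omega>: "x \<in> carrier F \<Longrightarrow> R #>\<^bsub>F\<^esub> x = \<Omega> (\<Theta> x)"
  unfolding \<Omega>_def coset_eq_iff using expand by blast

lemma in_\<Omega>D:
  assumes "h \<in> vecs" "x \<in> \<Omega> h" shows "x \<in> carrier F" "\<Theta> x = h"
proof -
  obtain r where r: "r \<in> R" "x = r + \<Psi> h" using assms(2) unfolding \<Omega>_def coset_eq by blast
  then show "x \<in> carrier F" "\<Theta> x = h"
    using R_carrier[OF r(1)] \<Psi>_carrier[OF assms(1)] by (simp_all add: F_closed \<Theta>_add \<Theta>_R \<Theta>_\<Psi> assms(1))
qed

lemma \<Psi>_in_\<Omega>: "\<Psi> h \<in> \<Omega> h"
  using R_0 by (force simp: \<Omega>_def coset_eq)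

lemma inj_\<Omega>: "inj_on \<Omega> vecs"
  by (rule inj_onI) (metis in_\<Omega>D(2) \<Psi>_in_\<Omega>)

lemma carrier_tensor_group: "carrier (tensor_group actM actN N) = \<Omega> ` vecs"
proof -
  have "carrier (tensor_group actM actN N) = (\<lambda>x. R #>\<^bsub>F\<^esub> x) ` carrier F"
    by (auto simp: tensor_group_def FactGroup_def RCOSETS_def)
  also have "\<dots> = \<Omega> ` vecs"
  proof (intro equalityI subsetI)
    fix X assume "X \<in> \<Omega> ` vecs"
    then show "X \<in> (\<lambda>x. R #>\<^bsub>F\<^esub> x) ` carrier F" using \<Psi>_carrier by (auto simp: \<Omega>_def)
  qed (use coset_eq_\<Omega> expand in auto)
  finally show ?thesis .
qed

lemma one_tensor_group: "\<one>\<^bsub>tensor_group actM actN N\<^esub> = \<Omega> 0"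
proof -
  have "R #>\<^bsub>F\<^esub> 0 = R" by (simp add: coset_eq)
  moreover have "R #>\<^bsub>F\<^esub> 0 = \<Omega> 0" using coset_eq_\<Omega>[of 0] by (simp add: F_closed \<Theta>_0)
  ultimately show ?thesis by (simp add: tensor_group_def FactGroup_def)
qed

lemma mult_tensor_group:
  assumes "h \<in> vecs" "h' \<in> vecs"
  shows "\<Omega> h \<otimes>\<^bsub>tensor_group actM actN N\<^esub> \<Omega> h' = \<Omega> (h + h')"
proof -
  have "normal R F" by (rule comm_group.subgroup_imp_normal[OF comm_group_F subgroup_R])
  then have "\<Omega> h <#>\<^bsub>F\<^esub> \<Omega> h' = R #>\<^bsub>F\<^esub> (\<Psi> h + \<Psi> h')"
    unfolding \<Omega>_def using normal.rcos_sum[of R F "\<Psi> h" "\<Psi> h'"] assms by (simp add: mult_F \<Psi>_carrier)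
  also have "\<dots> = \<Omega> (h + h')"
    using coset_eq_\<Omega>[of "\<Psi> h + \<Psi> h'"] assms by (simp add: F_closed \<Psi>_carrier \<Theta>_add \<Theta>_\<Psi>)
  finally show ?thesis by (simp add: tensor_group_def FactGroup_def)
qed

text \<open>S is the induced map on coordinates. All representatives of a coset have the same
  coordinates, so the union in \<open>tensor_map\<close> consists of a single coset.\<close>

lemma tensor_map_\<Omega>:
  assumes s: "\<And>f. f \<in> N \<Longrightarrow> s f \<in> N"
    and S: "\<And>m f. f \<in> N \<Longrightarrow> S (\<Phi> m f) = \<Phi> (g m) (s f)" "\<And>x y. S (x - y) = S x - S y"
    and h: "h \<in> vecs"
  shows "tensor_map actM actN N g s (\<Omega> h) = \<Omega> (S h)"
proof -
  let ?e = "frag_extend (\<lambda>(m, f). frag_of (g m, s f))"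
  have S0: "S 0 = 0" using S(2)[of 0 0] by simp
  have e: "?e x \<in> carrier F \<and> \<Theta> (?e x) = S (\<Theta> x)" if "x \<in> carrier F" for x
  proof -
    have "Poly_Mapping.keys x \<subseteq> UNIV \<times> N" using that by (simp add: carrier_F)
    then have "x \<in> carrier F \<and> ?e x \<in> carrier F \<and> \<Theta> (?e x) = S (\<Theta> x)"
    proof (induction x rule: frag_induction)
      case zero
      then show ?case by (simp add: F_closed \<Theta>_0 S0)
    next
      case (one x)
      then show ?case by (cases x) (auto simp: frag_of_carrier \<Theta>_frag_of S s)
    next
      case (diff x y)
      then show ?case by (simp add: F_closed frag_extend_diff \<Theta>_diff S)
    qed
    then show ?thesis by blast
  qed
  have "R #>\<^bsub>F\<^esub> ?e x = \<Omega> (S h)" if "x \<in> \<Omega> h" for x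
    using e coset_eq_\<Omega> in_\<Omega>D[OF h that] by metis
  then show ?thesis
    unfolding tensor_map_def using \<Psi>_in_\<Omega>[of h] by auto
qed

end

section \<open>The module of invariants\<close>

lemma ex1_transfer:
  assumes "\<And>y. Q y \<Longrightarrow> P (f y) \<and> g (f y) = y" "\<And>x. P x \<Longrightarrow> Q (g x) \<and> f (g x) = x"
  shows "(\<exists>!y. Q y) \<longleftrightarrow> (\<exists>!x. P x)"
  by (metis assms)

context C_infinity
begin

section \<open>Closure properties of the Tate algebra\<close>

lemma tate_iff: "f \<in> tate ord \<longleftrightarrow> (\<forall>K::real. \<forall>\<^sub>F i in sequentially. ereal K < ord (fps_nth f i))"
  by (simp add: tate_def tendsto_PInfty)

lemma tate_0: "0 \<in> tate ord"
  by (simp add: tate_iff)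

lemma tate_add: "f \<in> tate ord \<Longrightarrow> g \<in> tate ord \<Longrightarrow> f + g \<in> tate ord"
  unfolding tate_iff by (auto intro: eventually_elim2 ord_add_gt)

lemma fps_uminus_eq: "- f = (f :: 'a fps)"
  by (simp add: fps_eq_iff uminus_eq)

lemma tate_diff: "f \<in> tate ord \<Longrightarrow> g \<in> tate ord \<Longrightarrow> f - g \<in> tate ord"
  using tate_add[of f g] fps_uminus_eq[of g] by (metis add_uminus_conv_diff)

lemma tate_const_mult:
  assumes "f \<in> tate ord" shows "fps_const c * f \<in> tate ord"
proof (cases "c = 0")
  case False
  then obtain a where a: "ord c = ereal a" by (rule ord_nonzero)
  have "\<forall>\<^sub>F i in sequentially. ereal K < ord (fps_nth (fps_const c * f) i)" for K
  proof -
    have "\<forall>\<^sub>F i in sequentially. ereal (K - a) < ord (fps_nth f i)" using assms by (simp add: tate_iff)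
    then show ?thesis
    proof eventually_elim
      case (elim i)
      then show ?case by (cases "ord (fps_nth f i)") (auto simp: ord_mult a)
    qed
  qed
  then show ?thesis by (simp add: tate_iff)
qed (simp add: tate_0)

lemma tate_X_mult_iff: "fps_X * f \<in> tate ord \<longleftrightarrow> f \<in> tate ord"
proof -
  have "f \<in> tate ord \<longleftrightarrow> (\<lambda>i. ord (fps_nth (fps_X * f) (Suc i))) \<longlonglongrightarrow> \<infinity>"
    by (simp add: tate_def)
  also have "\<dots> \<longleftrightarrow> fps_X * f \<in> tate ord"
    unfolding tate_def mem_Collect_eq by (rule filterlim_sequentially_Suc)
  finally show ?thesis ..
qed

lemma tate_poly_mult: "f \<in> tate ord \<Longrightarrow> fps_of_poly p * f \<in> tate ord"
proof (induction p)
  case (pCons c p)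
  have "fps_of_poly (pCons c p) * f = fps_const c * f + fps_X * (fps_of_poly p * f)"
    by (simp add: fps_of_poly_pCons algebra_simps)
  then show ?case using pCons by (simp add: tate_add tate_const_mult tate_X_mult_iff)
qed (simp add: tate_0)

lemma tate_mult_poly: "f \<in> tate ord \<Longrightarrow> f * fps_of_poly p \<in> tate ord"
  by (simp add: tate_poly_mult mult.commute[of f])

text \<open>The auxiliary bound |K| ensures that the order is positive, so that doubling it does not
  decrease it.\<close>

lemma tate_tau_closed:
  assumes "f \<in> tate ord" shows "tate_tau f \<in> tate ord"
proof -
  have "\<forall>\<^sub>F i in sequentially. ereal K < ord (fps_nth (tate_tau f) i)" for K
  proof -
    have "\<forall>\<^sub>F i in sequentially. ereal \<bar>K\<bar> < ord (fps_nth f i)" using assms by (simp add: tate_iff)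
    then show ?thesis
    proof eventually_elim
      case (elim i)
      then show ?case
        by (cases "ord (fps_nth f i)") (auto simp: tate_tau_nth power2_eq_square ord_mult)
    qed
  qed
  then show ?thesis by (simp add: tate_iff)
qed

section \<open>Invariants as solutions of power series equations\<close>

lemma coord_spans:
  "\<exists>p. m = (\<Sum>i\<in>UNIV. motive_poly_act \<theta> A (p i) (motive_basis i)) \<and> (\<forall>i. coord A m $ i = fps_of_poly (p i))"
proof -
  obtain p where p: "m = (\<Sum>i\<in>UNIV. motive_poly_act \<theta> A (p i) (motive_basis i))"
    using motive_basis_spans by blast
  have coord_sum: "coord A (sum f S) = (\<Sum>i\<in>S. coord A (f i))" for f and S :: "(2 + 2) set"
    using coord_scale[of A 0 0]
    by (induction S rule: infinite_finite_induct) (auto simp: coord_add scale_0)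
  have "coord A m $ i = fps_of_poly (p i)" for i
  proof -
    have "coord A m $ i = (\<Sum>j\<in>UNIV. fps_of_poly (p j) * axis j 1 $ i)"
      by (subst p) (simp add: coord_sum coord_poly_act coord_basis)
    also have "\<dots> = (\<Sum>j\<in>UNIV. if j = i then fps_of_poly (p i) else 0)"
      by (intro sum.cong refl) (auto simp: axis_def)
    finally show ?thesis by simp
  qed
  then show ?thesis using p by blast
qed

text \<open>The equation \<open>coord_tau A h = h\<close> after eliminating the e_k-coordinates,
  which equal (T - \<theta>) \<tau>(Z_k). As \<tau> maps T - \<theta> to T - \<theta>^2, the
  parameter appears squared.\<close>

definition tau_solutions :: "'a ^ 2 ^ 2 \<Rightarrow> ('a fps ^ 2) set" where
  "tau_solutions A = {Z. \<forall>k. Z $ k \<in> tate ord \<and>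
     Z $ k = (fps_X - fps_const (\<theta>^2)) * tate_tau (tate_tau (Z $ k))
       - (\<Sum>j\<in>UNIV. tate_tau (Z $ j) * fps_const (A $ j $ k))}"

lemma tau_solutions_0: "0 \<in> tau_solutions A"
  by (simp add: tau_solutions_def tate_0 tate_tau_0)

lemma tau_solutions_add: "Z \<in> tau_solutions A \<Longrightarrow> Z' \<in> tau_solutions A \<Longrightarrow> Z + Z' \<in> tau_solutions A"
  unfolding tau_solutions_def mem_Collect_eq
proof (intro allI conjI)
  fix k
  assume Z: "\<forall>k. Z $ k \<in> tate ord \<and>
     Z $ k = (fps_X - fps_const (\<theta>^2)) * tate_tau (tate_tau (Z $ k))
       - (\<Sum>j\<in>UNIV. tate_tau (Z $ j) * fps_const (A $ j $ k))"
   and Z': "\<forall>k. Z' $ k \<in> tate ord \<and>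
     Z' $ k = (fps_X - fps_const (\<theta>^2)) * tate_tau (tate_tau (Z' $ k))
       - (\<Sum>j\<in>UNIV. tate_tau (Z' $ j) * fps_const (A $ j $ k))"
  show "(Z + Z') $ k \<in> tate ord" using Z Z' by (simp add: tate_add)
  have "(Z + Z') $ k = ((fps_X - fps_const (\<theta>^2)) * tate_tau (tate_tau (Z $ k))
       - (\<Sum>j\<in>UNIV. tate_tau (Z $ j) * fps_const (A $ j $ k))) +
     ((fps_X - fps_const (\<theta>^2)) * tate_tau (tate_tau (Z' $ k))
       - (\<Sum>j\<in>UNIV. tate_tau (Z' $ j) * fps_const (A $ j $ k)))"
    using Z Z' by (metis vector_add_component)
  also have "\<dots> = (fps_X - fps_const (\<theta>^2)) * tate_tau (tate_tau ((Z + Z') $ k))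
       - (\<Sum>j\<in>UNIV. tate_tau ((Z + Z') $ j) * fps_const (A $ j $ k))"
    by (simp add: tate_tau_add sum.distrib algebra_simps)
  finally show "(Z + Z') $ k = (fps_X - fps_const (\<theta>^2)) * tate_tau (tate_tau ((Z + Z') $ k))
       - (\<Sum>j\<in>UNIV. tate_tau ((Z + Z') $ j) * fps_const (A $ j $ k))" .
qed

lemma tau_solutions_X_mult_iff: "fps_X *s Z \<in> tau_solutions A \<longleftrightarrow> Z \<in> tau_solutions A"
proof -
  have "(fps_X - fps_const (\<theta>^2)) * tate_tau (tate_tau (fps_X * Z $ k))
       - (\<Sum>j\<in>UNIV. tate_tau (fps_X * Z $ j) * fps_const (A $ j $ k)) =
     fps_X * ((fps_X - fps_const (\<theta>^2)) * tate_tau (tate_tau (Z $ k))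
       - (\<Sum>j\<in>UNIV. tate_tau (Z $ j) * fps_const (A $ j $ k)))" for k
    by (simp add: tate_tau_mult tate_tau_X sum_distrib_left right_diff_distrib mult.assoc mult.left_commute)
  then show ?thesis by (simp add: tau_solutions_def tate_X_mult_iff)
qed

lemma tau_solutions_poly_mult:
  assumes "p \<in> F2_poly" "Z \<in> tau_solutions A" shows "fps_of_poly p *s Z \<in> tau_solutions A"
  using assms
proof (induction p)
  case (pCons c p)
  then have "c \<in> {0, 1}" "fps_of_poly p *s Z \<in> tau_solutions A" by (auto simp: F2_poly_pCons_iff)
  moreover have "fps_of_poly (pCons c p) *s Z = fps_const c *s Z + fps_X *s (fps_of_poly p *s Z)"
    by (simp add: fps_of_poly_pCons vec_eq_iff algebra_simps)
  ultimately show ?case using pCons.prems tau_solutions_0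
    by (auto intro!: tau_solutions_add simp: tau_solutions_X_mult_iff simp del: vector_smult_assoc)
qed (simp add: tau_solutions_0)

end

section \<open>Identification of H^1 with the solutions\<close>

locale motive = C_infinity ord \<theta> for ord :: "'a::field \<Rightarrow> ereal" and \<theta> +
  fixes A :: "'a ^ 2 ^ 2"
begin

sublocale tensor_coords "motive_poly_act \<theta> A" tate_poly_act "tate ord" motive_basis "\<lambda>m f. f *s coord A m"
proof
  fix m and f assume f: "f \<in> tate ord"
  show "(f *s coord A m) $ i \<in> tate ord" for i
    using coord_spans[of m A] tate_poly_mult[OF f] by (metis mult.commute vector_smult_component)
  show "f *s coord A (motive_basis i) = axis i f" for i
    by (simp add: coord_basis vec_eq_iff axis_def)
next
  fix m
  obtain p where "m = (\<Sum>i\<in>UNIV. motive_poly_act \<theta> A (p i) (motive_basis i))"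
    "\<forall>i. coord A m $ i = fps_of_poly (p i)" using coord_spans[of m A] by blast
  then show "\<exists>r. m = (\<Sum>i\<in>UNIV. motive_poly_act \<theta> A (r i) (motive_basis i)) \<and>
      (\<forall>f\<in>tate ord. \<forall>i. (f *s coord A m) $ i = tate_poly_act (r i) f)"
    by (intro exI[of _ p]) (simp add: tate_poly_act_def mult.commute)
qed (auto simp: tate_0 tate_diff coord_add vector_add_ldistrib vector_sadd_rdistrib coord_poly_act
       tate_poly_act_def tate_mult_poly mult.commute)

abbreviation HM where "HM \<equiv> H1 ord \<theta> A"

text \<open>Undoes the elimination: Z gives the \<tau> e_k-coordinates, and invariance dictates the
  others.\<close>

definition embed :: "'a fps ^ 2 \<Rightarrow> 'a fps ^ (2 + 2)" where
  "embed Z = (\<chi> i. case i of Inl k \<Rightarrow> (fps_X - fps_const \<theta>) * tate_tau (Z $ k) | Inr k \<Rightarrow> Z $ k)"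

lemma embed_add: "embed (Z + Z') = embed Z + embed Z'"
  by (auto simp: embed_def vec_eq_iff tate_tau_add algebra_simps split: sum.splits)

lemma embed_0: "embed 0 = 0"
  by (auto simp: embed_def vec_eq_iff tate_tau_0 split: sum.splits)

text \<open>The e_k-coordinates pass through \<tau>, which fixes p because its coefficients lie in
  F_2.\<close>

lemma embed_poly_mult: "p \<in> F2_poly \<Longrightarrow> embed (fps_of_poly p *s Z) = fps_of_poly p *s embed Z"
  by (auto simp: embed_def vec_eq_iff tate_tau_mult tate_tau_fps_of_poly algebra_simps split: sum.splits)

lemma inj_embed: "inj embed"
proof (rule injI)
  fix Z Z' assume "embed Z = embed Z'"
  then have "embed Z $ Inr k = embed Z' $ Inr k" for k by simp
  then show "Z = Z'" by (simp add: embed_def vec_eq_iff)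
qed

lemma coord_tau_diff: "coord_tau A (x - y) = coord_tau A x - coord_tau A y"
  using coord_tau_add[of A "x - y" y] by (simp add: algebra_simps)

lemma tate_linear_factor: "f \<in> tate ord \<Longrightarrow> (fps_X - fps_const c) * f \<in> tate ord"
  by (simp add: left_diff_distrib tate_diff tate_X_mult_iff tate_const_mult)

lemma tate_tau_linear_factor: "tate_tau (fps_X - fps_const c) = fps_X - fps_const ((c::'a)^2)"
  using tate_tau_add[of fps_X "- fps_const c"]
  by (simp add: fps_uminus_eq tate_tau_X tate_tau_const flip: fps_const_neg add: diff_conv_add_uminus)

lemma fixed_vecs: "{h \<in> vecs. coord_tau A h = h} = embed ` tau_solutions A"
proof (intro equalityI subsetI)
  fix h assume h: "h \<in> {h \<in> vecs. coord_tau A h = h}"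
  define Z where "Z = (\<chi> k. h $ Inr k)"
  have Inl: "h $ Inl k = (fps_X - fps_const \<theta>) * tate_tau (Z $ k)" for k
  proof -
    have "h $ Inl k = coord_tau A h $ Inl k" using h by simp
    then show ?thesis by (simp add: coord_tau_def Z_def)
  qed
  have Inr: "Z $ k = tate_tau (h $ Inl k) - (\<Sum>j\<in>UNIV. tate_tau (Z $ j) * fps_const (A $ j $ k))" for k
  proof -
    have "h $ Inr k = coord_tau A h $ Inr k" using h by simp
    then show ?thesis by (simp add: coord_tau_def Z_def)
  qed
  have "Z \<in> tau_solutions A"
    using h Inr by (simp add: tau_solutions_def vecs_def Inl tate_tau_mult tate_tau_linear_factor) (simp add: Z_def)
  moreover have "h = embed Z"
    by (auto simp: vec_eq_iff embed_def Inl split: sum.splits) (simp add: Z_def)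
  ultimately show "h \<in> embed ` tau_solutions A" by blast
next
  fix h assume "h \<in> embed ` tau_solutions A"
  then obtain Z where Z: "Z \<in> tau_solutions A" "h = embed Z" by blast
  have "embed Z \<in> vecs"
    using Z(1) by (auto simp: vecs_def embed_def tau_solutions_def tate_linear_factor tate_tau_closed split: sum.splits)
  moreover have "coord_tau A (embed Z) = embed Z"
  proof -
    have "coord_tau A (embed Z) $ i = embed Z $ i" for i
    proof (cases i)
      case (Inr k)
      have "Z $ k = (fps_X - fps_const (\<theta>^2)) * tate_tau (tate_tau (Z $ k))
         - (\<Sum>j\<in>UNIV. tate_tau (Z $ j) * fps_const (A $ j $ k))" using Z(1) unfolding tau_solutions_def by blast
      then show ?thesis by (simp add: coord_tau_def embed_def Inr tate_tau_mult tate_tau_linear_factor)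
    qed (simp add: coord_tau_def embed_def)
    then show ?thesis by (simp add: vec_eq_iff)
  qed
  ultimately show "h \<in> {h \<in> vecs. coord_tau A h = h}" using Z(2) by simp
qed

lemma embed_in_vecs: "Z \<in> tau_solutions A \<Longrightarrow> embed Z \<in> vecs"
  using fixed_vecs by blast

lemma tensor_map_tau:
  assumes "h \<in> vecs"
  shows "tensor_map (motive_poly_act \<theta> A) tate_poly_act (tate ord) motive_tau tate_tau (\<Omega> h) = \<Omega> (coord_tau A h)"
  by (rule tensor_map_\<Omega>) (simp_all add: assms tate_tau_closed coord_tau coord_tau_scale coord_tau_diff)

lemma tensor_map_poly:
  assumes "h \<in> vecs"
  shows "tensor_map (motive_poly_act \<theta> A) tate_poly_act (tate ord) id (tate_poly_act p) (\<Omega> h) = \<Omega> (fps_of_poly p *s h)"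
  by (rule tensor_map_\<Omega>)
     (simp_all add: assms tate_mult_poly tate_poly_act_def vec_eq_iff algebra_simps)

lemma coord_tau_in_vecs:
  assumes "h \<in> vecs" shows "coord_tau A h \<in> vecs"
proof -
  have sum: "sum f S \<in> tate ord" if "\<And>i. f i \<in> tate ord" for f and S :: "2 set"
    by (induction S rule: infinite_finite_induct) (auto simp: tate_0 intro: tate_add that)
  show ?thesis
    using assms
    by (auto simp: vecs_def coord_tau_def tate_linear_factor tate_tau_closed mult.commute[of _ "fps_const _"]
        intro!: tate_diff sum tate_const_mult split: sum.splits)
qed

definition to_H1 :: "'a fps ^ 2 \<Rightarrow> (('a poly ^ 2) \<times> 'a fps \<Rightarrow>\<^sub>0 int) set" where
  "to_H1 Z = \<Omega> (embed Z)"

lemma carrier_H1: "carrier HM = to_H1 ` tau_solutions A"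
proof -
  have "carrier HM = {X \<in> \<Omega> ` vecs. tensor_map (motive_poly_act \<theta> A) tate_poly_act (tate ord) motive_tau tate_tau X = X}"
    by (simp add: H1_def Let_def carrier_tensor_group)
  also have "\<dots> = \<Omega> ` {h \<in> vecs. coord_tau A h = h}"
    using tensor_map_tau coord_tau_in_vecs inj_onD[OF inj_\<Omega>] by (auto simp: image_iff)
  finally show ?thesis unfolding fixed_vecs to_H1_def[abs_def] by (simp add: image_image)
qed

lemma inj_to_H1: "inj_on to_H1 (tau_solutions A)"
  by (rule inj_onI) (metis to_H1_def inj_onD[OF inj_\<Omega>] embed_in_vecs injD[OF inj_embed])

lemma add_H1: "Z \<in> tau_solutions A \<Longrightarrow> Z' \<in> tau_solutions A \<Longrightarrow> to_H1 Z \<oplus>\<^bsub>HM\<^esub> to_H1 Z' = to_H1 (Z + Z')"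
  by (simp add: H1_def Let_def to_H1_def mult_tensor_group embed_in_vecs embed_add)

lemma zero_H1: "\<zero>\<^bsub>HM\<^esub> = to_H1 0"
  by (simp add: H1_def Let_def to_H1_def one_tensor_group embed_0)

lemma smult_H1: "p \<in> F2_poly \<Longrightarrow> Z \<in> tau_solutions A \<Longrightarrow> p \<odot>\<^bsub>HM\<^esub> to_H1 Z = to_H1 (fps_of_poly p *s Z)"
  by (simp add: H1_def Let_def to_H1_def tensor_map_poly embed_in_vecs embed_poly_mult)

lemma abelian_monoid_H1: "abelian_monoid HM"
proof (rule abelian_monoidI)
  show "\<zero>\<^bsub>HM\<^esub> \<in> carrier HM" unfolding carrier_H1 zero_H1 by (rule imageI[OF tau_solutions_0])
qed (auto simp: carrier_H1 add_H1 zero_H1 tau_solutions_add tau_solutions_0 ac_simps)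

lemma finsum_H1:
  assumes "finite B" "B \<subseteq> tau_solutions A" "c \<in> to_H1 ` B \<rightarrow> F2_poly"
  shows "(\<Oplus>\<^bsub>HM\<^esub>x\<in>to_H1 ` B. c x \<odot>\<^bsub>HM\<^esub> x) = to_H1 (\<Sum>b\<in>B. fps_of_poly (c (to_H1 b)) *s b)"
  using assms
proof (induction B rule: finite_induct)
  case empty
  then show ?case using abelian_monoid.finsum_empty[OF abelian_monoid_H1] by (simp add: zero_H1)
next
  case (insert b B)
  have smult: "c (to_H1 b') \<odot>\<^bsub>HM\<^esub> to_H1 b' = to_H1 (fps_of_poly (c (to_H1 b')) *s b')"
    "fps_of_poly (c (to_H1 b')) *s b' \<in> tau_solutions A" if "b' \<in> insert b B" for b'
    using that insert.prems by (auto intro!: smult_H1 tau_solutions_poly_mult)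
  have sum: "(\<Sum>b\<in>B. fps_of_poly (c (to_H1 b)) *s b) \<in> tau_solutions A"
    using \<open>finite B\<close> smult(2)
    by (induction B rule: finite_induct) (auto intro: tau_solutions_0 tau_solutions_add)
  have "to_H1 b \<notin> to_H1 ` B"
    using insert.hyps insert.prems inj_onD[OF inj_to_H1] by (auto dest: subsetD)
  then have "(\<Oplus>\<^bsub>HM\<^esub>x\<in>to_H1 ` insert b B. c x \<odot>\<^bsub>HM\<^esub> x) =
      c (to_H1 b) \<odot>\<^bsub>HM\<^esub> to_H1 b \<oplus>\<^bsub>HM\<^esub> (\<Oplus>\<^bsub>HM\<^esub>x\<in>to_H1 ` B. c x \<odot>\<^bsub>HM\<^esub> x)"
    unfolding image_insert using insert.hyps
    by (intro abelian_monoid.finsum_insert[OF abelian_monoid_H1]) (auto simp: smult carrier_H1)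
  also have "(\<Oplus>\<^bsub>HM\<^esub>x\<in>to_H1 ` B. c x \<odot>\<^bsub>HM\<^esub> x) = to_H1 (\<Sum>b\<in>B. fps_of_poly (c (to_H1 b)) *s b)"
    using insert by auto
  finally show ?case using insert.hyps smult[of b] sum by (simp add: add_H1)
qed

text \<open>\<open>?f\<close> and \<open>?g\<close> reindex coefficient families between B and its
  image; restricting both to their index sets makes them mutually inverse, so unique existence
  carries over.\<close>

lemma finite_module_basis_iff:
  assumes B: "finite B" "B \<subseteq> tau_solutions A"
  shows "finite_module_basis F2_poly_ring HM (to_H1 ` B) \<longleftrightarrow>
    (\<forall>Z\<in>tau_solutions A. \<exists>!c. c \<in> B \<rightarrow>\<^sub>E F2_poly \<and> Z = (\<Sum>b\<in>B. fps_of_poly (c b) *s b))"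
proof -
  have inj: "inj_on to_H1 B" using inj_on_subset[OF inj_to_H1 B(2)] .
  let ?P = "\<lambda>Z c. c \<in> B \<rightarrow>\<^sub>E F2_poly \<and> Z = (\<Sum>b\<in>B. fps_of_poly (c b) *s b)"
  let ?P' = "\<lambda>Z c. c \<in> to_H1 ` B \<rightarrow>\<^sub>E F2_poly \<and> to_H1 Z = (\<Oplus>\<^bsub>HM\<^esub>x\<in>to_H1 ` B. c x \<odot>\<^bsub>HM\<^esub> x)"
  let ?f = "\<lambda>c. restrict (\<lambda>b. c (to_H1 b)) B"
  let ?g = "\<lambda>c. restrict (\<lambda>x. c (the_inv_into B to_H1 x)) (to_H1 ` B)"
  have inv: "the_inv_into B to_H1 (to_H1 b) = b" if "b \<in> B" for b
    using the_inv_into_f_f[OF inj that] .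
  have sol: "(\<Sum>b\<in>B. fps_of_poly (c b) *s b) \<in> tau_solutions A" if "c \<in> B \<rightarrow> F2_poly" for c
    using B that
    by (induction B rule: finite_induct) (auto intro!: tau_solutions_0 tau_solutions_add tau_solutions_poly_mult)
  have P': "?P' Z c \<longleftrightarrow> c \<in> to_H1 ` B \<rightarrow>\<^sub>E F2_poly \<and> ?P Z (?f c)" if Z: "Z \<in> tau_solutions A" for Z c
  proof (cases "c \<in> to_H1 ` B \<rightarrow>\<^sub>E F2_poly")
    case True
    then have c: "c \<in> to_H1 ` B \<rightarrow> F2_poly" by auto
    have "(\<Sum>b\<in>B. fps_of_poly (?f c b) *s b) = (\<Sum>b\<in>B. fps_of_poly (c (to_H1 b)) *s b)" by simp
    moreover have "(\<Sum>b\<in>B. fps_of_poly (c (to_H1 b)) *s b) \<in> tau_solutions A" by (rule sol) (use c in auto)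
    ultimately show ?thesis
      unfolding finsum_H1[OF B c] using True inj_onD[OF inj_to_H1 _ Z] by auto
  qed simp
  have "(\<exists>!c. ?P' Z c) \<longleftrightarrow> (\<exists>!c. ?P Z c)" if Z: "Z \<in> tau_solutions A" for Z
  proof -
    have fg: "?f (?g c) = c" if "c \<in> B \<rightarrow>\<^sub>E F2_poly" for c
      using that by (auto simp: fun_eq_iff inv PiE_def extensional_def)
    have gf: "?g (?f c) = c" if "c \<in> to_H1 ` B \<rightarrow>\<^sub>E F2_poly" for c
      using that by (auto simp: fun_eq_iff inv PiE_def extensional_def)
    have g: "?g c \<in> to_H1 ` B \<rightarrow>\<^sub>E F2_poly" if "c \<in> B \<rightarrow>\<^sub>E F2_poly" for c
      using that by (auto simp: inv)
    have 1: "?P' Z (?g c) \<and> ?f (?g c) = c" if c: "?P Z c" for c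
      unfolding P'[OF Z] fg[OF conjunct1[OF c]] using conjunct1[OF c] conjunct2[OF c] g[OF conjunct1[OF c]] by (intro conjI refl)
    have 2: "?P Z (?f c) \<and> ?g (?f c) = c" if c: "?P' Z c" for c
      using iffD1[OF P'[OF Z] c] gf[OF conjunct1[OF c]] by (intro conjI) (elim conjE, assumption)+
    show ?thesis by (rule ex1_transfer[of "?P' Z" "?P Z" ?f ?g, OF 2 1])
  qed
  then have "(\<forall>Z\<in>tau_solutions A. \<exists>!c. ?P' Z c) \<longleftrightarrow> (\<forall>Z\<in>tau_solutions A. \<exists>!c. ?P Z c)"
    by (rule ball_cong[OF refl])
  moreover have "finite (to_H1 ` B)" "to_H1 ` B \<subseteq> to_H1 ` tau_solutions A" using B by auto
  moreover have "carrier F2_poly_ring = (F2_poly :: 'a poly set)" by (simp add: F2_poly_ring_def)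
  moreover have "(\<forall>x\<in>to_H1 ` tau_solutions A. Q x) \<longleftrightarrow> (\<forall>Z\<in>tau_solutions A. Q (to_H1 Z))" for Q
    by blast
  ultimately show ?thesis
    unfolding finite_module_basis_def carrier_H1 by (simp only: simp_thms)
qed

end

section \<open>The rank for the given matrix\<close>

context motive_7p5
begin

definition A :: "'a ^ 2 ^ 2" where "A = vector [vector [a11, a12], vector [a21, 0]]"

lemma tau_solutions_A_iff:
  "Z \<in> tau_solutions A \<longleftrightarrow> Z $ 1 \<in> tate ord \<and> Z $ 2 \<in> tate ord \<and>
     recurrence 0 0 (fps_nth (Z $ 1) 0) (fps_nth (Z $ 2) 0) \<and>
     (\<forall>n. recurrence (fps_nth (Z $ 1) n) (fps_nth (Z $ 2) n) (fps_nth (Z $ 1) (Suc n)) (fps_nth (Z $ 2) (Suc n)))"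
proof -
  have eq4: "((x::'a)\<^sup>2)\<^sup>2 = x ^ 4" for x by (simp flip: power_mult)
  have all_nat: "(\<forall>n. P n) \<longleftrightarrow> P 0 \<and> (\<forall>n. P (Suc n))" for P :: "nat \<Rightarrow> bool"
    by (metis nat.exhaust)
  have split: "(f = (fps_X - fps_const (\<theta>^2)) * tate_tau (tate_tau f) - g) \<longleftrightarrow>
    \<theta>^2 * fps_nth f 0 ^ 4 + fps_nth g 0 + fps_nth f 0 = 0 \<and>
    (\<forall>n. \<theta>^2 * fps_nth f (Suc n) ^ 4 + fps_nth g (Suc n) + fps_nth f (Suc n) = fps_nth f n ^ 4)" for f g :: "'a fps"
  proof -
    have "(f = (fps_X - fps_const (\<theta>^2)) * tate_tau (tate_tau f) - g) \<longleftrightarrow>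
      (\<forall>n. fps_nth f n = (if n = 0 then 0 else fps_nth f (n - 1) ^ 4) - \<theta>^2 * fps_nth f n ^ 4 - fps_nth g n)"
      by (simp add: fps_eq_iff left_diff_distrib tate_tau_nth fps_X_mult_nth eq4)
    also have "\<dots> \<longleftrightarrow> (\<forall>n. \<theta>^2 * fps_nth f n ^ 4 + fps_nth g n + fps_nth f n = (if n = 0 then 0 else fps_nth f (n - 1) ^ 4))"
      by (auto simp: algebra_simps)
    also have "\<dots> \<longleftrightarrow> \<theta>^2 * fps_nth f 0 ^ 4 + fps_nth g 0 + fps_nth f 0 = 0 \<and>
    (\<forall>n. \<theta>^2 * fps_nth f (Suc n) ^ 4 + fps_nth g (Suc n) + fps_nth f (Suc n) = fps_nth f n ^ 4)"
      by (subst all_nat) simp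
    finally show ?thesis .
  qed
  show ?thesis
    unfolding tau_solutions_def mem_Collect_eq forall_2 split
    by (auto simp: A_def sum_2 recurrence_def tate_tau_nth add.assoc mult.commute)
qed

text \<open>The inclusion of \<open>kernel\<close> is \<open>kernel_lifts\<close>: the orders of its
  sequences tend to infinity, so they define elements of the Tate algebra.\<close>

lemma kernel_eq_image: "(\<lambda>w. (w $ 1, w $ 2)) ` fps_vec_const ` tau_solutions A = kernel"
proof (intro equalityI subsetI)
  fix z assume z: "z \<in> kernel"
  obtain f where f: "f 0 = z" "\<And>n. recurrence (fst (f n)) (snd (f n)) (fst (f (Suc n))) (snd (f (Suc n)))"
    "(\<lambda>n. ord (fst (f n))) \<longlonglongrightarrow> \<infinity>" "(\<lambda>n. ord (snd (f n))) \<longlonglongrightarrow> \<infinity>"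
    using kernel_lifts[OF z] by blast
  define Z :: "'a fps ^ 2" where "Z = vector [Abs_fps (\<lambda>n. fst (f n)), Abs_fps (\<lambda>n. snd (f n))]"
  have "Z \<in> tau_solutions A"
    using f z by (auto simp: tau_solutions_A_iff Z_def tate_def kernel_def)
  moreover have "(\<lambda>w. (w $ 1, w $ 2)) (fps_vec_const Z) = z"
    using f(1) by (simp add: fps_vec_const_def Z_def)
  ultimately show "z \<in> (\<lambda>w. (w $ 1, w $ 2)) ` fps_vec_const ` tau_solutions A" by blast
qed (auto simp: tau_solutions_A_iff fps_vec_const_def kernel_def)

lemma card_const_tau_solutions: "card (fps_vec_const ` tau_solutions A) = 16"
proof -
  have "inj_on (\<lambda>w. (w $ 1, w $ 2)) (fps_vec_const ` tau_solutions A)"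
    by (rule inj_onI) (auto simp: vec_eq_iff forall_2)
  from card_image[OF this] show ?thesis unfolding kernel_eq_image card_kernel ..
qed

text \<open>U lies beyond the orders of all nonzero coordinates of \<open>kernel\<close>. If every
  coefficient is in U, the constant term vanishes; the next coefficient then solves the recurrence
  with X = Y = 0 and vanishes too, and so on.\<close>

lemma tau_lattice_solutions: "\<exists>U. tau_lattice ord \<theta> (tau_solutions A) U"
proof -
  have fin: "finite (fps_vec_const ` tau_solutions A)"
    using card_const_tau_solutions by (metis card.infinite zero_neq_numeral)
  have fin_kernel: "finite kernel" using card_kernel by (metis card.infinite zero_neq_numeral)
  define T where "T = fst ` kernel \<union> snd ` kernel"
  \<comment> \<open>\<open>real_of_ereal\<close> turns the infinite order of the coordinate 0 into
    0, so the maximum is not affected by it.\<close>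
  define K where "K = Max (insert 0 ((\<lambda>x. real_of_ereal (ord x)) ` T))"
  define U where "U = {x. ereal K < ord x}"
  have T: "x = 0" if "x \<in> T" "x \<in> U" for x
  proof (rule ccontr)
    assume "x \<noteq> 0"
    then obtain a where a: "ord x = ereal a" by (rule ord_nonzero)
    have "real_of_ereal (ord x) \<le> K" unfolding K_def
      by (rule Max_ge) (use fin_kernel that(1) in \<open>auto simp: T_def\<close>)
    then show False using that(2) a by (simp add: U_def)
  qed
  have zero: "x = 0 \<and> y = 0" if "recurrence 0 0 x y" "x \<in> U" "y \<in> U" for x y
    using that T[of x] T[of y] by (force simp: T_def kernel_def)
  have "tau_lattice ord \<theta> (tau_solutions A) U"
  proof
    fix Z :: "'a fps ^ 2" assume Z: "Z \<in> tau_solutions A"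
    have "\<forall>\<^sub>F j in sequentially. \<forall>k. fps_nth (Z $ k) j \<in> U"
      unfolding forall_2 using Z by (intro eventually_conj) (auto simp: tau_solutions_A_iff tate_iff U_def)
    then show "\<exists>n. \<forall>j\<ge>n. \<forall>k. fps_nth (Z $ k) j \<in> U" by (simp add: eventually_sequentially)
  next
    fix Z :: "'a fps ^ 2" assume Z: "Z \<in> tau_solutions A" "\<And>j k. fps_nth (Z $ k) j \<in> U"
    have "fps_nth (Z $ 1) n = 0 \<and> fps_nth (Z $ 2) n = 0" for n
    proof (induction n)
      case 0
      show ?case using Z by (intro zero) (auto simp: tau_solutions_A_iff)
    next
      case (Suc n)
      have "recurrence (fps_nth (Z $ 1) n) (fps_nth (Z $ 2) n) (fps_nth (Z $ 1) (Suc n)) (fps_nth (Z $ 2) (Suc n))"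
        using Z(1) by (simp add: tau_solutions_A_iff)
      then show ?case using Suc Z(2) by (intro zero) auto
    qed
    then show "Z = 0" by (simp add: vec_eq_iff forall_2 fps_eq_iff)
  qed (auto simp: tau_solutions_0 tau_solutions_add tau_solutions_X_mult_iff fin U_def intro: ord_add_gt)
  then show ?thesis ..
qed

text \<open>\<open>free_module_rank\<close> is a definite description, so every finite basis must be
  considered. Each one is the image of a basis B of solutions, for which 2 ^ card B = 16.\<close>

theorem h1_eq_4: "h1 ord \<theta> A = 4"
proof -
  interpret M: motive ord \<theta> A by unfold_locales
  obtain U where "tau_lattice ord \<theta> (tau_solutions A) U" using tau_lattice_solutions by blast
  then interpret L: tau_lattice ord \<theta> "tau_solutions A" U .
  have iff: "finite_module_basis F2_poly_ring M.HM (M.to_H1 ` B) \<longleftrightarrow> L.is_basis B"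
    if "finite B" "B \<subseteq> tau_solutions A" for B
    unfolding M.finite_module_basis_iff[OF that] L.is_basis_def L.comb_def using that by simp
  have card: "card (M.to_H1 ` B) = card B" if "B \<subseteq> tau_solutions A" for B
    by (rule card_image[OF inj_on_subset[OF M.inj_to_H1 that]])
  have four: "card B = 4" if "L.is_basis B" for B
  proof -
    have "(2::nat) ^ card B = 2 ^ 4" using L.basis_card[OF that] card_const_tau_solutions by simp
    then show ?thesis by (simp only: power_inject_exp)
  qed
  show ?thesis
    unfolding h1_def free_module_rank_def
  proof (rule the_equality)
    obtain B where B: "L.is_basis B" using L.basis_exists by blast
    then have "finite B" "B \<subseteq> tau_solutions A" by (auto simp: L.is_basis_def)
    then show "\<exists>B. finite_module_basis F2_poly_ring M.HM B \<and> card B = 4"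
      using iff card four[OF B] B by metis
  next
    fix n assume "\<exists>B. finite_module_basis F2_poly_ring M.HM B \<and> card B = n"
    then obtain B' where B': "finite_module_basis F2_poly_ring M.HM B'" "card B' = n" by blast
    then have "finite B'" "B' \<subseteq> M.to_H1 ` tau_solutions A"
      by (auto simp: finite_module_basis_def M.carrier_H1)
    then obtain B where B: "finite B" "B \<subseteq> tau_solutions A" "B' = M.to_H1 ` B"
      by (metis finite_subset_image)
    then show "n = 4" using iff[OF B(1,2)] card[OF B(2)] four B' by simp
  qed
qed

end

theorem proposition7p5:
  fixes ord :: "'a::field \<Rightarrow> ereal" and \<theta> a11 a12 a21 :: 'a and u v :: real
  assumes "C_infinity ord \<theta>"
    and "ord a11 = -1"
    and "a12 \<noteq> 0" and "a21 \<noteq> 0"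
    and "ord a12 = ereal u" and "ord a21 = ereal v"
    and "v \<le> -4/3"
    and "-2*u - 4 \<le> v" and "v \<le> -2*u - 3"
  shows "h1 ord \<theta> (vector [vector [a11, a12], vector [a21, 0]]) = 4"
proof -
  have "motive_7p5 ord \<theta> a11 a12 a21 u v"
    using assms by (simp add: motive_7p5_def motive_7p5_axioms_def)
  then interpret motive_7p5 ord \<theta> a11 a12 a21 u v .
  show ?thesis using h1_eq_4 unfolding A_def .
qed

end
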